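(* Let $G$ be a virtually RFRS group of type $\mathtt{FP}(\mathbb{Q})$ such that the group ring $\mathbb{Z}G$ is Noetherian. Then $G$ is virtually Abelian.
   Context: A group $G$ is RFRS (residually finite rationally solvable) if there is a chain $G = G_0 \geqslant G_1 \geqslant G_2 \geqslant \cdots$ of finite-index normal subgroups of $G$ with $\bigcap_{i \geqslant 0} G_i = \{1\}$ and $\ker(G_i \rightarrow \mathbb{Q} \otimes_{\mathbb{Z}} G_i^{\mathsf{ab}}) \leqslant G_{i+1}$ for every $i \geqslant 0$, where $G_i^{\mathsf{ab}} = G_i/[G_i,G_i]$ and the map is $g \mapsto 1 \otimes g[G_i,G_i]$. A group is virtually RFRS if it has a finite-index subgroup that is RFRS. A group $G$ is of type $\mathtt{FP}(\mathbb{Q})$ if the trivial left $\mathbb{Q}G$-module $\mathbb{Q}$ has a finite-length resolution $0 \to P_n \to \cdots \to P_0 \to \mathbb{Q} \to 0$ by finitely generated projective left $\mathbb{Q}G$-modules. A ring is Noetherian if all of its left ideals are finitely generated (for integral group rings, left and right Noetherian are equivalent via $g \mapsto g^{-1}$). A group is virtually Abelian if it has an Abelian subgroup of finite index. *)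

theory Defs
  imports "HOL-Algebra.Algebra"
begin

section \<open>Group rings\<close>

text \<open>The coefficients are drawn from a type class; elements are finitely supported functions that
  vanish outside the carrier of the group.\<close>

definition group_ring :: "('g, 'm) monoid_scheme \<Rightarrow> ('g \<Rightarrow> 'c::comm_ring_1) ring" where
  "group_ring G =
    \<lparr>carrier = {f. finite {x. f x \<noteq> 0} \<and> {x. f x \<noteq> 0} \<subseteq> carrier G},
     monoid.mult =
       (\<lambda>f g x. \<Sum>(h, k) \<in> {(h, k). f h \<noteq> 0 \<and> g k \<noteq> 0 \<and> h \<otimes>\<^bsub>G\<^esub> k = x}. f h * g k),
     one = (\<lambda>x. if x = \<one>\<^bsub>G\<^esub> then 1 else 0),
     ring.zero = (\<lambda>x. 0),
     ring.add = (\<lambda>f g x. f x + g x)\<rparr>"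

abbreviation integral_group_ring :: "('g, 'm) monoid_scheme \<Rightarrow> ('g \<Rightarrow> int) ring" where
  "integral_group_ring G \<equiv> group_ring G"

abbreviation rational_group_ring :: "('g, 'm) monoid_scheme \<Rightarrow> ('g \<Rightarrow> rat) ring" where
  "rational_group_ring G \<equiv> group_ring G"


section \<open>Left Noetherian rings\<close>

text \<open>\<^const>\<open>ideal\<close> and \<^const>\<open>noetherian_ring\<close> are about two-sided ideals, hence unsuitable
  for the noncommutative rings considered here.\<close>

locale left_ideal = additive_subgroup I R + ring R for I and R (structure) +
  assumes l_closed: "\<lbrakk>a \<in> I; x \<in> carrier R\<rbrakk> \<Longrightarrow> x \<otimes> a \<in> I"

definition fg_left_ideal :: "'a set \<Rightarrow> ('a, 'm) ring_scheme \<Rightarrow> bool" where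
  "fg_left_ideal I R \<longleftrightarrow>
    (\<exists>A. finite A \<and> A \<subseteq> carrier R \<and> I = \<Inter>{J. left_ideal J R \<and> A \<subseteq> J})"

definition left_noetherian :: "('a, 'm) ring_scheme \<Rightarrow> bool" where
  "left_noetherian R \<longleftrightarrow> ring R \<and> (\<forall>I. left_ideal I R \<longrightarrow> fg_left_ideal I R)"


section \<open>Left modules over arbitrary rings\<close>

text \<open>The library locale \<^locale>\<open>module\<close> with commutativity of the scalars dropped. The fields
  \<^const>\<open>monoid.mult\<close> and \<^const>\<open>one\<close> of a module record play no role.\<close>

locale left_module = R?: ring R + M?: abelian_group M
  for R :: "('a, 'r) ring_scheme" (structure) and M :: "('a, 'b, 'm) module_scheme" (structure) +
  assumes smult_closed:
      "\<lbrakk>a \<in> carrier R; x \<in> carrier M\<rbrakk> \<Longrightarrow> a \<odot>\<^bsub>M\<^esub> x \<in> carrier M"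
    and smult_l_distr:
      "\<lbrakk>a \<in> carrier R; b \<in> carrier R; x \<in> carrier M\<rbrakk> \<Longrightarrow>
        (a \<oplus> b) \<odot>\<^bsub>M\<^esub> x = a \<odot>\<^bsub>M\<^esub> x \<oplus>\<^bsub>M\<^esub> b \<odot>\<^bsub>M\<^esub> x"
    and smult_r_distr:
      "\<lbrakk>a \<in> carrier R; x \<in> carrier M; y \<in> carrier M\<rbrakk> \<Longrightarrow>
        a \<odot>\<^bsub>M\<^esub> (x \<oplus>\<^bsub>M\<^esub> y) = a \<odot>\<^bsub>M\<^esub> x \<oplus>\<^bsub>M\<^esub> a \<odot>\<^bsub>M\<^esub> y"
    and smult_assoc:
      "\<lbrakk>a \<in> carrier R; b \<in> carrier R; x \<in> carrier M\<rbrakk> \<Longrightarrow>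
        (a \<otimes> b) \<odot>\<^bsub>M\<^esub> x = a \<odot>\<^bsub>M\<^esub> (b \<odot>\<^bsub>M\<^esub> x)"
    and smult_one: "x \<in> carrier M \<Longrightarrow> \<one> \<odot>\<^bsub>M\<^esub> x = x"

definition left_module_hom ::
    "('a, 'r) ring_scheme \<Rightarrow> ('a, 'b, 'm) module_scheme \<Rightarrow> ('a, 'c, 'n) module_scheme
      \<Rightarrow> ('b \<Rightarrow> 'c) set" where
  "left_module_hom R M N =
    {f \<in> carrier M \<rightarrow> carrier N.
       (\<forall>x\<in>carrier M. \<forall>y\<in>carrier M. f (x \<oplus>\<^bsub>M\<^esub> y) = f x \<oplus>\<^bsub>N\<^esub> f y) \<and>
       (\<forall>a\<in>carrier R. \<forall>x\<in>carrier M. f (a \<odot>\<^bsub>M\<^esub> x) = a \<odot>\<^bsub>N\<^esub> f x)}"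

definition fg_left_module :: "('a, 'r) ring_scheme \<Rightarrow> ('a, 'b) module \<Rightarrow> bool" where
  "fg_left_module R M \<longleftrightarrow>
    (\<exists>A. finite A \<and> A \<subseteq> carrier M \<and> carrier M = \<Inter>{N. submodule N R M \<and> A \<subseteq> N})"

text \<open>The test modules in the lifting property necessarily live in a type, namely the element type
  of \<open>P\<close>. For a finitely generated module \<open>P\<close> this is no restriction as soon as every finitely
  generated free \<open>R\<close>-module is isomorphic to one with elements of that type: lifting the identity
  of \<open>P\<close> along a surjection from such a free module then exhibits \<open>P\<close> as a direct summand of it.\<close>

definition projective_left_module :: "('a, 'r) ring_scheme \<Rightarrow> ('a, 'b) module \<Rightarrow> bool" where
  "projective_left_module R P \<longleftrightarrow>
    (\<forall>(M :: ('a, 'b) module) (N :: ('a, 'b) module) f g.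
       left_module R M \<and> left_module R N \<and>
       f \<in> left_module_hom R M N \<and> f ` carrier M = carrier N \<and>
       g \<in> left_module_hom R P N \<longrightarrow>
       (\<exists>h\<in>left_module_hom R P M. \<forall>x\<in>carrier P. f (h x) = g x))"


section \<open>Groups of type FP over the rationals\<close>

definition trivial_rational_module :: "('g \<Rightarrow> rat, rat) module" where
  "trivial_rational_module =
    \<lparr>carrier = UNIV, monoid.mult = (*), one = 1, ring.zero = 0, ring.add = (+),
     smult = (\<lambda>a q. (\<Sum>g | a g \<noteq> 0. a g) * q)\<rparr>"

text \<open>A resolution of length \<open>n\<close> is given as an infinite one that vanishes beyond degree \<open>n\<close>.
  The elements of \<open>P i\<close> are taken from the type \<^typ>\<open>nat \<Rightarrow> 'g \<Rightarrow> rat\<close>. Since it accommodates all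
  finite powers of the rational group ring, and every finitely generated module is isomorphic
  to one with elements of this type, this loses no generality.\<close>

definition type_FP_rat :: "('g, 'm) monoid_scheme \<Rightarrow> bool" where
  "type_FP_rat G \<longleftrightarrow>
    (\<exists>(n :: nat) (P :: nat \<Rightarrow> ('g \<Rightarrow> rat, nat \<Rightarrow> 'g \<Rightarrow> rat) module) d \<epsilon>.
       (\<forall>i. left_module (rational_group_ring G) (P i) \<and>
            fg_left_module (rational_group_ring G) (P i) \<and>
            projective_left_module (rational_group_ring G) (P i)) \<and>
       (\<forall>i>n. carrier (P i) = {\<zero>\<^bsub>P i\<^esub>}) \<and>
       (\<forall>i. d i \<in> left_module_hom (rational_group_ring G) (P (Suc i)) (P i)) \<and>
       \<epsilon> \<in> left_module_hom (rational_group_ring G) (P 0) trivial_rational_module \<and>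
       (\<forall>i. d (Suc i) ` carrier (P (Suc (Suc i))) =
            {x \<in> carrier (P (Suc i)). d i x = \<zero>\<^bsub>P i\<^esub>}) \<and>
       d 0 ` carrier (P 1) =
         {x \<in> carrier (P 0). \<epsilon> x = \<zero>\<^bsub>trivial_rational_module :: ('g \<Rightarrow> rat, rat) module\<^esub>} \<and>
       \<epsilon> ` carrier (P 0) = carrier (trivial_rational_module :: ('g \<Rightarrow> rat, rat) module))"


section \<open>Tensor products of abelian groups\<close>

text \<open>The tensor product over the integers: formal sums of pairs modulo biadditivity. The abelian
  groups \<open>A\<close> and \<open>B\<close> are written multiplicatively, formal sums additively.\<close>

definition tensor_relations ::
    "('a, 'm) monoid_scheme \<Rightarrow> ('b, 'n) monoid_scheme \<Rightarrow> ('a \<times> 'b \<Rightarrow>\<^sub>0 int) set" where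
  "tensor_relations A B =
    {frag_of (a \<otimes>\<^bsub>A\<^esub> a', b) - frag_of (a, b) - frag_of (a', b) | a a' b.
       a \<in> carrier A \<and> a' \<in> carrier A \<and> b \<in> carrier B} \<union>
    {frag_of (a, b \<otimes>\<^bsub>B\<^esub> b') - frag_of (a, b) - frag_of (a, b') | a b b'.
       a \<in> carrier A \<and> b \<in> carrier B \<and> b' \<in> carrier B}"

definition tensor_kernel ::
    "('a, 'm) monoid_scheme \<Rightarrow> ('b, 'n) monoid_scheme \<Rightarrow> ('a \<times> 'b \<Rightarrow>\<^sub>0 int) set" where
  "tensor_kernel A B =
    generate (free_Abelian_group (carrier A \<times> carrier B)) (tensor_relations A B)"

definition tensor_group ::
    "('a, 'm) monoid_scheme \<Rightarrow> ('b, 'n) monoid_scheme \<Rightarrow> ('a \<times> 'b \<Rightarrow>\<^sub>0 int) set monoid" where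
  "tensor_group A B = free_Abelian_group (carrier A \<times> carrier B) Mod tensor_kernel A B"

definition pure_tensor ::
    "('a, 'm) monoid_scheme \<Rightarrow> ('b, 'n) monoid_scheme \<Rightarrow> 'a \<Rightarrow> 'b \<Rightarrow> ('a \<times> 'b \<Rightarrow>\<^sub>0 int) set" where
  "pure_tensor A B a b =
    tensor_kernel A B #>\<^bsub>free_Abelian_group (carrier A \<times> carrier B)\<^esub> frag_of (a, b)"


section \<open>RFRS groups\<close>

definition rational_group :: "rat monoid" where
  "rational_group = \<lparr>carrier = UNIV, monoid.mult = (+), one = 0\<rparr>"

definition abelianization :: "('g, 'm) monoid_scheme \<Rightarrow> 'g set monoid" where
  "abelianization G = G Mod derived G (carrier G)"

definition rational_abelianization ::
    "('g, 'm) monoid_scheme \<Rightarrow> (rat \<times> 'g set \<Rightarrow>\<^sub>0 int) set monoid" where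
  "rational_abelianization G = tensor_group rational_group (abelianization G)"

definition rational_abelianization_map ::
    "('g, 'm) monoid_scheme \<Rightarrow> 'g \<Rightarrow> (rat \<times> 'g set \<Rightarrow>\<^sub>0 int) set" where
  "rational_abelianization_map G g =
    pure_tensor rational_group (abelianization G) 1 (derived G (carrier G) #>\<^bsub>G\<^esub> g)"

abbreviation restrict_group :: "('g, 'm) monoid_scheme \<Rightarrow> 'g set \<Rightarrow> ('g, 'm) monoid_scheme" where
  "restrict_group G H \<equiv> G\<lparr>carrier := H\<rparr>"

definition finite_index_subgroup :: "'g set \<Rightarrow> ('g, 'm) monoid_scheme \<Rightarrow> bool" where
  "finite_index_subgroup H G \<longleftrightarrow> subgroup H G \<and> finite (rcosets\<^bsub>G\<^esub> H)"

definition RFRS :: "('g, 'm) monoid_scheme \<Rightarrow> bool" where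
  "RFRS G \<longleftrightarrow> group G \<and>
    (\<exists>C :: nat \<Rightarrow> 'g set.
       C 0 = carrier G \<and>
       (\<forall>i. C i \<lhd> G \<and> finite_index_subgroup (C i) G \<and> C (Suc i) \<subseteq> C i) \<and>
       (\<Inter>i. C i) = {\<one>\<^bsub>G\<^esub>} \<and>
       (\<forall>i. kernel (restrict_group G (C i)) (rational_abelianization (restrict_group G (C i)))
              (rational_abelianization_map (restrict_group G (C i))) \<subseteq> C (Suc i)))"

definition virtually_RFRS :: "('g, 'm) monoid_scheme \<Rightarrow> bool" where
  "virtually_RFRS G \<longleftrightarrow> (\<exists>H. finite_index_subgroup H G \<and> RFRS (restrict_group G H))"

definition virtually_abelian :: "('g, 'm) monoid_scheme \<Rightarrow> bool" where
  "virtually_abelian G \<longleftrightarrow> (\<exists>H. finite_index_subgroup H G \<and> comm_group (restrict_group G H))"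

end

theory Submission
  imports Defs "HOL-Library.Function_Algebras"
begin

text \<open>The theorem reduces to a bound on first Betti numbers. Let \<open>C\<^sub>0 \<ge> C\<^sub>1 \<ge> \<dots>\<close> be an RFRS chain and
  suppose that the numbers \<open>b\<^sub>1(C\<^sub>i)\<close> are bounded. Choose \<open>i\<close> with \<open>b\<^sub>1(C\<^sub>i)\<close> maximal. For \<open>j \<ge> i\<close> the
  inclusion \<open>C\<^sub>j \<le> C\<^sub>i\<close> of finite index is then injective on rational abelianizations, so an element of
  \<open>C\<^sub>j\<close> that is torsion in the abelianization of \<open>C\<^sub>i\<close> is already torsion in that of \<open>C\<^sub>j\<close>, and the
  RFRS condition puts it into \<open>C\<^bsub>j+1\<^esub>\<close>. By induction all these elements lie in the intersection of the
  chain, which is trivial. In particular \<open>[C\<^sub>i, C\<^sub>i]\<close> is trivial: \<open>C\<^sub>i\<close> is abelian and has finite index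
  (\<open>RFRS_bounded_towers\<close>).

  The bound is the length \<open>n\<close> of a projective resolution \<open>P\<close> of \<open>\<rat>\<close> over \<open>\<rat>G\<close>. Let \<open>K\<close> be a subgroup
  of \<open>G\<close> and \<open>t\<^sub>1, \<dots>, t\<^sub>m\<close> elements of \<open>K\<close> that are linearly independent in \<open>\<rat> \<otimes> K\<^sup>a\<^sup>b\<close>. They give a
  tower \<open>L\<^sub>0 = [K, K]\<close>, \<open>L\<^bsub>i+1\<^esub> = L\<^sub>i\<langle>t\<^bsub>i+1\<^esub>\<rangle>\<close> of subgroups with infinite cyclic quotients. It is shown
  that \<open>H\<^sub>i(L\<^sub>i; \<rat>)\<close> contains a nonzero class fixed by \<open>t\<^bsub>i+1\<^esub>, \<dots>, t\<^sub>m\<close>; hence \<open>P\<^sub>m\<close> is nonzero and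
  \<open>m \<le> n\<close> (\<open>tower_length_le\<close>). In degree \<open>0\<close> this is the class of an element of augmentation \<open>1\<close>. In the
  step from \<open>i\<close> to \<open>i + 1\<close>, the Wang sequence of \<open>L\<^sub>i \<lhd> L\<^bsub>i+1\<^esub>\<close> says that
  \<open>H\<^bsub>i+1\<^esub>(L\<^bsub>i+1\<^esub>) \<rightarrow> H\<^sub>i(L\<^sub>i) \<rightarrow> H\<^sub>i(L\<^sub>i)\<close> is exact, the second map being \<open>t\<^bsub>i+1\<^esub> - 1\<close>. So the
  given class lifts to degree \<open>i + 1\<close>, but the lift need not be fixed by the remaining \<open>t\<^sub>k\<close>. If the
  space \<open>H\<^bsub>i+1\<^esub>(L\<^bsub>i+1\<^esub>)\<close> has finite dimension, then multiplying the lift by suitable polynomials in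
  the \<open>t\<^sub>k - 1\<close> makes it fixed without annihilating it (\<open>simultaneous_fixed_class\<close>, \<open>chase_step\<close>).

  The Noetherian hypothesis gives this finiteness: it passes from \<open>\<int>G\<close> to \<open>\<rat>L\<close> for every subgroup
  \<open>L\<close> (\<open>submodule_fg\<close>), so \<open>\<rat>\<close> has a resolution by finitely generated free \<open>\<rat>L\<close>-modules, and comparing
  it with \<open>P\<close> shows that all \<open>H\<^sub>i(L; \<rat>)\<close> have finite dimension (\<open>finite_codim_bd\<close>).

  All modules are realized inside the functions \<open>\<nat> \<times> G \<rightarrow> \<rat>\<close>, and homology is never formed as a quotient:
  a class is an element of \<open>P\<^sub>i\<close>, considered modulo boundaries and modulo the kernel of the projection to
  \<open>L\<close>-coinvariants.\<close>

section \<open>Commuting operators modulo a subspace of finite codimension\<close>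

locale rational_space = vector_space scale
  for scale :: "rat \<Rightarrow> 'b::ab_group_add \<Rightarrow> 'b" (infixr "*s" 75)
begin

text \<open>States without quotient spaces that \<open>M\<close> has finite dimension modulo \<open>U\<close>: every sequence in \<open>M\<close> is
  linearly dependent modulo \<open>U\<close>.\<close>

definition finite_codim :: "'b set \<Rightarrow> 'b set \<Rightarrow> bool" where
  "finite_codim U M \<longleftrightarrow> (\<forall>v :: nat \<Rightarrow> 'b. (\<forall>k. v k \<in> M) \<longrightarrow>
     (\<exists>N a. (\<exists>k\<le>N. a k \<noteq> 0) \<and> (\<Sum>k\<le>N. a k *s v k) \<in> U))"

text \<open>In the application \<open>x s\<close> is the operator \<open>s - 1\<close>, \<open>C\<close> consists of cycles and \<open>U\<close> of boundaries, so
  that the conclusion produces a nonzero homology class fixed by all \<open>s\<close>. Finite dimension modulo \<open>U\<close>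
  yields a polynomial \<open>p\<close> with \<open>p(x s) b \<in> U\<close>. Write \<open>p = X\<^sup>M q\<close> where \<open>q\<close> has constant term \<open>1\<close>: then
  \<open>q(x s) b\<close> is killed by a power of \<open>x s\<close> modulo \<open>U\<close>, and it still lies in the coset \<open>b0 + W\<close>, hence
  outside \<open>U\<close>. Since the operators commute modulo \<open>U\<close>, this can be done for all \<open>s\<close> one after the other;
  afterwards one applies each \<open>x s\<close> as often as possible without entering \<open>U\<close>.\<close>

lemma simultaneous_fixed_class:
  fixes x :: "'s \<Rightarrow> 'b \<Rightarrow> 'b"
  assumes "finite S"
    and C: "subspace C" and U: "subspace U" and W: "subspace W" "W \<subseteq> C" and b0: "b0 \<in> C"
    and add: "\<And>s u v. s \<in> S \<Longrightarrow> x s (u + v) = x s u + x s v"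
    and scl: "\<And>s a u. s \<in> S \<Longrightarrow> x s (a *s u) = a *s x s u"
    and xb: "\<And>s. s \<in> S \<Longrightarrow> x s b0 \<in> W" and xW: "\<And>s v. s \<in> S \<Longrightarrow> v \<in> W \<Longrightarrow> x s v \<in> W"
    and xC: "\<And>s v. s \<in> S \<Longrightarrow> v \<in> C \<Longrightarrow> x s v \<in> C"
    and xU: "\<And>s v. s \<in> S \<Longrightarrow> v \<in> U \<Longrightarrow> x s v \<in> U"
    and comm: "\<And>s s' v. s \<in> S \<Longrightarrow> s' \<in> S \<Longrightarrow> v \<in> C \<Longrightarrow> x s (x s' v) - x s' (x s v) \<in> U"
    and disj: "\<And>w. w \<in> W \<Longrightarrow> b0 + w \<notin> U"
    and fin: "finite_codim U C"
  shows "\<exists>b\<in>C. b \<notin> U \<and> (\<forall>s\<in>S. x s b \<in> U)"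
proof -
  define nil where "nil s = {v \<in> C. \<exists>M. (x s ^^ M) v \<in> U}" for s
  have x_pow_C: "(x s ^^ k) v \<in> C" if "s \<in> S" "v \<in> C" for s k v
    by (induction k) (auto simp: that xC)
  have x_pow_U: "(x s ^^ k) v \<in> U" if "s \<in> S" "v \<in> U" for s k v
    by (induction k) (auto simp: that xU)
  have x_pow_add: "(x s ^^ k) (u + v) = (x s ^^ k) u + (x s ^^ k) v" if "s \<in> S" for s k u v
    by (induction k) (auto simp: that add)
  have x_pow_scl: "(x s ^^ k) (a *s v) = a *s (x s ^^ k) v" if "s \<in> S" for s k a v
    by (induction k) (auto simp: that scl)
  have x_zero: "x s 0 = 0" if "s \<in> S" for s using add[OF that, of 0 0] by simp
  have x_diff: "x s (u - v) = x s u - x s v" if "s \<in> S" for s u v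
    using add[OF that, of "u - v" v] by (simp add: algebra_simps)
  have x_pow_comm: "(x s' ^^ M) (x s v) - x s ((x s' ^^ M) v) \<in> U"
    if "s \<in> S" "s' \<in> S" "v \<in> C" for s s' v M
  proof (induction M)
    case 0
    show ?case using subspace_0[OF U] by simp
  next
    case (Suc M)
    have "x s' ((x s' ^^ M) (x s v) - x s ((x s' ^^ M) v)) \<in> U"
      using Suc xU that by blast
    then have "x s' ((x s' ^^ M) (x s v)) - x s' (x s ((x s' ^^ M) v)) \<in> U"
      using x_diff that by simp
    moreover have "x s' (x s ((x s' ^^ M) v)) - x s (x s' ((x s' ^^ M) v)) \<in> U"
      using comm x_pow_C that by blast
    ultimately show ?case using subspace_add[OF U] by fastforce
  qed
  have nil_x: "x s v \<in> nil s'" if s: "s \<in> S" "s' \<in> S" and v: "v \<in> nil s'" for s s' v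
  proof -
    obtain M where M: "v \<in> C" "(x s' ^^ M) v \<in> U" using v by (auto simp: nil_def)
    have "(x s' ^^ M) (x s v) = ((x s' ^^ M) (x s v) - x s ((x s' ^^ M) v)) + x s ((x s' ^^ M) v)" by simp
    also have "\<dots> \<in> U" using x_pow_comm[OF s M(1)] xU[OF s(1) M(2)] subspace_add[OF U] by blast
    finally show ?thesis using M xC s by (auto simp: nil_def)
  qed
  have nil_subspace: "subspace (nil s)" if s: "s \<in> S" for s
  proof (rule subspaceI)
    show "0 \<in> nil s" using subspace_0[OF U] subspace_0[OF C]
      by (auto simp: nil_def intro: exI[of _ 0])
  next
    fix u v assume "u \<in> nil s" "v \<in> nil s"
    then obtain M M' where M: "u \<in> C" "v \<in> C" "(x s ^^ M) u \<in> U" "(x s ^^ M') v \<in> U"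
      by (auto simp: nil_def)
    have "(x s ^^ (M' + M)) u \<in> U" using x_pow_U[OF s M(3)] by (simp add: funpow_add)
    moreover have "(x s ^^ (M' + M)) v \<in> U"
      using x_pow_U[OF s M(4), of M] by (simp add: funpow_add add.commute[of M'])
    ultimately have "(x s ^^ (M' + M)) (u + v) \<in> U"
      using subspace_add[OF U] x_pow_add[OF s] by simp
    then show "u + v \<in> nil s" using M subspace_add[OF C] unfolding nil_def by blast
  next
    fix c v assume "v \<in> nil s"
    then obtain M where "v \<in> C" "(x s ^^ M) v \<in> U" by (auto simp: nil_def)
    then have "c *s v \<in> C" "(x s ^^ M) (c *s v) \<in> U"
      using subspace_scale[OF C] subspace_scale[OF U] x_pow_scl[OF s] by auto
    then show "c *s v \<in> nil s" unfolding nil_def by blast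
  qed
  have step1: "\<exists>w\<in>W. \<forall>s\<in>T. b0 + w \<in> nil s" if "finite T" "T \<subseteq> S" for T
    using that
  proof (induction T rule: finite_induct)
    case empty
    then show ?case using subspace_0[OF W(1)] by auto
  next
    case (insert s T)
    then obtain w where w: "w \<in> W" "\<And>s. s \<in> T \<Longrightarrow> b0 + w \<in> nil s" by auto
    have s: "s \<in> S" using insert by simp
    define b where "b = b0 + w"
    have b: "b \<in> C" using b0 W w subspace_add[OF C] by (auto simp: b_def)
    have "x s b \<in> W" using xb xW s w(1) add subspace_add[OF W(1)] by (simp add: b_def)
    then have bW: "(x s ^^ k) b \<in> W" if k: "k > 0" for k
    proof -
      obtain k' where "k = Suc k'" using k by (cases k) auto
      moreover have "(x s ^^ Suc k') b \<in> W"
        using \<open>x s b \<in> W\<close> by (induction k') (auto simp: s xW)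
      ultimately show ?thesis by simp
    qed
    obtain N a where a: "\<exists>k\<le>N. a k \<noteq> 0" "(\<Sum>k\<le>N. a k *s (x s ^^ k) b) \<in> U"
      using fin[unfolded finite_codim_def, rule_format, of "\<lambda>k. (x s ^^ k) b", OF x_pow_C[OF s b]]
      by blast
    define M where "M = (LEAST k. a k \<noteq> 0)"
    obtain k0 where k0: "k0 \<le> N" "a k0 \<noteq> 0" using a(1) by blast
    have "a M \<noteq> 0" unfolding M_def using k0(2) by (rule LeastI)
    moreover have "M \<le> k0" unfolding M_def using k0(2) by (rule Least_le)
    moreover have "a k = 0" if "k < M" for k using not_less_Least[OF that[unfolded M_def]] by simp
    ultimately have M: "a M \<noteq> 0" "M \<le> N" "\<And>k. k < M \<Longrightarrow> a k = 0"
      using k0(1) by auto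
    \<comment> \<open>\<open>b + w'\<close> is the relation divided by \<open>a M\<close> and by the \<open>M\<close>-th power of the operator\<close>
    define w' where "w' = (\<Sum>k\<in>{M<..N}. (a k / a M) *s (x s ^^ (k - M)) b)"
    have w'W: "w' \<in> W" unfolding w'_def
      by (intro subspace_sum[OF W(1)] subspace_scale[OF W(1)] bW) auto
    have split: "{..N} = {..<M} \<union> ({M} \<union> {M<..N})" using M(2) by auto
    have x_pow_sum: "(x s ^^ M) (\<Sum>k\<in>A. f k) = (\<Sum>k\<in>A. (x s ^^ M) (f k))" if "finite A"
      for A :: "nat set" and f
    proof -
      have zero: "(x s ^^ M) 0 = 0" by (induction M) (simp_all add: x_zero s)
      show ?thesis using that by (induction A rule: finite_induct) (simp_all add: x_pow_add s zero)
    qed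
    have shift: "(x s ^^ M) ((x s ^^ (k - M)) b) = (x s ^^ k) b" if "k \<in> {M<..N}" for k
      using that funpow_add[of M "k - M" "x s"] by simp
    have "a M *s (x s ^^ M) (b + w')
        = a M *s (x s ^^ M) b + (\<Sum>k\<in>{M<..N}. a M *s ((a k / a M) *s (x s ^^ k) b))"
      unfolding w'_def
      by (simp add: x_pow_add s x_pow_sum x_pow_scl scale_right_distrib scale_sum_right shift
          del: scale_scale)
    also have "\<dots> = a M *s (x s ^^ M) b + (\<Sum>k\<in>{M<..N}. a k *s (x s ^^ k) b)"
      using M(1) by simp
    also have "\<dots> = (\<Sum>k\<in>{M..N}. a k *s (x s ^^ k) b)"
      using M(2) by (simp add: sum.head)
    also have "\<dots> = (\<Sum>k\<le>N. a k *s (x s ^^ k) b)"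
      by (rule sum.mono_neutral_left) (auto simp: M(3))
    finally have "a M *s (x s ^^ M) (b + w') \<in> U" using a(2) by simp
    then have "(1 / a M) *s (a M *s (x s ^^ M) (b + w')) \<in> U" using subspace_scale[OF U] by blast
    then have "(x s ^^ M) (b + w') \<in> U" using M(1) by simp
    then have ns: "b + w' \<in> nil s" using b w'W W subspace_add[OF C] by (auto simp: nil_def)
    have "b + w' \<in> nil s'" if "s' \<in> T" for s'
    proof -
      have s': "s' \<in> S" using that insert by auto
      have "(x s ^^ k) b \<in> nil s'" for k
        using w(2)[OF that] nil_x[OF s s'] by (induction k) (auto simp: b_def)
      then have "w' \<in> nil s'" unfolding w'_def
        by (intro subspace_sum[OF nil_subspace[OF s']] subspace_scale[OF nil_subspace[OF s']])
      then show ?thesis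
        using subspace_add[OF nil_subspace[OF s']] w(2)[OF that] by (simp add: b_def)
    qed
    then show ?case using ns w'W w(1) subspace_add[OF W(1)]
      by (intro bexI[of _ "w + w'"]) (auto simp: b_def add.assoc)
  qed
  obtain w where w: "w \<in> W" "\<And>s. s \<in> S \<Longrightarrow> b0 + w \<in> nil s" using step1[OF \<open>finite S\<close>] by auto
  have "\<exists>b\<in>C. b \<notin> U \<and> (\<forall>s\<in>S. b \<in> nil s) \<and> (\<forall>s\<in>T. x s b \<in> U)" if "finite T" "T \<subseteq> S" for T
    using that
  proof (induction T rule: finite_induct)
    case empty
    then show ?case using disj w b0 W subspace_add[OF C] by (intro bexI[of _ "b0 + w"]) auto
  next
    case (insert s T)
    then obtain b where b: "b \<in> C" "b \<notin> U" "\<And>s. s \<in> S \<Longrightarrow> b \<in> nil s" "\<And>s. s \<in> T \<Longrightarrow> x s b \<in> U"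
      by auto
    have s: "s \<in> S" using insert by simp
    define M where "M = (LEAST k. (x s ^^ k) b \<in> U)"
    obtain k where "(x s ^^ k) b \<in> U" using b(3)[OF s] by (auto simp: nil_def)
    then have M: "(x s ^^ M) b \<in> U" unfolding M_def by (rule LeastI)
    then obtain M' where M': "M = Suc M'" using b(2) by (cases M) auto
    have M'': "(x s ^^ M') b \<notin> U" using not_less_Least[of M' "\<lambda>k. (x s ^^ k) b \<in> U"] M' M_def by auto
    have "x s' ((x s ^^ M') b) \<in> U" if "s' \<in> T" for s'
    proof -
      have s': "s' \<in> S" using that insert by auto
      have "(x s ^^ M') (x s' b) \<in> U" using x_pow_U[OF s b(4)[OF that]] .
      then show ?thesis using x_pow_comm[OF s' s b(1), of M'] subspace_diff[OF U] by fastforce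
    qed
    moreover have "(x s ^^ M') b \<in> nil s'" if "s' \<in> S" for s'
      using b(3)[OF that] nil_x[OF s that] by (induction M') auto
    moreover have "x s ((x s ^^ M') b) \<in> U" using M M' by simp
    ultimately show ?case using M'' x_pow_C[OF s b(1)] by (intro bexI[of _ "(x s ^^ M') b"]) auto
  qed
  then show ?thesis using \<open>finite S\<close> by blast
qed

end

section \<open>Towers of infinite cyclic extensions\<close>

context group
begin

text \<open>This is the subgroup generated by \<open>L\<close> and \<open>t\<close> as soon as \<open>t\<close> normalizes the subgroup \<open>L\<close>.\<close>

definition adjoin :: "'a set \<Rightarrow> 'a \<Rightarrow> 'a set" where
  "adjoin L t = {x \<otimes> t [^] a | x a. x \<in> L \<and> a \<in> (UNIV :: int set)}"

definition normalizes :: "'a \<Rightarrow> 'a set \<Rightarrow> bool" where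
  "normalizes t L \<longleftrightarrow> (\<forall>l\<in>L. t \<otimes> l \<otimes> inv t \<in> L \<and> inv t \<otimes> l \<otimes> t \<in> L)"

text \<open>For a subgroup \<open>L\<close> of \<open>K\<close> this says that \<open>L\<close> is normal in \<open>K\<close> with abelian quotient.\<close>

definition commutators_in :: "'a set \<Rightarrow> 'a set \<Rightarrow> bool" where
  "commutators_in K L \<longleftrightarrow> (\<forall>s\<in>K. \<forall>s'\<in>K. s \<otimes> s' \<otimes> inv s \<otimes> inv s' \<in> L)"

text \<open>For \<open>L = [K, K]\<close> and elements of \<open>K\<close> this is linear independence in the rational abelianization of
  \<open>K\<close>. The recursion on the list matches the homological induction, which climbs one infinite cyclic
  extension at a time.\<close>

primrec tower :: "'a set \<Rightarrow> 'a list \<Rightarrow> bool" where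
  "tower L [] \<longleftrightarrow> True"
| "tower L (t # ts) \<longleftrightarrow> (\<forall>a :: int. t [^] a \<in> L \<longrightarrow> a = 0) \<and> tower (adjoin L t) ts"

lemma commutators_in_normalizes:
  assumes K: "subgroup K G" and L: "subgroup L G" "L \<subseteq> K" and c: "commutators_in K L" and s: "s \<in> K"
  shows "normalizes s L"
  unfolding normalizes_def
proof (intro ballI conjI)
  fix l assume l: "l \<in> L"
  have car: "s \<in> carrier G" "l \<in> carrier G" "l \<in> K" "inv s \<in> K"
    using K L l s subgroup.mem_carrier subgroup.m_inv_closed[OF K] by auto
  have "s \<otimes> l \<otimes> inv s \<otimes> inv l \<otimes> l \<in> L"
    using c s car l L subgroup.m_closed[OF L(1)] by (auto simp: commutators_in_def)
  then show "s \<otimes> l \<otimes> inv s \<in> L" using car by (simp add: m_assoc)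
  have "inv s \<otimes> l \<otimes> inv (inv s) \<otimes> inv l \<otimes> l \<in> L"
    using c s car l L subgroup.m_closed[OF L(1)] unfolding commutators_in_def by blast
  then show "inv s \<otimes> l \<otimes> s \<in> L" using car by (simp add: m_assoc)
qed

lemma subset_adjoin: "L \<subseteq> carrier G \<Longrightarrow> L \<subseteq> adjoin L t"
proof
  fix x assume "L \<subseteq> carrier G" "x \<in> L"
  then have "x = x \<otimes> t [^] (0::int)" by auto
  then show "x \<in> adjoin L t" using \<open>x \<in> L\<close> unfolding adjoin_def by blast
qed

lemma adjoin_props:
  assumes K: "subgroup K G" and L: "subgroup L G" "L \<subseteq> K" and c: "commutators_in K L" and t: "t \<in> K"
  shows "subgroup (adjoin L t) G" "adjoin L t \<subseteq> K" "commutators_in K (adjoin L t)"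
proof -
  have LG: "L \<subseteq> carrier G" using L subgroup.subset by blast
  have tG: "t \<in> carrier G" using K t subgroup.mem_carrier by fast
  have pow: "t [^] a \<in> K" for a :: int using K t by (simp add: subgroup_int_pow_closed)
  have norm: "t [^] a \<otimes> x \<otimes> inv (t [^] a) \<in> L" if "x \<in> L" for x and a :: int
    using commutators_in_normalizes[OF K L c pow] that unfolding normalizes_def by blast
  show "adjoin L t \<subseteq> K" using L pow subgroup.m_closed[OF K] by (auto simp: adjoin_def)
  show "commutators_in K (adjoin L t)"
    using c subset_adjoin[OF LG] unfolding commutators_in_def by blast
  show "subgroup (adjoin L t) G"
  proof (rule subgroupI)
    show "adjoin L t \<subseteq> carrier G" using LG tG by (auto simp: adjoin_def)
    show "adjoin L t \<noteq> {}" using subset_adjoin[OF LG] subgroup.one_closed[OF L(1)] by blast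
  next
    fix y assume "y \<in> adjoin L t"
    then obtain x and a :: int where y: "y = x \<otimes> t [^] a" "x \<in> L" by (auto simp: adjoin_def)
    have xG: "x \<in> carrier G" using y LG by auto
    have "inv y = (t [^] (-a) \<otimes> inv x \<otimes> inv (t [^] (-a))) \<otimes> t [^] (-a)"
      using xG tG y by (simp add: inv_mult_group m_assoc int_pow_neg)
    moreover have "t [^] (-a) \<otimes> inv x \<otimes> inv (t [^] (-a)) \<in> L"
      using norm subgroup.m_inv_closed[OF L(1) y(2)] by blast
    ultimately show "inv y \<in> adjoin L t" unfolding adjoin_def by blast
  next
    fix y z assume "y \<in> adjoin L t" "z \<in> adjoin L t"
    then obtain x x' and a b :: int where y: "y = x \<otimes> t [^] a" "x \<in> L" "z = x' \<otimes> t [^] b" "x' \<in> L"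
      by (auto simp: adjoin_def)
    have xG: "x \<in> carrier G" "x' \<in> carrier G" using y LG by auto
    have "inv (t [^] a) \<otimes> (t [^] a \<otimes> t [^] b) = t [^] b"
      using tG by (simp flip: m_assoc)
    then have "y \<otimes> z = (x \<otimes> (t [^] a \<otimes> x' \<otimes> inv (t [^] a))) \<otimes> t [^] (a + b)"
      using xG tG y by (simp add: m_assoc int_pow_mult)
    moreover have "x \<otimes> (t [^] a \<otimes> x' \<otimes> inv (t [^] a)) \<in> L"
      using norm y subgroup.m_closed[OF L(1)] by blast
    ultimately show "y \<otimes> z \<in> adjoin L t" unfolding adjoin_def by blast
  qed
qed

lemma pow_mult_mod:
  assumes K: "subgroup K G" and L: "subgroup L G" "L \<subseteq> K" and c: "commutators_in K L"
    and x: "x \<in> L" and y: "y \<in> K"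
  shows "\<exists>z\<in>L. (x \<otimes> y) [^] (k::nat) = z \<otimes> y [^] k"
proof (induction k)
  case 0
  show ?case using subgroup.one_closed[OF L(1)] by (intro bexI[of _ \<one>]) simp_all
next
  case (Suc k)
  then obtain z where z: "z \<in> L" "(x \<otimes> y) [^] k = z \<otimes> y [^] k" by auto
  have yk: "y [^] k \<in> K" using K y by (metis int_pow_int subgroup_int_pow_closed)
  have G: "x \<in> carrier G" "y \<in> carrier G" "z \<in> carrier G"
    using K L x y z subgroup.mem_carrier by fast+
  have "y [^] k \<otimes> x \<otimes> inv (y [^] k) \<in> L"
    using commutators_in_normalizes[OF K L c yk] x unfolding normalizes_def by blast
  then have "z \<otimes> (y [^] k \<otimes> x \<otimes> inv (y [^] k)) \<in> L" using z subgroup.m_closed[OF L(1)] by blast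
  moreover have "inv (y [^] k) \<otimes> (y [^] k \<otimes> y) = y" using G by (simp flip: m_assoc)
  then have "(x \<otimes> y) [^] Suc k = z \<otimes> (y [^] k \<otimes> x \<otimes> inv (y [^] k)) \<otimes> y [^] Suc k"
    using z G by (simp add: m_assoc)
  ultimately show ?case by blast
qed

text \<open>Here \<open>L\<close> and \<open>L'\<close> will be the commutator subgroups of \<open>K \<le> K'\<close>, and the powers of a maximal
  independent family of \<open>K'\<close> span the rational abelianization of \<open>K\<close>. The lemma then says that an element of
  \<open>K\<close> in this span which is torsion modulo \<open>[K', K']\<close> lies in \<open>[K, K]\<close>: its coordinates vanish because they
  vanish in the larger group, where the family is still independent.\<close>

lemma tower_power_descend:
  assumes K: "subgroup K G" and L: "subgroup L G" "L \<subseteq> K" and c: "commutators_in K L"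
    and K': "subgroup K' G" and L': "subgroup L' G" "L' \<subseteq> K'" and c': "commutators_in K' L'"
    and LL': "L \<subseteq> L'"
    and ts: "set ts \<subseteq> K'" "(\<lambda>t. t [^] (e::nat)) ` set ts \<subseteq> K" "tower L' ts" and e: "e > 0"
    and x: "x \<in> foldl adjoin L (map (\<lambda>t. t [^] e) ts)" "x [^] (k::nat) \<in> L'" and k: "k > 0"
  shows "x \<in> L"
  using L c L' c' LL' ts x
proof (induction ts arbitrary: L L')
  case Nil
  then show ?case by simp
next
  case (Cons t ts)
  define s where "s = t [^] e"
  note L = Cons.prems(1,2) and c = Cons.prems(3) and L' = Cons.prems(4,5) and c' = Cons.prems(6)
    and LL' = Cons.prems(7)
  have t: "t \<in> K'" "s \<in> K" using Cons.prems by (auto simp: s_def)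
  have tG: "t \<in> carrier G" "s \<in> carrier G" using t K K' subgroup.mem_carrier by fast+
  have spow: "s [^] b = t [^] (int e * b)" for b :: int
    using tG by (simp add: s_def int_pow_pow flip: int_pow_int)
  have "adjoin L s \<subseteq> adjoin L' t" using LL' spow by (fastforce simp: adjoin_def)
  moreover have "x [^] k \<in> adjoin L' t"
    using Cons.prems subset_adjoin subgroup.subset[OF L'(1)] by blast
  ultimately have "x \<in> adjoin L s"
    using Cons.IH[OF adjoin_props[OF K L c t(2)] adjoin_props[OF K' L' c' t(1)]] Cons.prems
    by (simp add: s_def)
  then obtain y and b :: int where y: "x = y \<otimes> s [^] b" "y \<in> L" by (auto simp: adjoin_def)
  have yG: "y \<in> carrier G" using y L subgroup.mem_carrier by fast
  have sb: "s [^] b \<in> K" using K t by (simp add: subgroup_int_pow_closed)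
  obtain z where z: "z \<in> L" "x [^] k = z \<otimes> (s [^] b) [^] k"
    using pow_mult_mod[OF K L c y(2) sb] y(1) by blast
  have zG: "z \<in> carrier G" using z L subgroup.mem_carrier by fast
  have "inv z \<otimes> x [^] k \<in> L'"
    using z LL' Cons.prems subgroup.m_closed[OF L'(1)] subgroup.m_inv_closed[OF L'(1)] by blast
  moreover have "inv z \<otimes> x [^] k = t [^] (int e * b * int k)"
    using z zG tG by (simp add: spow int_pow_pow m_assoc[symmetric] flip: int_pow_int)
  ultimately have "int e * b * int k = 0" using Cons.prems by auto
  then have "b = 0" using e k by auto
  then show ?case using y yG by simp
qed

lemma commutators_in_derived: "commutators_in K (derived G K)"
  unfolding commutators_in_def derived_def by (blast intro: generate.incl)

lemma tower_snoc:
  "tower L (ts @ [t]) \<longleftrightarrow> tower L ts \<and> (\<forall>a :: int. t [^] a \<in> foldl adjoin L ts \<longrightarrow> a = 0)"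
  by (induction ts arbitrary: L) auto

lemma int_pow_nat_pow: "t \<in> carrier G \<Longrightarrow> (t [^] (e::nat)) [^] (a::int) = t [^] (int e * a)"
  by (simp add: int_pow_pow flip: int_pow_int)

lemma tower_powers:
  assumes "L \<subseteq> L'" "set ts \<subseteq> carrier G" "tower L' ts" "e > 0"
  shows "tower L (map (\<lambda>t. t [^] (e::nat)) ts)"
  using assms
proof (induction ts arbitrary: L L')
  case (Cons t ts)
  have t: "t \<in> carrier G" using Cons.prems by simp
  have "a = 0" if "(t [^] e) [^] a \<in> L" for a :: int
  proof -
    have "int e * a = 0" using that Cons.prems by (auto simp: int_pow_nat_pow[OF t])
    then show ?thesis using Cons.prems by simp
  qed
  moreover have "adjoin L (t [^] e) \<subseteq> adjoin L' t"
    using Cons.prems(1) by (fastforce simp: adjoin_def int_pow_nat_pow[OF t])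
  then have "tower (adjoin L (t [^] e)) (map (\<lambda>t. t [^] e) ts)"
    using Cons.IH Cons.prems by simp
  ultimately show ?case by simp
qed simp

lemma foldl_adjoin_subgroup:
  assumes "subgroup K G" "subgroup L G" "L \<subseteq> K" "commutators_in K L" "set ts \<subseteq> K"
  shows "subgroup (foldl adjoin L ts) G"
  using assms(2-)
proof (induction ts arbitrary: L)
  case (Cons t ts)
  then show ?case using adjoin_props[OF assms(1) Cons.prems(1-3), of t] by simp
qed simp

end

section \<open>Rational representations and coinvariants\<close>

text \<open>A rational representation on a whole type; the modules of interest are subsets of that type.\<close>

locale linear_action = group G + rational_space scale
  for G :: "('g, 'm) monoid_scheme" (structure)
    and scale :: "rat \<Rightarrow> 'v::ab_group_add \<Rightarrow> 'v" (infixr "*s" 75) +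
  fixes act :: "'g \<Rightarrow> 'v \<Rightarrow> 'v" (infixr "\<bullet>" 75)
  assumes act_one: "\<one> \<bullet> v = v"
    and act_mult: "\<lbrakk>g \<in> carrier G; h \<in> carrier G\<rbrakk> \<Longrightarrow> (g \<otimes> h) \<bullet> v = g \<bullet> h \<bullet> v"
    and act_add: "g \<bullet> (u + v) = g \<bullet> u + g \<bullet> v"
    and act_scale: "g \<bullet> (c *s v) = c *s g \<bullet> v"
begin

definition submod :: "'g set \<Rightarrow> 'v set \<Rightarrow> bool" where
  "submod L M \<longleftrightarrow> subspace M \<and> (\<forall>l\<in>L. \<forall>v\<in>M. l \<bullet> v \<in> M)"

definition lhom :: "'g set \<Rightarrow> 'v set \<Rightarrow> 'v set \<Rightarrow> ('v \<Rightarrow> 'v) \<Rightarrow> bool" where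
  "lhom L M N f \<longleftrightarrow> f ` M \<subseteq> N \<and> (\<forall>u\<in>M. \<forall>v\<in>M. f (u + v) = f u + f v) \<and>
     (\<forall>c. \<forall>v\<in>M. f (c *s v) = c *s f v) \<and> (\<forall>l\<in>L. \<forall>v\<in>M. f (l \<bullet> v) = l \<bullet> f v)"

text \<open>The quotient of \<open>M\<close> by this subspace is the space of \<open>L\<close>-coinvariants \<open>\<rat> \<otimes>\<^bsub>\<rat>L\<^esub> M\<close>.\<close>

definition aug :: "'g set \<Rightarrow> 'v set \<Rightarrow> 'v set" where
  "aug L M = span {l \<bullet> v - v | l v. l \<in> L \<and> v \<in> M}"

definition dif :: "'g \<Rightarrow> 'v \<Rightarrow> 'v" where
  "dif s v = s \<bullet> v - v"

text \<open>Projectivity over \<open>\<rat>L\<close>, tested against modules inside the fixed type of vectors. Homomorphisms are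
  functions on the whole type that are controlled on the module only.\<close>

definition projective_rel :: "'g set \<Rightarrow> 'v set \<Rightarrow> bool" where
  "projective_rel L P \<longleftrightarrow> (\<forall>A f g. submod L A \<and> lhom L A UNIV f \<and> lhom L P UNIV g \<and> g ` P \<subseteq> f ` A \<longrightarrow>
     (\<exists>h. lhom L P A h \<and> (\<forall>p\<in>P. f (h p) = g p)))"

lemma projective_relD:
  assumes "projective_rel L P" "submod L A" "lhom L A UNIV f" "lhom L P UNIV g"
    and "\<And>p. p \<in> P \<Longrightarrow> g p \<in> f ` A"
  obtains h where "lhom L P A h" "\<And>p. p \<in> P \<Longrightarrow> f (h p) = g p"
  using assms unfolding projective_rel_def by (metis image_subsetI)

lemma act_zero [simp]: "g \<bullet> 0 = 0"
  using act_add[of g 0 0] by simp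

lemma act_diff: "g \<bullet> (u - v) = g \<bullet> u - g \<bullet> v"
  using act_add[of g "u - v" v] by (simp add: algebra_simps)

lemma dif_add: "dif s (u + v) = dif s u + dif s v"
  by (simp add: dif_def act_add)

lemma dif_diff: "dif s (u - v) = dif s u - dif s v"
  by (simp add: dif_def act_diff)

lemma dif_scale: "dif s (c *s v) = c *s dif s v"
  by (simp add: dif_def act_scale scale_right_diff_distrib)

lemma submod_subspace: "submod L M \<Longrightarrow> subspace M"
  and submod_act: "submod L M \<Longrightarrow> l \<in> L \<Longrightarrow> v \<in> M \<Longrightarrow> l \<bullet> v \<in> M"
  by (auto simp: submod_def)

lemma submod_mono: "submod L M \<Longrightarrow> L' \<subseteq> L \<Longrightarrow> submod L' M"
  by (auto simp: submod_def)

lemma submod_dif: "submod L M \<Longrightarrow> l \<in> L \<Longrightarrow> v \<in> M \<Longrightarrow> dif l v \<in> M"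
  unfolding dif_def submod_def by (auto intro: subspace_diff)

lemma lhomD:
  assumes "lhom L M N f"
  shows "v \<in> M \<Longrightarrow> f v \<in> N" "u \<in> M \<Longrightarrow> v \<in> M \<Longrightarrow> f (u + v) = f u + f v"
    "v \<in> M \<Longrightarrow> f (c *s v) = c *s f v" "l \<in> L \<Longrightarrow> v \<in> M \<Longrightarrow> f (l \<bullet> v) = l \<bullet> f v"
  using assms by (auto simp: lhom_def)

lemma lhomI:
  assumes "\<And>v. v \<in> M \<Longrightarrow> f v \<in> N" "\<And>u v. u \<in> M \<Longrightarrow> v \<in> M \<Longrightarrow> f (u + v) = f u + f v"
    "\<And>c v. v \<in> M \<Longrightarrow> f (c *s v) = c *s f v"
    "\<And>l v. l \<in> L \<Longrightarrow> v \<in> M \<Longrightarrow> f (l \<bullet> v) = l \<bullet> f v"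
  shows "lhom L M N f"
  using assms by (auto simp: lhom_def)

lemma lhom_mono: "lhom L M N f \<Longrightarrow> L' \<subseteq> L \<Longrightarrow> M' \<subseteq> M \<Longrightarrow> f ` M' \<subseteq> N' \<Longrightarrow> lhom L' M' N' f"
  unfolding lhom_def by blast

lemma lhom_comp:
  assumes "lhom L M N f" "lhom L N' K g" "f ` M \<subseteq> N'"
  shows "lhom L M K (\<lambda>v. g (f v))"
  using assms unfolding lhom_def by (simp add: image_subset_iff)

lemma lhom_zero: "lhom L M N f \<Longrightarrow> subspace M \<Longrightarrow> f 0 = 0"
  using lhomD(3)[of L M N f 0 0] subspace_0 by fastforce

lemma lhom_diff:
  assumes "lhom L M N f" "subspace M" "u \<in> M" "v \<in> M"
  shows "f (u - v) = f u - f v"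
  using lhomD(2)[OF assms(1), of "u - v" v] assms subspace_diff by (auto simp: algebra_simps)

lemma lhom_dif:
  assumes "lhom L M N f" "submod L M" "l \<in> L" "v \<in> M"
  shows "f (dif l v) = dif l (f v)"
  using assms by (simp add: dif_def lhom_diff[OF assms(1)] submod_act submod_subspace lhomD(4)[OF assms(1)])

lemma lhom_lincomb:
  assumes f: "lhom L M N f" and M: "subspace M" and v: "\<And>k. v k \<in> M"
  shows "f (\<Sum>k\<le>(N'::nat). a k *s v k) = (\<Sum>k\<le>N'. a k *s f (v k))"
proof (induction N')
  case 0
  then show ?case using lhomD(3)[OF f] v by simp
next
  case (Suc N')
  have "(\<Sum>k\<le>N'. a k *s v k) \<in> M" by (intro subspace_sum[OF M] subspace_scale[OF M] v)
  then show ?case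
    using Suc lhomD(2)[OF f] lhomD(3)[OF f] subspace_scale[OF M] v by simp
qed

lemma subspace_lhom_image:
  assumes f: "lhom L M N f" and M: "subspace M"
  shows "subspace (f ` M)"
proof (rule subspaceI)
  show "0 \<in> f ` M" using subspace_0[OF M] lhom_zero[OF f M] by (metis imageI)
next
  fix x y assume "x \<in> f ` M" "y \<in> f ` M"
  then obtain u v where "u \<in> M" "v \<in> M" "x = f u" "y = f v" by blast
  then show "x + y \<in> f ` M"
    using lhomD(2)[OF f, of u v] subspace_add[OF M] by (metis imageI)
next
  fix c x assume "x \<in> f ` M"
  then obtain u where "u \<in> M" "x = f u" by blast
  then show "c *s x \<in> f ` M"
    using lhomD(3)[OF f, of u c] subspace_scale[OF M] by (metis imageI)
qed

lemma subspace_aug: "subspace (aug L M)"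
  by (simp add: aug_def)

lemma dif_in_aug: "l \<in> L \<Longrightarrow> v \<in> M \<Longrightarrow> dif l v \<in> aug L M"
  by (auto simp: aug_def dif_def intro: span_base)

lemma aug_minimal:
  assumes "subspace T" "\<And>l v. l \<in> L \<Longrightarrow> v \<in> M \<Longrightarrow> dif l v \<in> T"
  shows "aug L M \<subseteq> T"
  unfolding aug_def using assms by (intro span_minimal) (auto simp: dif_def)

lemma aug_subset: "submod L M \<Longrightarrow> aug L M \<subseteq> M"
  by (intro aug_minimal submod_subspace submod_dif)

lemma aug_mono: "L \<subseteq> L' \<Longrightarrow> M \<subseteq> M' \<Longrightarrow> aug L M \<subseteq> aug L' M'"
  unfolding aug_def by (intro span_mono) auto

lemma lhom_aug:
  assumes f: "lhom L M N f" and M: "submod L M" and v: "v \<in> aug L M"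
  shows "f v \<in> aug L N"
proof -
  note MS = submod_subspace[OF M]
  have "aug L M \<subseteq> {v \<in> M. f v \<in> aug L N}"
  proof (rule aug_minimal)
    show "subspace {v \<in> M. f v \<in> aug L N}"
      using lhom_zero[OF f MS] lhomD(2,3)[OF f] MS subspace_aug[of L N]
      by (intro subspaceI) (auto simp: subspace_0 subspace_add subspace_scale)
    show "dif l v \<in> {v \<in> M. f v \<in> aug L N}" if "l \<in> L" "v \<in> M" for l v
      using that submod_dif[OF M] lhom_dif[OF f M] dif_in_aug lhomD(1)[OF f] by simp
  qed
  then show ?thesis using v by auto
qed

text \<open>Hence the normalizer of \<open>L\<close> acts on \<open>L\<close>-coinvariants.\<close>

lemma act_aug:
  assumes L: "L \<subseteq> carrier G" and s: "s \<in> carrier G" "normalizes s L"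
    and M: "submod L M" "\<And>v. v \<in> M \<Longrightarrow> s \<bullet> v \<in> M" and v: "v \<in> aug L M"
  shows "s \<bullet> v \<in> aug L M"
proof -
  have "aug L M \<subseteq> {v. s \<bullet> v \<in> aug L M}"
  proof (rule aug_minimal)
    show "subspace {v. s \<bullet> v \<in> aug L M}"
      using subspace_aug[of L M]
      by (intro subspaceI) (auto simp: act_add act_scale subspace_0 subspace_add subspace_scale)
    show "dif l v \<in> {v. s \<bullet> v \<in> aug L M}" if lv: "l \<in> L" "v \<in> M" for l v
    proof -
      define l' where "l' = s \<otimes> l \<otimes> inv s"
      have l: "l \<in> carrier G" using lv L by auto
      have l': "l' \<in> L" using s lv by (auto simp: normalizes_def l'_def)
      have "l' \<otimes> s = s \<otimes> l" using l s by (simp add: l'_def m_assoc)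
      then have "s \<bullet> l \<bullet> v = l' \<bullet> s \<bullet> v"
        using l l' L s by (metis act_mult subsetD)
      then have "s \<bullet> dif l v = dif l' (s \<bullet> v)"
        by (simp add: dif_def act_diff)
      then show ?thesis using dif_in_aug[OF l', of "s \<bullet> v" M] M(2) lv by simp
    qed
  qed
  then show ?thesis using v by auto
qed

text \<open>An abelian quotient \<open>K/L\<close> acts on \<open>L\<close>-coinvariants by commuting operators: \<open>s s' = c s' s\<close> with \<open>c \<in> L\<close>,
  and \<open>c - 1\<close> vanishes on coinvariants.\<close>

lemma dif_commute_mod_aug:
  assumes L: "L \<subseteq> carrier G" and s: "s \<in> carrier G" "s' \<in> carrier G"
    and c: "s \<otimes> s' \<otimes> inv s \<otimes> inv s' \<in> L"
    and M: "submod {s, s'} M" and v: "v \<in> M"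
  shows "dif s (dif s' v) - dif s' (dif s v) \<in> aug L M"
proof -
  define c where "c = s \<otimes> s' \<otimes> inv s \<otimes> inv s'"
  have cc: "c \<in> carrier G" using s by (simp add: c_def)
  have "c \<otimes> (s' \<otimes> s) = s \<otimes> s'" using s unfolding c_def
    by (simp add: m_assoc) (metis inv_closed l_inv_ex m_assoc l_inv l_one m_closed r_inv r_one)
  then have "c \<bullet> s' \<bullet> s \<bullet> v = s \<bullet> s' \<bullet> v"
    using s cc by (metis act_mult m_closed)
  then have "dif s (dif s' v) - dif s' (dif s v) = dif c (s' \<bullet> s \<bullet> v)"
    by (simp add: dif_def act_diff)
  moreover have "s' \<bullet> s \<bullet> v \<in> M" using M v submod_act[OF M] by blast
  ultimately show ?thesis using dif_in_aug c unfolding c_def by metis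
qed

text \<open>Coinvariants of \<open>L\<langle>t\<rangle>\<close> are the coinvariants of \<open>t\<close> on those of \<open>L\<close>, because \<open>t\<^sup>a - 1\<close> is divisible by
  \<open>t - 1\<close> for every integer \<open>a\<close>.\<close>

lemma aug_adjoin:
  assumes L: "subgroup L G" and t: "t \<in> carrier G" and M: "submod (carrier G) M"
    and v: "v \<in> aug (adjoin L t) M"
  shows "\<exists>w\<in>aug L M. \<exists>u\<in>M. v = w + dif t u"
proof -
  note MS = submod_subspace[OF M]
  have pow: "\<exists>u\<in>M. dif (t [^] a) v = dif t u" if "v \<in> M" for a :: int and v
    using that
  proof (induction a arbitrary: v rule: int_induct[where k = 0])
    case base
    show ?case using subspace_0[OF MS] by (intro bexI[of _ 0]) (auto simp: dif_def act_one)
  next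
    case (step1 i)
    have tv: "t \<bullet> v \<in> M" using M t step1.prems submod_act by blast
    obtain u where u: "u \<in> M" "dif (t [^] i) (t \<bullet> v) = dif t u" using step1.IH[OF tv] by blast
    have "t [^] (i + 1) = t [^] i \<otimes> t" using t by (simp add: int_pow_mult)
    then have "dif (t [^] (i + 1)) v = dif (t [^] i) (t \<bullet> v) + dif t v"
      using t by (simp add: dif_def act_mult)
    then have "dif (t [^] (i + 1)) v = dif t (u + v)" using u by (simp add: dif_add)
    then show ?case using u step1.prems subspace_add[OF MS] by blast
  next
    case (step2 i)
    define v' where "v' = inv t \<bullet> v"
    have v': "v' \<in> M" using M t step2.prems submod_act v'_def by blast
    obtain u where u: "u \<in> M" "dif (t [^] i) v' = dif t u" using step2.IH[OF v'] by blast
    have "t [^] (i - 1) = t [^] i \<otimes> inv t" using t by (simp add: int_pow_diff)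
    moreover have "t \<bullet> v' = v" using t by (simp add: v'_def act_one flip: act_mult)
    ultimately have "dif (t [^] (i - 1)) v = dif (t [^] i) v' - dif t v'"
      using t by (simp add: dif_def act_mult v'_def[symmetric])
    then have "dif (t [^] (i - 1)) v = dif t (u - v')" using u by (simp add: dif_diff)
    then show ?case using u v' subspace_diff[OF MS] by blast
  qed
  have "aug (adjoin L t) M \<subseteq> {w + dif t u | w u. w \<in> aug L M \<and> u \<in> M}"
  proof (rule aug_minimal)
    have "lhom {} M UNIV (dif t)" by (intro lhomI) (auto simp: dif_add dif_scale)
    from subspace_sums[OF subspace_aug[of L M] subspace_lhom_image[OF this MS]]
    show "subspace {w + dif t u | w u. w \<in> aug L M \<and> u \<in> M}"
      by (rule back_subst) blast
    show "dif l v \<in> {w + dif t u | w u. w \<in> aug L M \<and> u \<in> M}"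
      if l: "l \<in> adjoin L t" and v: "v \<in> M" for l v
    proof -
      obtain x and a :: int where xa: "l = x \<otimes> t [^] a" "x \<in> L" using l by (auto simp: adjoin_def)
      have x: "x \<in> carrier G" using xa subgroup.subset[OF L] by auto
      obtain u where u: "u \<in> M" "dif (t [^] a) v = dif t u" using pow v by blast
      have "dif l v = dif x ((t [^] a) \<bullet> v) + dif (t [^] a) v"
        using x t xa by (simp add: dif_def act_mult)
      moreover have "dif x ((t [^] a) \<bullet> v) \<in> aug L M"
        using xa t v M submod_act by (intro dif_in_aug) auto
      ultimately show ?thesis using u by auto
    qed
  qed
  then show ?thesis using v by blast
qed

text \<open>One degree of the comparison of two resolutions. Here \<open>P\<close> covers \<open>\<pi> ` P\<close> with kernel \<open>d ` P1\<close>, and \<open>F\<close>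
  covers \<open>\<rho> ` F\<close>; the maps \<open>\<alpha>\<close>, \<open>\<beta>\<close> between the covered modules, for which \<open>\<beta> \<alpha>\<close> is homotopic to the
  identity by \<open>h\<close>, are lifted to \<open>g\<close>, \<open>f\<close>, together with the next component \<open>k\<close> of the homotopy.\<close>

lemma comparison_step:
  assumes P: "submod L P" "projective_rel L P" and F: "submod L F" "projective_rel L F"
    and P1: "submod L P1"
    and \<pi>: "lhom L P UNIV \<pi>" and \<rho>: "lhom L F UNIV \<rho>"
    and \<beta>: "lhom L (\<rho> ` F) UNIV \<beta>" "\<beta> ` \<rho> ` F \<subseteq> \<pi> ` P"
    and \<alpha>: "lhom L (\<pi> ` P) UNIV \<alpha>" "\<alpha> ` \<pi> ` P \<subseteq> \<rho> ` F"
    and h: "lhom L (\<pi> ` P) P h" "\<And>m. m \<in> \<pi> ` P \<Longrightarrow> m - \<beta> (\<alpha> m) = \<pi> (h m)"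
    and d: "lhom L P1 UNIV d" "d ` P1 = {p \<in> P. \<pi> p = 0}"
  obtains f g k where "lhom L F P f" "lhom L P F g" "lhom L P P1 k"
    "\<And>v. v \<in> F \<Longrightarrow> \<pi> (f v) = \<beta> (\<rho> v)" "\<And>p. p \<in> P \<Longrightarrow> \<rho> (g p) = \<alpha> (\<pi> p)"
    "\<And>p. p \<in> P \<Longrightarrow> p - f (g p) - h (\<pi> p) = d (k p)"
proof -
  note PS = submod_subspace[OF P(1)]
  obtain f where f: "lhom L F P f" "\<And>v. v \<in> F \<Longrightarrow> \<pi> (f v) = \<beta> (\<rho> v)"
    using projective_relD[OF F(2) P(1) \<pi> lhom_comp[OF \<rho> \<beta>(1)]] \<beta>(2) by blast
  obtain g where g: "lhom L P F g" "\<And>p. p \<in> P \<Longrightarrow> \<rho> (g p) = \<alpha> (\<pi> p)"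
    using projective_relD[OF P(2) F(1) \<rho> lhom_comp[OF \<pi> \<alpha>(1)]] \<alpha>(2) by blast
  define e where "e p = p - f (g p) - h (\<pi> p)" for p
  have fg: "lhom L P P (\<lambda>p. f (g p))" using lhom_comp[OF g(1) f(1)] g(1) by (auto simp: lhom_def)
  have h\<pi>: "lhom L P P (\<lambda>p. h (\<pi> p))" using lhom_comp[OF \<pi> h(1)] by auto
  have e: "lhom L P UNIV e"
    using lhomD[OF fg] lhomD[OF h\<pi>]
    by (intro lhomI) (simp_all add: e_def scale_right_diff_distrib act_diff)
  have eP: "e p \<in> P" "\<pi> (e p) = 0" if p: "p \<in> P" for p
  proof -
    have fp: "f (g p) \<in> P" "h (\<pi> p) \<in> P" using lhomD(1)[OF fg] lhomD(1)[OF h\<pi>] p by auto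
    show "e p \<in> P" unfolding e_def using fp p PS subspace_diff by blast
    have "\<pi> (e p) = \<pi> p - \<pi> (f (g p)) - \<pi> (h (\<pi> p))"
      unfolding e_def using fp p PS subspace_diff lhom_diff[OF \<pi> PS] by simp
    also have "\<dots> = 0" using f(2) g p lhomD(1)[OF g(1)] h(2)[of "\<pi> p"] by (simp add: algebra_simps)
    finally show "\<pi> (e p) = 0" .
  qed
  obtain k where "lhom L P P1 k" "\<And>p. p \<in> P \<Longrightarrow> d (k p) = e p"
    using projective_relD[OF P(2) P1 d(1) e] d(2) eP by blast
  then show ?thesis using f g that unfolding e_def by metis
qed

end

section \<open>Rational homology along a tower\<close>

text \<open>What the homological argument uses of a group of type FP with Noetherian group ring: a projective
  resolution \<open>P\<close> of the trivial module, which is embedded as the line through a fixed vector \<open>w0\<close>, and for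
  every subgroup \<open>L\<close> a class \<open>fam L\<close> of finitely generated free \<open>\<rat>L\<close>-modules. That \<open>\<rat>L\<close> is Noetherian
  enters as \<open>fam_cover\<close>: submodules of members are again quotients of members. \<open>P_regular\<close> says that
  \<open>t - 1\<close> is injective on \<open>L\<close>-coinvariants if \<open>t\<close> has infinite order modulo \<open>L\<close>.\<close>

locale noetherian_resolution = linear_action G scale act
  for G :: "('g, 'm) monoid_scheme" (structure)
    and scale :: "rat \<Rightarrow> 'v::ab_group_add \<Rightarrow> 'v" (infixr "*s" 75)
    and act :: "'g \<Rightarrow> 'v \<Rightarrow> 'v" (infixr "\<bullet>" 75) +
  fixes P :: "nat \<Rightarrow> 'v set" and d :: "nat \<Rightarrow> 'v \<Rightarrow> 'v" and \<epsilon> :: "'v \<Rightarrow> 'v" and w0 :: 'v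
    and fam :: "'g set \<Rightarrow> 'v set set" and n :: nat
  assumes P_submod: "submod (carrier G) (P j)"
    and d_hom: "lhom (carrier G) (P (Suc j)) (P j) (d j)"
    and exact: "d (Suc j) ` P (Suc (Suc j)) = {p \<in> P (Suc j). d j p = 0}"
    and \<epsilon>_hom: "lhom (carrier G) (P 0) UNIV \<epsilon>"
    and exact0: "d 0 ` P (Suc 0) = {p \<in> P 0. \<epsilon> p = 0}"
    and \<epsilon>_image: "\<epsilon> ` P 0 = range (\<lambda>c. c *s w0)"
    and w0: "w0 \<noteq> 0" "g \<in> carrier G \<Longrightarrow> g \<bullet> w0 = w0"
    and P_vanish: "j > n \<Longrightarrow> P j = {0}"
    and P_projective: "subgroup L G \<Longrightarrow> projective_rel L (P j)"
    and P_regular: "\<lbrakk>subgroup L G; t \<in> carrier G; normalizes t L;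
        \<And>a :: int. t [^] a \<in> L \<Longrightarrow> a = 0; u \<in> P j; dif t u \<in> aug L (P j)\<rbrakk> \<Longrightarrow> u \<in> aug L (P j)"
    and fam_submod: "\<lbrakk>subgroup L G; F \<in> fam L\<rbrakk> \<Longrightarrow> submod L F"
    and fam_projective: "\<lbrakk>subgroup L G; F \<in> fam L\<rbrakk> \<Longrightarrow> projective_rel L F"
    and fam_codim: "\<lbrakk>subgroup L G; F \<in> fam L\<rbrakk> \<Longrightarrow> finite_codim (aug L F) F"
    and fam_cover: "\<lbrakk>subgroup L G; F \<in> fam L; submod L E; E \<subseteq> F\<rbrakk> \<Longrightarrow>
        \<exists>F'\<in>fam L. \<exists>\<rho>. lhom L F' UNIV \<rho> \<and> \<rho> ` F' = E"
    and fam_trivial: "subgroup L G \<Longrightarrow>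
        \<exists>F\<in>fam L. \<exists>\<rho>. lhom L F UNIV \<rho> \<and> \<rho> ` F = range (\<lambda>c. c *s w0)"
begin

lemma P_subspace: "subspace (P j)"
  using P_submod submod_subspace by blast

lemma P_submod': "subgroup L G \<Longrightarrow> submod L (P j)"
  using P_submod submod_mono subgroup.subset by metis

lemma d_hom': "subgroup L G \<Longrightarrow> lhom L (P (Suc j)) (P j) (d j)"
  using d_hom[of j] subgroup.subset[of L G] unfolding lhom_def by blast

lemma d_d: "p \<in> P (Suc (Suc j)) \<Longrightarrow> d j (d (Suc j) p) = 0"
  using exact[of j] by blast

text \<open>The preimage in \<open>P j\<close> of the boundaries of the complex of \<open>L\<close>-coinvariants. Modulo \<open>bd j L\<close>, a cycle
  represents a class in \<open>H\<^sub>j(L; \<rat>)\<close>.\<close>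

definition bd :: "nat \<Rightarrow> 'g set \<Rightarrow> 'v set" where
  "bd j L = {d j y + w | y w. y \<in> P (Suc j) \<and> w \<in> aug L (P j)}"

lemma bdI: "y \<in> P (Suc j) \<Longrightarrow> w \<in> aug L (P j) \<Longrightarrow> d j y + w \<in> bd j L"
  by (auto simp: bd_def)

lemma bdE:
  assumes "b \<in> bd j L"
  obtains y w where "b = d j y + w" "y \<in> P (Suc j)" "w \<in> aug L (P j)"
  using assms by (auto simp: bd_def)

lemma d_zero: "d j 0 = 0"
  using lhom_zero[OF d_hom P_subspace] .

lemma aug_bd: "w \<in> aug L (P j) \<Longrightarrow> w \<in> bd j L"
  using bdI[of 0 j w L] P_subspace subspace_0 d_zero by auto

lemma d_bd: "y \<in> P (Suc j) \<Longrightarrow> d j y \<in> bd j L"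
  using bdI[of y j 0 L] subspace_0[OF subspace_aug] by auto

lemma subspace_bd: "subspace (bd j L)"
proof -
  have "bd j L = {x + w | x w. x \<in> d j ` P (Suc j) \<and> w \<in> aug L (P j)}"
    unfolding bd_def by blast
  then show ?thesis
    using subspace_sums[OF subspace_lhom_image[OF d_hom P_subspace] subspace_aug] by simp
qed

lemma bd_subset:
  assumes "subgroup L G"
  shows "bd j L \<subseteq> P j"
proof
  fix b assume "b \<in> bd j L"
  then obtain y w where "b = d j y + w" "y \<in> P (Suc j)" "w \<in> aug L (P j)" by (rule bdE)
  then show "b \<in> P j"
    using aug_subset[OF P_submod'[OF assms]] lhomD(1)[OF d_hom] subspace_add[OF P_subspace] by blast
qed

lemma dif_P: "s \<in> carrier G \<Longrightarrow> v \<in> P j \<Longrightarrow> dif s v \<in> P j"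
  using submod_dif[OF P_submod] by blast

lemma d_dif: "s \<in> carrier G \<Longrightarrow> v \<in> P (Suc j) \<Longrightarrow> d j (dif s v) = dif s (d j v)"
  using lhom_dif[OF d_hom P_submod] by blast

lemma dif_aug:
  assumes "subgroup L G" "s \<in> carrier G" "normalizes s L" "v \<in> aug L (P j)"
  shows "dif s v \<in> aug L (P j)"
  unfolding dif_def
  using act_aug[OF subgroup.subset[OF assms(1)] assms(2,3) P_submod'[OF assms(1)] submod_act[OF P_submod assms(2)] assms(4)]
    assms(4) subspace_diff[OF subspace_aug] by blast

lemma dif_bd:
  assumes "subgroup L G" "s \<in> carrier G" "normalizes s L" "v \<in> bd j L"
  shows "dif s v \<in> bd j L"
proof -
  obtain y w where *: "v = d j y + w" "y \<in> P (Suc j)" "w \<in> aug L (P j)" using assms(4) by (rule bdE)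
  then have "dif s v = d j (dif s y) + dif s w" using d_dif[OF assms(2)] by (simp add: dif_add)
  then show ?thesis using * dif_P[OF assms(2)] dif_aug[OF assms(1-3)] bdI by metis
qed

text \<open>The part of a comparison with a resolution of \<open>\<rat>\<close> by finitely generated free \<open>\<rat>L\<close>-modules that concerns
  degree \<open>j\<close>. The module \<open>F\<close> is the free one in degree \<open>j\<close> and \<open>E\<close> the kernel of its differential, so
  the maps \<open>f\<close>, \<open>g\<close> and the homotopy \<open>k\<close> can be continued from \<open>E\<close> and the kernel of the differential
  of \<open>P\<close>. The last conjunct is the homotopy formula on cycles of the complex of \<open>L\<close>-coinvariants, where
  the contribution from degree \<open>j - 1\<close> disappears.\<close>

definition comparable :: "'g set \<Rightarrow> nat \<Rightarrow> bool" where
  "comparable L j \<longleftrightarrow> (\<exists>F\<in>fam L. \<exists>f g k E. lhom L F (P j) f \<and> lhom L (P j) F g \<and>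
     lhom L (P j) (P (Suc j)) k \<and> submod L E \<and> E \<subseteq> F \<and>
     g ` d j ` P (Suc j) \<subseteq> E \<and> f ` E \<subseteq> d j ` P (Suc j) \<and>
     (\<forall>z\<in>d j ` P (Suc j). z - f (g z) = d j (k z)) \<and>
     (\<forall>i. j = Suc i \<longrightarrow> (\<forall>p\<in>P j. d i p \<in> aug L (P i) \<longrightarrow> p - f (g p) - d j (k p) \<in> aug L (P j))))"

lemma submod_kernel:
  assumes "submod L F" "lhom L F UNIV \<rho>"
  shows "submod L {v \<in> F. \<rho> v = 0}"
  using lhomD[OF assms(2)] lhom_zero[OF assms(2) submod_subspace[OF assms(1)]] assms(1)
  unfolding submod_def
  by (auto intro!: subspaceI simp: subspace_0 subspace_add subspace_scale)

lemma comparable_all: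
  assumes L: "subgroup L G"
  shows "comparable L j"
proof (induction j)
  case 0
  obtain F \<rho> where F: "F \<in> fam L" "lhom L F UNIV \<rho>" "\<rho> ` F = range (\<lambda>c. c *s w0)"
    using fam_trivial[OF L] by blast
  have eps: "lhom L (P 0) UNIV \<epsilon>" using \<epsilon>_hom subgroup.subset[OF L] unfolding lhom_def by blast
  have id: "lhom L M UNIV (\<lambda>m. m)" for M by (auto simp: lhom_def)
  have zero: "lhom L M (P 0) (\<lambda>m. 0)" for M using subspace_0[OF P_subspace] by (auto simp: lhom_def)
  obtain f g k where fgk: "lhom L F (P 0) f" "lhom L (P 0) F g" "lhom L (P 0) (P (Suc 0)) k"
    "\<And>v. v \<in> F \<Longrightarrow> \<epsilon> (f v) = \<rho> v" "\<And>p. p \<in> P 0 \<Longrightarrow> \<rho> (g p) = \<epsilon> p"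
    "\<And>p. p \<in> P 0 \<Longrightarrow> p - f (g p) - 0 = d 0 (k p)"
  proof (rule comparison_step[OF P_submod'[OF L] P_projective[OF L] fam_submod[OF L F(1)]
        fam_projective[OF L F(1)] P_submod'[OF L] eps F(2) id _ id _ zero _ _ exact0])
    show "lhom L (P (Suc 0)) UNIV (d 0)" using d_hom'[OF L, of 0] by (auto simp: lhom_def)
  qed (use F(3) \<epsilon>_image lhom_zero[OF \<epsilon>_hom P_subspace] in auto)
  note Z = exact0
  have "submod L {v \<in> F. \<rho> v = 0}" using submod_kernel fam_submod[OF L F(1)] F(2) by blast
  moreover have "g ` d 0 ` P (Suc 0) \<subseteq> {v \<in> F. \<rho> v = 0}"
    unfolding Z using fgk(5) lhomD(1)[OF fgk(2)] by auto
  moreover have "f ` {v \<in> F. \<rho> v = 0} \<subseteq> d 0 ` P (Suc 0)"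
    unfolding Z using fgk(4) lhomD(1)[OF fgk(1)] by auto
  moreover have "\<forall>z\<in>d 0 ` P (Suc 0). z - f (g z) = d 0 (k z)"
    unfolding Z using fgk(6) by auto
  ultimately show ?case unfolding comparable_def using F(1) fgk(1-3) by blast
next
  case (Suc j)
  then obtain F f g k E where *: "F \<in> fam L" "lhom L F (P j) f" "lhom L (P j) F g"
    "lhom L (P j) (P (Suc j)) k" "submod L E" "E \<subseteq> F"
    "g ` d j ` P (Suc j) \<subseteq> E" "f ` E \<subseteq> d j ` P (Suc j)"
    "\<forall>z\<in>d j ` P (Suc j). z - f (g z) = d j (k z)"
    unfolding comparable_def by (elim bexE exE conjE) (rule that, assumption+)
  obtain F' \<rho> where F': "F' \<in> fam L" "lhom L F' UNIV \<rho>" "\<rho> ` F' = E"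
    using fam_cover[OF L *(1,5,6)] by blast
  have dj: "lhom L (P (Suc j)) UNIV (d j)" for j
    using d_hom'[OF L, of j] by (auto simp: lhom_def)
  have ZP: "d j ` P (Suc j) \<subseteq> P j" using lhomD(1)[OF d_hom] by blast
  obtain f' g' k' where fgk: "lhom L F' (P (Suc j)) f'" "lhom L (P (Suc j)) F' g'"
    "lhom L (P (Suc j)) (P (Suc (Suc j))) k'"
    "\<And>v. v \<in> F' \<Longrightarrow> d j (f' v) = f (\<rho> v)" "\<And>p. p \<in> P (Suc j) \<Longrightarrow> \<rho> (g' p) = g (d j p)"
    "\<And>p. p \<in> P (Suc j) \<Longrightarrow> p - f' (g' p) - k (d j p) = d (Suc j) (k' p)"
  proof (rule comparison_step[OF P_submod'[OF L] P_projective[OF L] fam_submod[OF L F'(1)]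
        fam_projective[OF L F'(1)] P_submod'[OF L] dj F'(2) _ _ _ _ _ _ dj exact])
    show "lhom L (\<rho> ` F') UNIV f" using lhom_mono[OF *(2)] F'(3) *(6) by blast
    show "lhom L (d j ` P (Suc j)) UNIV g" using lhom_mono[OF *(3)] ZP by blast
    show "lhom L (d j ` P (Suc j)) (P (Suc j)) k"
      using lhom_mono[OF *(4) _ ZP] lhomD(1)[OF *(4)] ZP by blast
  qed (use F'(3) * in auto)
  have zero: "k 0 = 0" "f 0 = 0" "g 0 = 0"
    using lhom_zero *(2-4) P_subspace submod_subspace[OF fam_submod[OF L *(1)]] by blast+
  note Z = exact
  have "submod L {v \<in> F'. \<rho> v = 0}" using submod_kernel fam_submod[OF L F'(1)] F'(2) by blast
  moreover have "g' ` d (Suc j) ` P (Suc (Suc j)) \<subseteq> {v \<in> F'. \<rho> v = 0}"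
    unfolding Z using fgk(5) lhomD(1)[OF fgk(2)] zero by auto
  moreover have "f' ` {v \<in> F'. \<rho> v = 0} \<subseteq> d (Suc j) ` P (Suc (Suc j))"
    unfolding Z using fgk(4) lhomD(1)[OF fgk(1)] zero by auto
  moreover have "\<forall>z\<in>d (Suc j) ` P (Suc (Suc j)). z - f' (g' z) = d (Suc j) (k' z)"
    unfolding Z using fgk(6) zero by fastforce
  moreover have "p - f' (g' p) - d (Suc j) (k' p) \<in> aug L (P (Suc j))"
    if "p \<in> P (Suc j)" "d j p \<in> aug L (P j)" for p
  proof -
    have "p - f' (g' p) - d (Suc j) (k' p) = k (d j p)" using fgk(6)[OF that(1)]
      by (simp add: algebra_simps)
    then show ?thesis using lhom_aug[OF *(4) P_submod'[OF L] that(2)] by simp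
  qed
  then have "\<forall>i. Suc j = Suc i \<longrightarrow> (\<forall>p\<in>P (Suc j). d i p \<in> aug L (P i) \<longrightarrow>
      p - f' (g' p) - d (Suc j) (k' p) \<in> aug L (P (Suc j)))" by simp
  ultimately show ?case unfolding comparable_def
    by (intro bexI[OF _ F'(1)] exI[of _ f'] exI[of _ g'] exI[of _ k'] exI[of _ "{v \<in> F'. \<rho> v = 0}"] conjI
        fgk(1-3)) auto
qed

text \<open>Cycles of degree \<open>i + 1\<close> of the complex of \<open>L\<close>-coinvariants. Degree \<open>0\<close>, where every element is a
  cycle, does not occur.\<close>

definition cyc :: "nat \<Rightarrow> 'g set \<Rightarrow> 'v set" where
  "cyc i L = {p \<in> P (Suc i). d i p \<in> aug L (P i)}"

lemma subspace_cyc: "subspace (cyc i L)"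
  using d_zero lhomD(2,3)[OF d_hom] P_subspace[of "Suc i"] subspace_aug[of L "P i"]
  by (intro subspaceI) (auto simp: cyc_def subspace_0 subspace_add subspace_scale)

text \<open>This is the finite dimension of \<open>H\<^bsub>i+1\<^esub>(L; \<rat>)\<close>: modulo boundaries the identity of cycles factors
  through the \<open>L\<close>-coinvariants of a finitely generated free module.\<close>

lemma finite_codim_bd:
  assumes L: "subgroup L G"
  shows "finite_codim (bd (Suc i) L) (cyc i L)"
  unfolding finite_codim_def
proof (intro allI impI)
  fix v :: "nat \<Rightarrow> 'v" assume v: "\<forall>k. v k \<in> cyc i L"
  obtain F f g k where F: "F \<in> fam L" "lhom L F (P (Suc i)) f" "lhom L (P (Suc i)) F g"
    "lhom L (P (Suc i)) (P (Suc (Suc i))) k"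
    "\<And>p. p \<in> P (Suc i) \<Longrightarrow> d i p \<in> aug L (P i) \<Longrightarrow>
       p - f (g p) - d (Suc i) (k p) \<in> aug L (P (Suc i))"
  proof -
    obtain F f g k where F: "F \<in> fam L" "lhom L F (P (Suc i)) f" "lhom L (P (Suc i)) F g"
      "lhom L (P (Suc i)) (P (Suc (Suc i))) k"
      "\<forall>i'. Suc i = Suc i' \<longrightarrow> (\<forall>p\<in>P (Suc i). d i' p \<in> aug L (P i') \<longrightarrow>
         p - f (g p) - d (Suc i) (k p) \<in> aug L (P (Suc i)))"
      using comparable_all[OF L, of "Suc i"] unfolding comparable_def
      by (elim bexE exE conjE) (rule that, assumption+)
    show thesis by (rule that[OF F(1-4)]) (use F(5) in blast)
  qed
  have vP: "v k \<in> P (Suc i)" for k using v by (auto simp: cyc_def)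
  have gF: "g (v k) \<in> F" for k using lhomD(1)[OF F(3) vP] .
  obtain N a where a: "\<exists>k\<le>N. a k \<noteq> 0" "(\<Sum>k\<le>N. a k *s g (v k)) \<in> aug L F"
    using fam_codim[OF L F(1), unfolded finite_codim_def, rule_format, of "\<lambda>k. g (v k)", OF gF] by blast
  define p where "p = (\<Sum>k\<le>N. a k *s v k)"
  have p: "p \<in> cyc i L" unfolding p_def
    using v by (intro subspace_sum[OF subspace_cyc] subspace_scale[OF subspace_cyc]) auto
  then have pP: "p \<in> P (Suc i)" by (simp add: cyc_def)
  have "g p \<in> aug L F" using a(2) lhom_lincomb[OF F(3) P_subspace vP] by (simp add: p_def)
  then have fg: "f (g p) \<in> aug L (P (Suc i))" using lhom_aug[OF F(2) fam_submod[OF L F(1)]] by blast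
  have "p = d (Suc i) (k p) + ((p - f (g p) - d (Suc i) (k p)) + f (g p))" by simp
  moreover have "(p - f (g p) - d (Suc i) (k p)) + f (g p) \<in> aug L (P (Suc i))"
    using subspace_add[OF subspace_aug F(5)[OF pP] fg] p unfolding cyc_def by blast
  ultimately have "p \<in> bd (Suc i) L" using bdI lhomD(1)[OF F(4) pP] by metis
  then show "\<exists>N a. (\<exists>k\<le>N. a k \<noteq> 0) \<and> (\<Sum>k\<le>N. a k *s v k) \<in> bd (Suc i) L"
    using a(1) unfolding p_def by blast
qed

text \<open>The step along the Wang sequence. As \<open>c0\<close> is fixed by \<open>t\<close> in \<open>H\<^sub>i(L)\<close>, one has \<open>d b = (t - 1) c0\<close> in
  \<open>L\<close>-coinvariants for some \<open>b\<close>, and \<open>b\<close> is a cycle for \<open>L\<langle>t\<rangle>\<close>. Its class is nonzero: a boundary \<open>b\<close> would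
  give \<open>(t - 1) (c0 - d c) = 0\<close> in \<open>L\<close>-coinvariants for some \<open>c\<close>, and \<open>t - 1\<close> is injective there. The set
  \<open>W\<close> in the proof collects the cycles lying in the same way over boundaries instead of \<open>c0\<close>; the
  nonvanishing holds on all of \<open>b0 + W\<close>, which leaves the freedom needed to pass to a class fixed by \<open>S\<close>.\<close>

lemma chase_step:
  assumes L: "subgroup L G" and t: "t \<in> carrier G" "\<And>a :: int. t [^] a \<in> L \<Longrightarrow> a = 0"
    and L': "subgroup (adjoin L t) G"
    and S: "finite S" "S \<subseteq> carrier G"
    and norm: "\<And>s. s \<in> insert t S \<Longrightarrow> normalizes s L" "\<And>s. s \<in> S \<Longrightarrow> normalizes s (adjoin L t)"
    and comm: "\<And>s s'. s \<in> insert t S \<Longrightarrow> s' \<in> insert t S \<Longrightarrow> s \<otimes> s' \<otimes> inv s \<otimes> inv s' \<in> L"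
    and c0: "c0 \<in> P i" "c0 \<notin> bd i L" "\<And>s. s \<in> insert t S \<Longrightarrow> dif s c0 \<in> bd i L"
  shows "\<exists>b\<in>P (Suc i). b \<notin> bd (Suc i) (adjoin L t) \<and> (\<forall>s\<in>S. dif s b \<in> bd (Suc i) (adjoin L t))"
proof -
  define L1 where "L1 = adjoin L t"
  define B where "B = bd i L"
  note BS = subspace_bd[of i L, folded B_def] and AS = subspace_aug[of L "P i"]
  have LL1: "L \<subseteq> L1"
  proof
    fix x assume "x \<in> L"
    moreover have "x = x \<otimes> t [^] (0::int)" using \<open>x \<in> L\<close> subgroup.subset[OF L] by auto
    ultimately show "x \<in> L1" unfolding L1_def adjoin_def by blast
  qed
  have tL1: "t \<in> L1"
  proof -
    have "t = \<one> \<otimes> t [^] (1::int)" using t by simp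
    then show ?thesis unfolding L1_def adjoin_def using subgroup.one_closed[OF L] by blast
  qed
  have BP: "B \<subseteq> P i" using bd_subset[OF L] B_def by simp
  have comm_aug: "dif s (dif s' v) - dif s' (dif s v) \<in> aug L (P j)"
    if s: "s \<in> insert t S" "s' \<in> insert t S" and v: "v \<in> P j" for s s' v j
  proof -
    have c: "s \<in> carrier G" "s' \<in> carrier G" using s S t by auto
    then have "submod {s, s'} (P j)" by (intro submod_mono[OF P_submod]) auto
    then show ?thesis using dif_commute_mod_aug[OF subgroup.subset[OF L] c comm[OF s] _ v] by blast
  qed
  obtain b0 w where b0: "dif t c0 = d i b0 + w" "b0 \<in> P (Suc i)" "w \<in> aug L (P i)"
    using c0(3)[of t] by (auto elim: bdE)
  define W where "W = {b \<in> P (Suc i). \<exists>c\<in>B. d i b - dif t c \<in> aug L (P i)}"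
  have in_cyc: "b \<in> cyc i L1" if "b \<in> P (Suc i)" "c \<in> P i" "d i b - dif t c \<in> aug L (P i)" for b c
  proof -
    have "d i b - dif t c \<in> aug L1 (P i)" using that aug_mono[OF LL1] by blast
    moreover have "dif t c \<in> aug L1 (P i)" using tL1 that by (intro dif_in_aug)
    ultimately have "d i b \<in> aug L1 (P i)" using subspace_add[OF subspace_aug] by fastforce
    then show ?thesis using that by (simp add: cyc_def)
  qed
  have W: "subspace W"
  proof (rule subspaceI)
    show "0 \<in> W" using subspace_0[OF P_subspace] subspace_0[OF BS] subspace_0[OF AS] d_zero
      by (auto simp: W_def dif_def intro!: bexI[of _ 0])
  next
    fix x y assume "x \<in> W" "y \<in> W"
    then obtain c c' where *: "x \<in> P (Suc i)" "y \<in> P (Suc i)" "c \<in> B" "c' \<in> B"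
      "d i x - dif t c \<in> aug L (P i)" "d i y - dif t c' \<in> aug L (P i)" by (auto simp: W_def)
    have "d i (x + y) - dif t (c + c') = (d i x - dif t c) + (d i y - dif t c')"
      using lhomD(2)[OF d_hom] * by (simp add: dif_add)
    then have "d i (x + y) - dif t (c + c') \<in> aug L (P i)" using * subspace_add[OF AS] by metis
    then show "x + y \<in> W" using * subspace_add[OF BS] subspace_add[OF P_subspace]
      unfolding W_def by blast
  next
    fix a x assume "x \<in> W"
    then obtain c where *: "x \<in> P (Suc i)" "c \<in> B" "d i x - dif t c \<in> aug L (P i)"
      by (auto simp: W_def)
    have "d i (a *s x) - dif t (a *s c) = a *s (d i x - dif t c)"
      using lhomD(3)[OF d_hom] * by (simp add: dif_scale scale_right_diff_distrib)
    then have "d i (a *s x) - dif t (a *s c) \<in> aug L (P i)" using * subspace_scale[OF AS] by metis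
    then show "a *s x \<in> W" using * subspace_scale[OF BS] subspace_scale[OF P_subspace]
      unfolding W_def by blast
  qed
  have shift: "d i (dif s b) - dif t (dif s c) \<in> aug L (P i)"
    if "s \<in> S" "b \<in> P (Suc i)" "c \<in> P i" "d i b - dif t c \<in> aug L (P i)" for s b c
  proof -
    have s: "s \<in> carrier G" using that S by auto
    have "dif s (d i b - dif t c) \<in> aug L (P i)" using dif_aug[OF L s norm(1)] that by blast
    moreover have "dif s (dif t c) - dif t (dif s c) \<in> aug L (P i)" using comm_aug that by blast
    ultimately have "dif s (d i b - dif t c) + (dif s (dif t c) - dif t (dif s c)) \<in> aug L (P i)"
      using subspace_add[OF AS] by blast
    then show ?thesis using d_dif[OF s that(2)] by (simp add: dif_diff)
  qed
  have b0': "d i b0 - dif t c0 \<in> aug L (P i)" using b0 subspace_neg[OF AS] by fastforce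
  have main: "\<exists>b\<in>cyc i L1. b \<notin> bd (Suc i) L1 \<and> (\<forall>s\<in>S. dif s b \<in> bd (Suc i) L1)"
  proof (rule simultaneous_fixed_class[where W = W and ?b0.0 = b0, OF S(1) subspace_cyc subspace_bd W])
    show "W \<subseteq> cyc i L1" using in_cyc BP unfolding W_def by blast
    show "b0 \<in> cyc i L1" using in_cyc b0 b0' c0 by blast
    show "dif s b0 \<in> W" if "s \<in> S" for s
      unfolding W_def using shift[OF that b0(2) c0(1) b0'] c0(3) that dif_P[OF _ b0(2)] S B_def by blast
    show "dif s v \<in> W" if sS: "s \<in> S" and vW: "v \<in> W" for s v
    proof -
      obtain c where *: "v \<in> P (Suc i)" "c \<in> B" "d i v - dif t c \<in> aug L (P i)"
        using vW by (auto simp: W_def)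
      have s: "s \<in> carrier G" using sS S by auto
      have "dif s c \<in> B" using dif_bd[OF L s norm(1)] * sS unfolding B_def by blast
      then show ?thesis unfolding W_def using shift[OF sS *(1) _ *(3)] * BP dif_P[OF s] by blast
    qed
    show "dif s v \<in> cyc i L1" if "s \<in> S" "v \<in> cyc i L1" for s v
    proof -
      have s: "s \<in> carrier G" using that S by auto
      show ?thesis using that d_dif[OF s] dif_P[OF s] dif_aug[OF L'[folded L1_def] s] norm(2)
        by (auto simp: cyc_def L1_def)
    qed
    show "dif s v \<in> bd (Suc i) L1" if "s \<in> S" "v \<in> bd (Suc i) L1" for s v
      using that S norm(2) dif_bd[OF L'[folded L1_def]] unfolding L1_def by blast
    show "dif s (dif s' v) - dif s' (dif s v) \<in> bd (Suc i) L1"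
      if "s \<in> S" "s' \<in> S" "v \<in> cyc i L1" for s s' v
    proof -
      have "dif s (dif s' v) - dif s' (dif s v) \<in> aug L (P (Suc i))"
        using comm_aug that by (auto simp: cyc_def)
      then show ?thesis using aug_mono[OF LL1 order_refl] aug_bd by blast
    qed
    show "finite_codim (bd (Suc i) L1) (cyc i L1)" using finite_codim_bd L' L1_def by blast
    \<comment> \<open>exactness of the Wang sequence at the connecting map, for the lift \<open>b0 + b1\<close> of \<open>c0 + c1\<close>\<close>
    show "b0 + b1 \<notin> bd (Suc i) L1" if b1: "b1 \<in> W" for b1
    proof
      assume bad: "b0 + b1 \<in> bd (Suc i) L1"
      obtain c1 where c1: "b1 \<in> P (Suc i)" "c1 \<in> B" "d i b1 - dif t c1 \<in> aug L (P i)"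
        using b1 by (auto simp: W_def)
      define c where "c = c0 + c1"
      have cP: "c \<in> P i" using c0 c1 BP subspace_add[OF P_subspace] c_def by blast
      have "d i (b0 + b1) - dif t c = (d i b0 - dif t c0) + (d i b1 - dif t c1)"
        using lhomD(2)[OF d_hom b0(2) c1(1)] by (simp add: c_def dif_add)
      then have db: "d i (b0 + b1) - dif t c \<in> aug L (P i)"
        using b0' c1(3) subspace_add[OF AS] by simp
      obtain y w' where y: "b0 + b1 = d (Suc i) y + w'" "y \<in> P (Suc (Suc i))"
        "w' \<in> aug L1 (P (Suc i))" using bad by (rule bdE)
      obtain w2 c2 where w2: "w' = w2 + dif t c2" "w2 \<in> aug L (P (Suc i))" "c2 \<in> P (Suc i)"
        using aug_adjoin[OF L t(1) P_submod] y(3) unfolding L1_def by blast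
      have w2P: "w2 \<in> P (Suc i)" using w2 aug_subset[OF P_submod'[OF L]] by blast
      have "d i (b0 + b1) = d i w' "
        using y(1,2) d_d lhomD(2)[OF d_hom, of "d (Suc i) y" i w'] lhomD(1)[OF d_hom y(2)]
          y(3) aug_subset[OF P_submod'[OF L'[folded L1_def]]] by auto
      also have "\<dots> = d i w2 + dif t (d i c2)"
        using w2 w2P lhomD(2)[OF d_hom w2P dif_P[OF t(1) w2(3)]] d_dif[OF t(1) w2(3)] by simp
      finally have "dif t (d i c2 - c) = (d i (b0 + b1) - dif t c) - d i w2"
        by (simp add: dif_diff)
      moreover have "d i w2 \<in> aug L (P i)" using lhom_aug[OF d_hom'[OF L] P_submod'[OF L] w2(2)] .
      ultimately have "dif t (d i c2 - c) \<in> aug L (P i)" using db subspace_diff[OF AS] by simp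
      moreover have "d i c2 - c \<in> P i"
        using lhomD(1)[OF d_hom w2(3)] cP subspace_diff[OF P_subspace] by blast
      ultimately have "d i c2 - c \<in> aug L (P i)"
        using P_regular[OF L t(1) norm(1)[OF insertI1] t(2)] by blast
      then have "d i c2 - c \<in> B" using aug_bd B_def by blast
      then have "d i c2 - (d i c2 - c) \<in> B"
        using d_bd[OF w2(3)] subspace_diff[OF BS] unfolding B_def by blast
      then have "c - c1 \<in> B" using c1 subspace_diff[OF BS] by simp
      then show False using c0(2) by (simp add: c_def B_def)
    qed
  qed (auto simp: dif_add dif_scale)
  then obtain b where "b \<in> cyc i L1" "b \<notin> bd (Suc i) L1" "\<forall>s\<in>S. dif s b \<in> bd (Suc i) L1"
    by (elim bexE conjE)
  then show ?thesis unfolding L1_def by (intro bexI[of _ b] conjI) (simp_all add: cyc_def)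
qed

end

context noetherian_resolution
begin

lemma tower_nonvanishing:
  assumes K: "subgroup K G" and L: "subgroup L G" "L \<subseteq> K" "commutators_in K L"
    and ts: "set ts \<subseteq> K" "tower L ts"
    and c: "c \<in> P i" "c \<notin> bd i L" "\<And>s. s \<in> set ts \<Longrightarrow> dif s c \<in> bd i L"
  shows "P (i + length ts) \<noteq> {0}"
  using L ts c
proof (induction ts arbitrary: L c i)
  case Nil
  then show ?case using subspace_0[OF subspace_bd] by auto
next
  case (Cons t ts)
  note L = Cons.prems(1,2,3)
  have KG: "K \<subseteq> carrier G" using K subgroup.subset by blast
  have tK: "t \<in> K" "set ts \<subseteq> K" using Cons.prems by auto
  note L1 = adjoin_props[OF K L tK(1)]
  have "\<exists>b\<in>P (Suc i). b \<notin> bd (Suc i) (adjoin L t) \<and>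
      (\<forall>s\<in>set ts. dif s b \<in> bd (Suc i) (adjoin L t))"
  proof (rule chase_step[OF L(1) _ _ L1(1) _ _ _ _ _ Cons.prems(6,7)])
    show "t \<in> carrier G" "set ts \<subseteq> carrier G" using tK KG by auto
    show "normalizes s L" if "s \<in> insert t (set ts)" for s
      using that tK commutators_in_normalizes[OF K L] by auto
    show "normalizes s (adjoin L t)" if "s \<in> set ts" for s
      using that tK commutators_in_normalizes[OF K L1] by auto
    show "s \<otimes> s' \<otimes> inv s \<otimes> inv s' \<in> L" if "s \<in> insert t (set ts)" "s' \<in> insert t (set ts)" for s s'
      using that tK L(3) unfolding commutators_in_def by auto
    show "dif s c \<in> bd i L" if "s \<in> insert t (set ts)" for s using that Cons.prems(8) by simp
  qed (use Cons.prems in auto)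
  then obtain b where b: "b \<in> P (Suc i)" "b \<notin> bd (Suc i) (adjoin L t)"
    "\<And>s. s \<in> set ts \<Longrightarrow> dif s b \<in> bd (Suc i) (adjoin L t)" by blast
  have "tower (adjoin L t) ts" using Cons.prems by simp
  then have "P (Suc i + length ts) \<noteq> {0}" using Cons.IH[OF L1 tK(2) _ b] by blast
  then show ?case by simp
qed

text \<open>The induction starts with an element of augmentation \<open>1\<close>. It represents a generator of
  \<open>H\<^sub>0(L; \<rat>) = \<rat>\<close>, on which \<open>K\<close> acts trivially.\<close>

theorem tower_length_le:
  assumes K: "subgroup K G" and L: "subgroup L G" "L \<subseteq> K" "commutators_in K L"
    and ts: "set ts \<subseteq> K" "tower L ts"
  shows "length ts \<le> n"
proof (rule ccontr)
  assume "\<not> length ts \<le> n"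
  then have vanish: "P (0 + length ts) = {0}" using P_vanish by simp
  have "w0 \<in> range (\<lambda>c. c *s w0)" using scale_one[of w0] by (metis rangeI)
  then obtain p where p: "p \<in> P 0" "\<epsilon> p = w0" using \<epsilon>_image by (metis imageE)
  have \<epsilon>_dif: "\<epsilon> (dif s q) = 0" if s: "s \<in> carrier G" and q: "q \<in> P 0" for s q
  proof -
    obtain c where c: "\<epsilon> q = c *s w0" using q \<epsilon>_image by auto
    have "\<epsilon> (dif s q) = dif s (c *s w0)" using lhom_dif[OF \<epsilon>_hom P_submod s q] c by simp
    also have "\<dots> = 0" using w0(2)[OF s] by (simp add: dif_def act_scale)
    finally show ?thesis .
  qed
  have ker: "subspace {v \<in> P 0. \<epsilon> v = 0}"
    using submod_subspace[OF submod_kernel[OF P_submod \<epsilon>_hom]] .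
  have LG: "L \<subseteq> carrier G" using L subgroup.subset by blast
  have "aug L (P 0) \<subseteq> {v \<in> P 0. \<epsilon> v = 0}"
    using \<epsilon>_dif LG dif_P by (intro aug_minimal ker) auto
  then have "bd 0 L \<subseteq> {v \<in> P 0. \<epsilon> v = 0}"
    using exact0 subspace_add[OF ker] by (blast elim: bdE)
  then have "p \<notin> bd 0 L" using p w0 by auto
  moreover have "dif s p \<in> bd 0 L" if "s \<in> set ts" for s
  proof -
    have s: "s \<in> carrier G" using that ts K subgroup.mem_carrier by fast
    have "dif s p \<in> d 0 ` P (Suc 0)" unfolding exact0 using \<epsilon>_dif[OF s p(1)] dif_P[OF s p(1)] by simp
    then show ?thesis by (elim imageE) (simp add: d_bd)
  qed
  ultimately show False using tower_nonvanishing[OF K L ts p(1)] vanish by blast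
qed

end

section \<open>Permutation modules\<close>

definition fin_supp :: "'s set \<Rightarrow> ('s \<Rightarrow> rat) set" where
  "fin_supp S = {v. finite {s. v s \<noteq> 0} \<and> {s. v s \<noteq> 0} \<subseteq> S}"

definition delta :: "'s \<Rightarrow> 's \<Rightarrow> rat" where
  "delta s = (\<lambda>s'. if s' = s then 1 else 0)"

definition fscale :: "rat \<Rightarrow> ('s \<Rightarrow> rat) \<Rightarrow> 's \<Rightarrow> rat" where
  "fscale c v = (\<lambda>s. c * v s)"

text \<open>The weight \<open>w\<close> is arbitrary while \<open>v\<close> has finite support, so this is the pairing of the full dual with
  the space of finitely supported functions.\<close>

definition pairing :: "('s \<Rightarrow> rat) \<Rightarrow> ('s \<Rightarrow> rat) \<Rightarrow> rat" where
  "pairing w v = (\<Sum>s | v s \<noteq> 0. w s * v s)"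

text \<open>The linear extension of \<open>\<phi>\<close> from the basis \<open>delta\<close>, written pointwise.\<close>

definition extend :: "('s \<Rightarrow> 't \<Rightarrow> rat) \<Rightarrow> ('s \<Rightarrow> rat) \<Rightarrow> 't \<Rightarrow> rat" where
  "extend \<phi> v = (\<lambda>y. pairing (\<lambda>s. \<phi> s y) v)"

lemma pairing_eq: "finite A \<Longrightarrow> {s. v s \<noteq> 0} \<subseteq> A \<Longrightarrow> pairing w v = (\<Sum>s\<in>A. w s * v s)"
  unfolding pairing_def by (rule sum.mono_neutral_left) auto

lemma pairing_add:
  assumes "u \<in> fin_supp S" "v \<in> fin_supp S"
  shows "pairing w (u + v) = pairing w u + pairing w v"
proof -
  define A where "A = {s. u s \<noteq> 0} \<union> {s. v s \<noteq> 0}"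
  have "finite A" using assms by (auto simp: A_def fin_supp_def)
  then have "pairing w x = (\<Sum>s\<in>A. w s * x s)" if "x \<in> {u, v, u + v}" for x
    using that by (intro pairing_eq) (auto simp: A_def)
  then show ?thesis by (simp add: sum.distrib distrib_left)
qed

lemma pairing_scale: "pairing w (fscale c v) = c * pairing w v"
  by (cases "c = 0") (auto simp: pairing_def fscale_def sum_distrib_left mult_ac)

lemma pairing_delta [simp]: "pairing w (delta s) = w s"
  by (simp add: pairing_def delta_def)

lemma extend_add: "u \<in> fin_supp S \<Longrightarrow> v \<in> fin_supp S \<Longrightarrow> extend \<phi> (u + v) = extend \<phi> u + extend \<phi> v"
  by (auto simp: extend_def fun_eq_iff pairing_add)

lemma extend_scale: "extend \<phi> (fscale c v) = fscale c (extend \<phi> v)"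
  by (auto simp: extend_def fun_eq_iff pairing_scale fscale_def[of c "\<lambda>y. pairing _ _"])
     (simp add: fscale_def)

lemma extend_delta [simp]: "extend \<phi> (delta s) = \<phi> s"
  by (simp add: extend_def)

lemma extend_zero [simp]: "extend \<phi> 0 = 0"
  by (simp add: extend_def pairing_def fun_eq_iff)

lemma delta_in: "s \<in> S \<Longrightarrow> delta s \<in> fin_supp S"
  by (auto simp: fin_supp_def delta_def)

interpretation fn: rational_space "fscale :: rat \<Rightarrow> ('s \<Rightarrow> rat) \<Rightarrow> 's \<Rightarrow> rat"
  by unfold_locales (auto simp: fscale_def fun_eq_iff algebra_simps)

lemma subspace_fin_supp: "fn.subspace (fin_supp S)"
proof (rule fn.subspaceI)
  fix u v :: "'a \<Rightarrow> rat" assume uv: "u \<in> fin_supp S" "v \<in> fin_supp S"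
  have "{s. (u + v) s \<noteq> 0} \<subseteq> {s. u s \<noteq> 0} \<union> {s. v s \<noteq> 0}" by auto
  then show "u + v \<in> fin_supp S" using uv unfolding fin_supp_def
    by (auto intro: finite_subset[of _ "{s. u s \<noteq> 0} \<union> {s. v s \<noteq> 0}"])
next
  fix c :: rat and v :: "'a \<Rightarrow> rat" assume v: "v \<in> fin_supp S"
  have "{s. fscale c v s \<noteq> 0} \<subseteq> {s. v s \<noteq> 0}" by (auto simp: fscale_def)
  then show "fscale c v \<in> fin_supp S" using v unfolding fin_supp_def
    by (auto intro: finite_subset)
qed (auto simp: fin_supp_def)

text \<open>The induction principle for finitely supported functions: it turns identities that are linear in \<open>v\<close>
  into identities on the basis.\<close>

lemma fin_supp_least:
  assumes T: "fn.subspace T" and \<delta>: "\<And>s. s \<in> S \<Longrightarrow> delta s \<in> T"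
  shows "fin_supp S \<subseteq> T"
proof
  fix v assume v: "v \<in> fin_supp S"
  have "finite A \<Longrightarrow> {s. v s \<noteq> 0} = A \<Longrightarrow> A \<subseteq> S \<Longrightarrow> v \<in> T" for A and v :: "'a \<Rightarrow> rat"
  proof (induction A arbitrary: v rule: finite_induct)
    case empty
    have "v = 0" using empty.prems by (auto simp: fun_eq_iff)
    show ?case using fn.subspace_0[OF T] unfolding \<open>v = 0\<close> .
  next
    case (insert s A)
    have "{s'. (v(s := 0)) s' \<noteq> 0} = A" using insert.prems insert.hyps by auto
    then have "v(s := 0) \<in> T" using insert by auto
    moreover have "fscale (v s) (delta s) \<in> T" using \<delta> insert.prems fn.subspace_scale[OF T] by blast
    moreover have "v = fscale (v s) (delta s) + v(s := 0)"
      by (auto simp: fscale_def delta_def fun_eq_iff)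
    ultimately show ?case using fn.subspace_add[OF T] by metis
  qed
  then show "v \<in> T" using v by (auto simp: fin_supp_def)
qed

text \<open>Gaussian elimination, by induction on the number of equations: an unknown \<open>p\<close> with nonzero
  coefficient in the last equation is eliminated from the others.\<close>

lemma homogeneous_system:
  fixes m :: "nat \<Rightarrow> 'k \<Rightarrow> rat"
  assumes "finite A" "card A > r"
  shows "\<exists>a. (\<exists>k\<in>A. a k \<noteq> 0) \<and> (\<forall>i<r. (\<Sum>k\<in>A. a k * m i k) = 0)"
  using assms
proof (induction r arbitrary: A m)
  case 0
  then obtain k where "k \<in> A" by fastforce
  then show ?case by (intro exI[of _ "\<lambda>_. 1"]) auto
next
  case (Suc r)
  show ?case
  proof (cases "\<exists>p\<in>A. m r p \<noteq> 0")
    case False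
    obtain a where "\<exists>k\<in>A. a k \<noteq> 0" "\<forall>i<r. (\<Sum>k\<in>A. a k * m i k) = 0"
      using Suc.IH[of A m] Suc.prems by auto
    then show ?thesis using False by (intro exI[of _ a]) (auto simp: less_Suc_eq)
  next
    case True
    then obtain p where p: "p \<in> A" "m r p \<noteq> 0" by blast
    define A' where "A' = A - {p}"
    define m' where "m' i k = m i k - m i p * m r k / m r p" for i k
    have A': "finite A'" "card A' > r" "p \<notin> A'" "A = insert p A'"
      using Suc.prems p by (auto simp: A'_def)
    obtain a where a: "\<exists>k\<in>A'. a k \<noteq> 0" "\<forall>i<r. (\<Sum>k\<in>A'. a k * m' i k) = 0"
      using Suc.IH[OF A'(1,2), of m'] by blast
    define q where "q = - (\<Sum>k\<in>A'. a k * m r k) / m r p"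
    have sum: "(\<Sum>k\<in>A. (a(p := q)) k * m i k) = q * m i p + (\<Sum>k\<in>A'. a k * m i k)" for i
    proof -
      have "(\<Sum>k\<in>A'. (a(p := q)) k * m i k) = (\<Sum>k\<in>A'. a k * m i k)"
        using A'(3) by (intro sum.cong) auto
      then show ?thesis using A' by simp
    qed
    have "q * m i p + (\<Sum>k\<in>A'. a k * m i k) = (\<Sum>k\<in>A'. a k * m' i k)" for i
      using p(2) unfolding q_def m'_def
      by (simp add: sum_distrib_left sum_distrib_right sum_subtractf right_diff_distrib sum_divide_distrib mult_ac)
    moreover have "(\<Sum>k\<in>A'. a k * m' r k) = 0" using p(2) by (simp add: m'_def)
    ultimately have "\<forall>i<Suc r. (\<Sum>k\<in>A. (a(p := q)) k * m i k) = 0"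
      using a(2) by (metis sum less_Suc_eq)
    moreover have "\<exists>k\<in>A. (a(p := q)) k \<noteq> 0" using a(1) A' by auto
    ultimately show ?thesis by blast
  qed
qed

locale permutation_modules = group G for G :: "('g, 'm) monoid_scheme" (structure)
begin

text \<open>The action on functions dual to left multiplication on the points \<open>\<nat> \<times> G\<close>. Arguments outside the carrier
  are left alone, so that the laws of an action hold for all functions of the type.\<close>

definition translate :: "'g \<Rightarrow> (nat \<times> 'g \<Rightarrow> rat) \<Rightarrow> nat \<times> 'g \<Rightarrow> rat" where
  "translate g v = (\<lambda>(i, x). v (i, if x \<in> carrier G then inv g \<otimes> x else x))"

definition shift :: "'g \<Rightarrow> nat \<times> 'g \<Rightarrow> nat \<times> 'g" where
  "shift g = (\<lambda>(i, x). (i, g \<otimes> x))"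

sublocale linear_action G fscale translate
proof
  show "translate \<one> v = v" for v by (auto simp: translate_def fun_eq_iff)
  show "translate (g \<otimes> h) v = translate g (translate h v)"
    if "g \<in> carrier G" "h \<in> carrier G" for g h v
    using that by (auto simp: translate_def fun_eq_iff inv_mult_group m_assoc)
qed (auto simp: translate_def fun_eq_iff fscale_def)

definition points :: "(nat \<times> 'g) set" where "points = UNIV \<times> carrier G"

lemma shift_points: "g \<in> carrier G \<Longrightarrow> s \<in> points \<Longrightarrow> shift g s \<in> points"
  by (auto simp: shift_def points_def)

lemma shift_mult: "g \<in> carrier G \<Longrightarrow> h \<in> carrier G \<Longrightarrow> s \<in> points \<Longrightarrow> shift g (shift h s) = shift (g \<otimes> h) s"
  by (auto simp: shift_def points_def m_assoc)

lemma shift_one: "s \<in> points \<Longrightarrow> shift \<one> s = s"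
  by (auto simp: shift_def points_def)

lemma shift_inj: "g \<in> carrier G \<Longrightarrow> h \<in> carrier G \<Longrightarrow> s \<in> points \<Longrightarrow> shift g s = shift h s \<Longrightarrow> g = h"
  by (auto simp: shift_def points_def)

lemma translate_delta:
  assumes "g \<in> carrier G" "s \<in> points"
  shows "translate g (delta s) = delta (shift g s)"
proof (rule ext, clarify)
  fix i x
  have "inv g \<otimes> x = y \<longleftrightarrow> x = g \<otimes> y" if "x \<in> carrier G" "y \<in> carrier G" for y
    using that assms inv_solve_left by metis
  moreover have "g \<otimes> snd s \<in> carrier G" "snd s \<in> carrier G" using assms by (auto simp: points_def)
  ultimately show "translate g (delta s) (i, x) = delta (shift g s) (i, x)"
    using assms by (cases s) (auto simp: translate_def delta_def shift_def)
qed

definition invariant :: "'g set \<Rightarrow> (nat \<times> 'g) set \<Rightarrow> bool" where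
  "invariant L S \<longleftrightarrow> S \<subseteq> points \<and> (\<forall>l\<in>L. \<forall>s\<in>S. shift l s \<in> S)"

lemma invariantD:
  assumes "invariant L S" "s \<in> S"
  shows "s \<in> points" "l \<in> L \<Longrightarrow> shift l s \<in> S"
  using assms by (auto simp: invariant_def simp del: split_paired_All)

lemma submod_fin_supp:
  assumes L: "L \<subseteq> carrier G" and S: "invariant L S"
  shows "submod L (fin_supp S)"
  unfolding submod_def
proof (intro conjI ballI)
  show "fn.subspace (fin_supp S)" by (rule subspace_fin_supp)
  fix l v assume l: "l \<in> L" and v: "v \<in> fin_supp S"
  have "fin_supp S \<subseteq> {v. translate l v \<in> fin_supp S}"
  proof (rule fin_supp_least)
    show "fn.subspace {v. translate l v \<in> fin_supp S}"
      using subspace_fin_supp[of S]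
      by (intro fn.subspaceI) (auto simp: act_add act_scale fn.subspace_0 fn.subspace_add fn.subspace_scale)
    show "delta s \<in> {v. translate l v \<in> fin_supp S}" if "s \<in> S" for s
      using invariantD[OF S that] L l by (simp add: translate_delta subsetD delta_in)
  qed
  then show "translate l v \<in> fin_supp S" using v by auto
qed

lemma lhom_extend:
  assumes L: "L \<subseteq> carrier G" and S: "invariant L S" and N: "fn.subspace N"
    and \<phi>: "\<And>s. s \<in> S \<Longrightarrow> \<phi> s \<in> N" "\<And>l s. l \<in> L \<Longrightarrow> s \<in> S \<Longrightarrow> \<phi> (shift l s) = translate l (\<phi> s)"
  shows "lhom L (fin_supp S) N (extend \<phi>)"
proof (rule lhomI)
  fix v assume v: "v \<in> fin_supp S"
  have "fin_supp S \<subseteq> {v \<in> fin_supp S. extend \<phi> v \<in> N}"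
  proof (intro fin_supp_least fn.subspaceI)
    show "0 \<in> {v \<in> fin_supp S. extend \<phi> v \<in> N}"
      using fn.subspace_0[OF subspace_fin_supp] fn.subspace_0[OF N] by (simp add: extend_zero)
  qed (use subspace_fin_supp[of S] N in
      \<open>auto simp: fn.subspace_add fn.subspace_scale extend_add extend_scale delta_in \<phi>(1)\<close>)
  then show "extend \<phi> v \<in> N" using v by auto
next
  fix l v assume l: "l \<in> L" and v: "v \<in> fin_supp S"
  note SM = submod_act[OF submod_fin_supp[OF L S] l]
  let ?Z = "{v \<in> fin_supp S. extend \<phi> (translate l v) = translate l (extend \<phi> v)}"
  have "fin_supp S \<subseteq> ?Z"
  proof (intro fin_supp_least fn.subspaceI)
    show "0 \<in> ?Z"
      using fn.subspace_0[OF subspace_fin_supp] by simp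
    show "delta s \<in> ?Z" if "s \<in> S" for s
      using that invariantD[OF S that] L l \<phi>(2) by (simp add: translate_delta subsetD delta_in)
  qed (auto simp: SM fn.subspace_add[OF subspace_fin_supp] fn.subspace_scale[OF subspace_fin_supp]
        extend_add[of _ S] extend_scale act_add act_scale)
  then show "extend \<phi> (translate l v) = translate l (extend \<phi> v)" using v by auto
qed (auto simp: extend_add extend_scale)

lemma lhom_eq_on_fin_supp:
  assumes f: "lhom L (fin_supp S) N f" and g: "lhom L (fin_supp S) N' g"
    and eq: "\<And>s. s \<in> S \<Longrightarrow> f (delta s) = g (delta s)" and v: "v \<in> fin_supp S"
  shows "f v = g v"
proof -
  have "fin_supp S \<subseteq> {v \<in> fin_supp S. f v = g v}"
    using subspace_fin_supp[of S] lhom_zero[OF f subspace_fin_supp] lhom_zero[OF g subspace_fin_supp]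
    by (intro fin_supp_least fn.subspaceI CollectI conjI)
       (auto simp: fn.subspace_0 fn.subspace_add fn.subspace_scale delta_in eq lhomD[OF f] lhomD[OF g])
  then show ?thesis using v by auto
qed

definition orb :: "'g set \<Rightarrow> nat \<times> 'g \<Rightarrow> (nat \<times> 'g) set" where
  "orb L s = (\<lambda>l. shift l s) ` L"

text \<open>The representative depends on the orbit \<open>orb L s\<close> only, since the choice operator is applied to this set.\<close>

definition rep :: "'g set \<Rightarrow> nat \<times> 'g \<Rightarrow> nat \<times> 'g" where
  "rep L s = (SOME r. r \<in> orb L s)"

lemma orb_self: "subgroup L G \<Longrightarrow> s \<in> points \<Longrightarrow> s \<in> orb L s"
  unfolding orb_def using shift_one[of s] subgroup.one_closed[of L G] by (intro image_eqI[of _ _ \<one>]) auto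

lemma orb_eq:
  assumes L: "subgroup L G" and s: "s \<in> points" and r: "r \<in> orb L s"
  shows "orb L r = orb L s"
proof -
  obtain l where l: "l \<in> L" "r = shift l s" using r by (auto simp: orb_def)
  have lG: "l \<in> carrier G" "\<And>k. k \<in> L \<Longrightarrow> k \<in> carrier G" using l L subgroup.mem_carrier by fast+
  show ?thesis
  proof
    show "orb L r \<subseteq> orb L s" unfolding orb_def l(2)
      using lG s l L subgroup.m_closed[OF L] by (auto simp: shift_mult)
    show "orb L s \<subseteq> orb L r"
    proof
      fix x assume "x \<in> orb L s"
      then obtain k where k: "k \<in> L" "x = shift k s" by (auto simp: orb_def)
      then have "x = shift (k \<otimes> inv l) r" using lG s l by (simp add: shift_mult m_assoc)
      moreover have "k \<otimes> inv l \<in> L" using k l L subgroup.m_closed subgroup.m_inv_closed by fast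
      ultimately show "x \<in> orb L r" by (auto simp: orb_def)
    qed
  qed
qed

lemma rep_orb: "subgroup L G \<Longrightarrow> s \<in> points \<Longrightarrow> rep L s \<in> orb L s"
  unfolding rep_def using orb_self by (metis someI)

lemma rep_shift: "subgroup L G \<Longrightarrow> s \<in> points \<Longrightarrow> l \<in> L \<Longrightarrow> rep L (shift l s) = rep L s"
  unfolding rep_def using orb_eq[of L s "shift l s"] by (auto simp: orb_def)

lemma rep_eq_iff:
  assumes "subgroup L G" "s \<in> points" "s' \<in> points"
  shows "rep L s' = rep L s \<longleftrightarrow> s' \<in> orb L s"
proof
  assume "rep L s' = rep L s"
  then have "orb L s' = orb L s" using orb_eq rep_orb assms by metis
  then show "s' \<in> orb L s" using orb_self assms by blast
next
  assume "s' \<in> orb L s"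
  then obtain l where "l \<in> L" "s' = shift l s" by (auto simp: orb_def)
  then show "rep L s' = rep L s" using rep_shift[OF assms(1,2)] by simp
qed

text \<open>Left multiplication makes \<open>S\<close> a free \<open>L\<close>-set, so the finitely supported functions on \<open>S\<close> form a free
  \<open>\<rat>L\<close>-module whose basis consists of orbit representatives; a homomorphism is lifted on these.\<close>

lemma free_projective:
  assumes L: "subgroup L G" and S: "invariant L S"
  shows "projective_rel L (fin_supp S)"
  unfolding projective_rel_def
proof (intro allI impI, elim conjE)
  fix A f g
  assume A: "submod L A" and f: "lhom L A UNIV f" and g: "lhom L (fin_supp S) UNIV g"
    and gf: "g ` fin_supp S \<subseteq> f ` A"
  have LG: "L \<subseteq> carrier G" using L subgroup.subset by blast
  have SP: "S \<subseteq> points" using S invariant_def by auto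
  have "\<exists>a. a \<in> A \<and> f a = g (delta r)" if "r \<in> S" for r
  proof -
    have "g (delta r) \<in> f ` A" using gf delta_in[OF that] by blast
    then show ?thesis by (metis imageE)
  qed
  then have "\<exists>\<mu>. \<forall>r\<in>S. \<mu> r \<in> A \<and> f (\<mu> r) = g (delta r)" by (intro bchoice ballI)
  then obtain \<mu> where \<mu>: "\<And>r. r \<in> S \<Longrightarrow> \<mu> r \<in> A" "\<And>r. r \<in> S \<Longrightarrow> f (\<mu> r) = g (delta r)" by blast
  have "\<exists>l. l \<in> L \<and> s = shift l (rep L s)" if "s \<in> S" for s
  proof -
    have s: "s \<in> points" using that SP by auto
    have "s \<in> orb L (rep L s)" using orb_eq[OF L s rep_orb[OF L s]] orb_self[OF L s] by auto
    then show ?thesis by (auto simp: orb_def)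
  qed
  then obtain lam where lam: "\<And>s. s \<in> S \<Longrightarrow> lam s \<in> L" "\<And>s. s \<in> S \<Longrightarrow> s = shift (lam s) (rep L s)"
    by metis
  have repS: "rep L s \<in> S" if "s \<in> S" for s
  proof -
    have "rep L s \<in> orb L s" using rep_orb[OF L invariantD(1)[OF S that]] .
    then show ?thesis using invariantD(2)[OF S that] unfolding orb_def by auto
  qed
  define \<phi> where "\<phi> s = translate (lam s) (\<mu> (rep L s))" for s
  have \<phi>A: "\<phi> s \<in> A" if "s \<in> S" for s
    unfolding \<phi>_def using submod_act[OF A lam(1)] \<mu>(1) repS that by blast
  have \<phi>f: "f (\<phi> s) = g (delta s)" if "s \<in> S" for s
  proof -
    have "f (\<phi> s) = translate (lam s) (g (delta (rep L s)))"
      unfolding \<phi>_def using lhomD(4)[OF f lam(1)] \<mu> repS that by simp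
    also have "\<dots> = g (translate (lam s) (delta (rep L s)))"
      using lhomD(4)[OF g lam(1)[OF that] delta_in[OF repS[OF that]]] by simp
    also have "\<dots> = g (delta s)"
      using translate_delta[of "lam s" "rep L s"] lam that LG SP repS by (metis subsetD)
    finally show ?thesis .
  qed
  have \<phi>_equi: "\<phi> (shift l s) = translate l (\<phi> s)" if l: "l \<in> L" and s: "s \<in> S" for l s
  proof -
    have ls: "shift l s \<in> S" using S l s by (auto simp: invariant_def)
    have sp: "s \<in> points" "rep L s \<in> points" using SP s repS[OF s] by blast+
    have G: "l \<in> carrier G" "lam s \<in> carrier G" "lam (shift l s) \<in> carrier G"
      using l lam(1)[OF ls] lam(1)[OF s] LG by blast+
    have r: "rep L (shift l s) = rep L s" using rep_shift[OF L sp(1) l] .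
    have "shift (lam (shift l s)) (rep L s) = shift l s" using lam(2)[OF ls] r by simp
    also have "\<dots> = shift (l \<otimes> lam s) (rep L s)" using lam(2)[OF s] G sp shift_mult by metis
    finally have "lam (shift l s) = l \<otimes> lam s" using shift_inj G sp by blast
    then show ?thesis unfolding \<phi>_def r using G by (simp add: act_mult)
  qed
  have h: "lhom L (fin_supp S) A (extend \<phi>)"
    using lhom_extend[OF LG S submod_subspace[OF A] \<phi>A \<phi>_equi] .
  have "lhom L (fin_supp S) UNIV (\<lambda>v. f (extend \<phi> v))"
    using lhom_comp[OF h f] h by (auto simp: lhom_def)
  then have "f (extend \<phi> v) = g v" if "v \<in> fin_supp S" for v
    by (rule lhom_eq_on_fin_supp[OF _ g _ that]) (simp add: \<phi>f)
  then show "\<exists>h. lhom L (fin_supp S) A h \<and> (\<forall>p\<in>fin_supp S. f (h p) = g p)" using h by blast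
qed

definition mass :: "(nat \<times> 'g) set \<Rightarrow> (nat \<times> 'g \<Rightarrow> rat) \<Rightarrow> rat" where
  "mass T = pairing (\<lambda>s. if s \<in> T then 1 else 0)"

lemma subspace_mass_eq:
  assumes "fn.subspace M" "M \<subseteq> fin_supp S"
    "\<And>u v. u \<in> M \<Longrightarrow> v \<in> M \<Longrightarrow> f (u + v) = f u + f v" "\<And>c v. v \<in> M \<Longrightarrow> f (fscale c v) = c * f v"
  shows "fn.subspace {v \<in> M. mass T v = (f v :: rat)}"
proof (rule fn.subspaceI)
  have "f 0 = 0" using assms(4)[of 0 0] fn.subspace_0[OF assms(1)] by simp
  then show "0 \<in> {v \<in> M. mass T v = f v}"
    using fn.subspace_0[OF assms(1)] by (simp add: mass_def pairing_def)
next
  fix u v assume "u \<in> {v \<in> M. mass T v = f v}" "v \<in> {v \<in> M. mass T v = f v}"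
  then show "u + v \<in> {v \<in> M. mass T v = f v}"
    using assms fn.subspace_add[OF assms(1)] pairing_add[of u S v] by (auto simp: mass_def subset_iff)
next
  fix c v assume "v \<in> {v \<in> M. mass T v = f v}"
  then show "fscale c v \<in> {v \<in> M. mass T v = f v}"
    using assms fn.subspace_scale[OF assms(1)] by (auto simp: mass_def pairing_scale)
qed

lemma mass_add: "u \<in> fin_supp S \<Longrightarrow> v \<in> fin_supp S \<Longrightarrow> mass T (u + v) = mass T u + mass T v"
  by (simp add: mass_def pairing_add)

lemma mass_scale: "mass T (fscale c v) = c * mass T v"
  by (simp add: mass_def pairing_scale)

lemma mass_delta: "mass T (delta s) = (if s \<in> T then 1 else 0)"
  by (simp add: mass_def)

lemma mass_diff: 
  assumes "u \<in> fin_supp S" "v \<in> fin_supp S"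
  shows "mass T (u - v) = mass T u - mass T v"
  using mass_add[of "u - v" S v T] assms fn.subspace_diff[OF subspace_fin_supp] by fastforce

lemma mass_on_fin_supp:
  assumes f: "\<And>u v. u \<in> fin_supp S \<Longrightarrow> v \<in> fin_supp S \<Longrightarrow> f (u + v) = f u + f v"
      "\<And>c v. v \<in> fin_supp S \<Longrightarrow> f (fscale c v) = c * f v"
    and eq: "\<And>s. s \<in> S \<Longrightarrow> f (delta s) = (if s \<in> T then 1 else 0)" and v: "v \<in> fin_supp S"
  shows "f v = mass T v"
proof -
  have "fin_supp S \<subseteq> {v \<in> fin_supp S. mass T v = f v}"
    using subspace_mass_eq[OF subspace_fin_supp order_refl f] eq
    by (intro fin_supp_least) (auto simp: delta_in mass_delta)
  then show ?thesis using v by auto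
qed

lemma mass_aug:
  assumes L: "L \<subseteq> carrier G" and S: "invariant L S"
    and T: "\<And>l s. l \<in> L \<Longrightarrow> s \<in> S \<Longrightarrow> shift l s \<in> T \<longleftrightarrow> s \<in> T"
    and v: "v \<in> aug L (fin_supp S)"
  shows "mass T v = 0"
proof -
  note SM = submod_act[OF submod_fin_supp[OF L S]]
  have "aug L (fin_supp S) \<subseteq> {v \<in> fin_supp S. mass T v = 0}"
  proof (rule aug_minimal)
    show "fn.subspace {v \<in> fin_supp S. mass T v = 0}"
      by (rule subspace_mass_eq[OF subspace_fin_supp order_refl]) auto
    fix l v assume l: "l \<in> L" and v: "v \<in> fin_supp S"
    have "mass T (translate l v) = mass T v"
    proof (rule mass_on_fin_supp[where f = "\<lambda>v. mass T (translate l v)", OF _ _ _ v])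
      fix s assume "s \<in> S"
      then show "mass T (translate l (delta s)) = (if s \<in> T then 1 else 0)"
        using T[OF l] L l S by (subst translate_delta) (auto simp: mass_delta invariant_def)
    qed (auto simp: act_add act_scale mass_scale SM[OF l] mass_add[of _ S])
    then show "dif l v \<in> {v \<in> fin_supp S. mass T v = 0}"
      using SM[OF l v] v mass_diff[OF SM[OF l v] v] submod_dif[OF submod_fin_supp[OF L S] l v]
      by (simp add: dif_def)
  qed
  then show ?thesis using v by auto
qed

text \<open>Replacing every point by its orbit representative changes a function only by an element of
  \<open>aug L (fin_supp S)\<close>, and it annihilates the functions whose sum over each orbit is zero. Together with
  \<open>mass_aug\<close> this identifies the coinvariants of a permutation module with functions on the set of orbits.\<close>

lemma orbit_masses_aug:
  assumes L: "subgroup L G" and S: "invariant L S" and v: "v \<in> fin_supp S"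
    and zero: "\<And>s. s \<in> S \<Longrightarrow> mass (orb L s) v = 0"
  shows "v \<in> aug L (fin_supp S)"
proof -
  have LG: "L \<subseteq> carrier G" using L subgroup.subset by blast
  have SP: "S \<subseteq> points" using S invariant_def by auto
  define \<rho> where "\<rho> = extend (\<lambda>s. delta (rep L s))"
  let ?Z = "{v \<in> fin_supp S. \<rho> v - v \<in> aug L (fin_supp S)}"
  have "fin_supp S \<subseteq> ?Z"
  proof (intro fin_supp_least fn.subspaceI)
    show "0 \<in> ?Z"
      using fn.subspace_0[OF subspace_fin_supp] fn.subspace_0[OF subspace_aug]
      by (simp add: \<rho>_def)
  next
    fix u v assume *: "u \<in> ?Z"
      "v \<in> ?Z"
    then have "\<rho> (u + v) - (u + v) = (\<rho> u - u) + (\<rho> v - v)"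
      unfolding \<rho>_def using extend_add[of u S v] by simp
    also have "\<dots> \<in> aug L (fin_supp S)" using * fn.subspace_add[OF subspace_aug] by blast
    finally show "u + v \<in> ?Z"
      using * fn.subspace_add[OF subspace_fin_supp] by blast
  next
    fix c v assume *: "v \<in> ?Z"
    have "\<rho> (fscale c v) - fscale c v = fscale c (\<rho> v - v)"
      unfolding \<rho>_def by (simp add: extend_scale fn.scale_right_diff_distrib)
    also have "\<dots> \<in> aug L (fin_supp S)" using * fn.subspace_scale[OF subspace_aug] by blast
    finally show "fscale c v \<in> ?Z"
      using * fn.subspace_scale[OF subspace_fin_supp] by blast
  next
    fix s assume s: "s \<in> S"
    then have sp: "s \<in> points" using SP by auto
    obtain l where l: "l \<in> L" "rep L s = shift l s" using rep_orb[OF L sp] by (auto simp: orb_def)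
    have "\<rho> (delta s) - delta s = dif l (delta s)"
      using l LG sp by (simp add: \<rho>_def dif_def translate_delta subset_iff)
    then show "delta s \<in> ?Z"
      using dif_in_aug[OF l(1)] delta_in[OF s] by simp
  qed
  then have "\<rho> v - v \<in> aug L (fin_supp S)" using v by auto
  moreover have "\<rho> v = 0"
  proof
    fix y
    have "\<rho> v y = (\<Sum>s | v s \<noteq> 0. (if rep L s = y then 1 else 0) * v s)"
      by (auto simp: \<rho>_def extend_def pairing_def delta_def intro!: sum.cong)
    also have "\<dots> = 0"
    proof (cases "\<exists>s0. v s0 \<noteq> 0 \<and> rep L s0 = y")
      case True
      then obtain s0 where s0: "v s0 \<noteq> 0" "rep L s0 = y" by blast
      have supp: "s \<in> S" if "v s \<noteq> 0" for s using that v by (auto simp: fin_supp_def)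
      have "rep L s = y \<longleftrightarrow> s \<in> orb L s0" if "v s \<noteq> 0" for s
        using rep_eq_iff[OF L invariantD(1)[OF S supp[OF s0(1)]] invariantD(1)[OF S supp[OF that]]] s0(2)
        by simp
      then have "(\<Sum>s | v s \<noteq> 0. (if rep L s = y then 1 else 0) * v s) = mass (orb L s0) v"
        unfolding mass_def pairing_def by (intro sum.cong) auto
      then show ?thesis using zero supp s0 by simp
    next
      case False
      show ?thesis
      proof (intro sum.neutral ballI)
        fix s assume "s \<in> {s. v s \<noteq> 0}"
        then have "rep L s \<noteq> y" using False by blast
        then show "(if rep L s = y then 1 else 0) * v s = 0" by simp
      qed
    qed
    finally show "\<rho> v y = 0 y" by simp
  qed
  ultimately have "- v \<in> aug L (fin_supp S)" by simp
  then show ?thesis using fn.subspace_neg[OF subspace_aug] by fastforce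
qed

text \<open>If \<open>t - 1\<close> annihilates \<open>u\<close> in coinvariants, then the orbit sums of \<open>u\<close> are invariant under \<open>t\<close>, and
  finite support forces them to vanish. To see a single orbit, \<open>u\<close> is summed over the half-line of orbits
  \<open>T = \<Union>\<^sub>a L t\<^sup>a s1\<close>, \<open>a \<ge> 0\<close>: this set and its shift \<open>T1 = t T\<close> are \<open>L\<close>-invariant and differ by the
  single orbit \<open>L s1\<close>.\<close>

lemma free_regular:
  assumes L: "subgroup L G" and t: "t \<in> carrier G" "normalizes t L" "\<And>a :: int. t [^] a \<in> L \<Longrightarrow> a = 0"
    and S: "invariant (carrier G) S" and u: "u \<in> fin_supp S" and dif: "dif t u \<in> aug L (fin_supp S)"
  shows "u \<in> aug L (fin_supp S)"
proof -
  have LG: "L \<subseteq> carrier G" using L subgroup.subset by blast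
  have SP: "S \<subseteq> points" using S invariant_def by auto
  have SL: "invariant L S" using S LG by (auto simp: invariant_def)
  note SM = submod_act[OF submod_fin_supp[OF order_refl S] t(1)]
  show ?thesis
  proof (rule orbit_masses_aug[OF L SL u])
    fix s1 assume s1: "s1 \<in> S"
    then have s1p: "s1 \<in> points" using SP by auto
    define T where "T = {shift (l \<otimes> t [^] (a::nat)) s1 | l a. l \<in> L}"
    define T1 where "T1 = {shift (l \<otimes> t [^] (Suc a)) s1 | l a. l \<in> L}"
    have closed: "shift k s \<in> T1" if k: "k \<in> L" and s: "s \<in> T1" for k s
    proof -
      obtain l a where la: "s = shift (l \<otimes> t [^] Suc a) s1" "l \<in> L" using s unfolding T1_def by blast
      have "shift k s = shift ((k \<otimes> l) \<otimes> t [^] Suc a) s1"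
        using la k LG t s1p by (simp add: shift_mult m_assoc subset_iff)
      then show ?thesis unfolding T1_def using subgroup.m_closed[OF L k la(2)] by blast
    qed
    have inv: "shift l s \<in> T1 \<longleftrightarrow> s \<in> T1" if l: "l \<in> L" and s: "s \<in> S" for l s
    proof
      assume "shift l s \<in> T1"
      then have "shift (inv l) (shift l s) \<in> T1" using closed subgroup.m_inv_closed[OF L l] by blast
      moreover have "s \<in> points" "l \<in> carrier G" using l s LG SP by auto
      ultimately show "s \<in> T1" using shift_one[of s] by (simp add: shift_mult)
    qed (use closed l in blast)
    have "mass T1 (dif t u) = 0" using mass_aug[OF LG SL inv dif] .
    then have "mass T1 (translate t u) = mass T1 u"
      using mass_diff[OF SM[OF u] u] by (simp add: dif_def)
    moreover have "mass T1 (translate t u) - mass T1 u = mass (orb L s1) u"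
    proof (rule mass_on_fin_supp[where f = "\<lambda>u. mass T1 (translate t u) - mass T1 u", OF _ _ _ u])
      fix s assume s: "s \<in> S"
      then have sp: "s \<in> points" using SP by auto
      have move: "shift t s = shift (l \<otimes> t [^] Suc a) s1 \<longleftrightarrow> s = shift (inv t \<otimes> l \<otimes> t \<otimes> t [^] a) s1"
        if l: "l \<in> L" for l and a :: nat
      proof -
        have lG: "l \<in> carrier G" using l LG by auto
        have "t [^] Suc a = t \<otimes> t [^] a" using t nat_pow_Suc2 by simp
        then have "inv t \<otimes> (l \<otimes> t [^] Suc a) = inv t \<otimes> l \<otimes> t \<otimes> t [^] a"
          using t lG by (simp add: m_assoc del: nat_pow_Suc)
        then have 1: "shift (inv t) (shift (l \<otimes> t [^] Suc a) s1) = shift (inv t \<otimes> l \<otimes> t \<otimes> t [^] a) s1"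
          using t lG s1p by (subst shift_mult) auto
        have 2: "shift (inv t) (shift t s) = s" "shift t (shift (inv t) x) = x" if "x \<in> points" for x
          using t sp that by (simp_all add: shift_mult shift_one)
        have "shift (l \<otimes> t [^] Suc a) s1 \<in> points" using s1p lG t by (intro shift_points) auto
        then show ?thesis using 1 2 by metis
      qed
      have a1: "shift t s \<in> T1 \<longleftrightarrow> s \<in> T"
      proof
        assume "shift t s \<in> T1"
        then obtain l and a :: nat where "l \<in> L" "s = shift (inv t \<otimes> l \<otimes> t \<otimes> t [^] a) s1"
          unfolding T1_def using move by blast
        then show "s \<in> T" unfolding T_def using t(2) unfolding normalizes_def by blast
      next
        assume "s \<in> T"
        then obtain l and a :: nat where la: "l \<in> L" "s = shift (l \<otimes> t [^] a) s1"
          unfolding T_def by blast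
        have "inv t \<otimes> (t \<otimes> l \<otimes> inv t) \<otimes> t = l" using t la LG by (simp add: m_assoc subset_iff)
            (simp add: m_assoc[symmetric] subset_iff)
        then show "shift t s \<in> T1"
          using move[of "t \<otimes> l \<otimes> inv t" a] la t(2) unfolding T1_def normalizes_def by auto
      qed
      have a2: "s \<in> T \<longleftrightarrow> s \<in> orb L s1 \<or> s \<in> T1"
      proof
        assume "s \<in> T"
        then obtain l and a :: nat where la: "l \<in> L" "s = shift (l \<otimes> t [^] a) s1"
          unfolding T_def by blast
        show "s \<in> orb L s1 \<or> s \<in> T1"
        proof (cases a)
          case 0
          then have "s = shift l s1" using la LG by auto
          then show ?thesis using la by (auto simp: orb_def)
        next
          case (Suc b)
          then show ?thesis using la unfolding T1_def by blast
        qed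
      next
        have "shift l s1 = shift (l \<otimes> t [^] (0::nat)) s1" if "l \<in> L" for l using that LG by auto
        then show "s \<in> orb L s1 \<or> s \<in> T1 \<Longrightarrow> s \<in> T" unfolding T_def T1_def orb_def by blast
      qed
      have a3: "s \<notin> T1" if so: "s \<in> orb L s1"
      proof
        assume "s \<in> T1"
        then obtain l and a :: nat where la: "l \<in> L" "s = shift (l \<otimes> t [^] Suc a) s1"
          unfolding T1_def by blast
        obtain l' where "l' \<in> L" "s = shift l' s1" using so unfolding orb_def by blast
        then have la: "l \<in> L" "l' \<in> L" "shift l' s1 = shift (l \<otimes> t [^] Suc a) s1" using la by auto
        moreover have "l' \<in> carrier G" "l \<otimes> t [^] Suc a \<in> carrier G" using la LG t by auto
        ultimately have "l' = l \<otimes> t [^] Suc a" using shift_inj[OF _ _ s1p] by blast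
        then have "inv l \<otimes> l' = t [^] int (Suc a)"
          using la LG t by (simp add: int_pow_int subset_iff m_assoc[symmetric] del: nat_pow_Suc of_nat_Suc)
        then have "int (Suc a) = 0"
          using t(3) subgroup.m_closed[OF L subgroup.m_inv_closed[OF L la(1)] la(2)] by metis
        then show False by simp
      qed
      show "mass T1 (translate t (delta s)) - mass T1 (delta s) = (if s \<in> orb L s1 then 1 else 0)"
        using a1 a2 a3 t sp by (auto simp: translate_delta mass_delta)
    qed (auto simp: act_add act_scale SM mass_add[of _ S] mass_scale right_diff_distrib)
    ultimately show "mass (orb L s1) u = 0" by simp
  qed
qed

end

section \<open>Submodules of free modules over a Noetherian group ring\<close>

definition ring_delta :: "'c \<Rightarrow> 'g \<Rightarrow> 'g \<Rightarrow> 'c::comm_ring_1" where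
  "ring_delta c g = (\<lambda>x. if x = g then c else 0)"

context group
begin

lemma group_ring_carrier: "f \<in> carrier (group_ring G) \<longleftrightarrow> finite {x. f x \<noteq> 0} \<and> {x. f x \<noteq> 0} \<subseteq> carrier G"
  by (simp add: group_ring_def)

lemma ring_delta_carrier: "g \<in> carrier G \<Longrightarrow> ring_delta c g \<in> carrier (group_ring G)"
  by (auto simp: group_ring_carrier ring_delta_def)

text \<open>Multiplication by a point mass is translation. Since point masses generate the group ring additively,
  this is all that is needed of its multiplication.\<close>

lemma ring_delta_mult:
  fixes f :: "'a \<Rightarrow> 'c::comm_ring_1"
  assumes g: "g \<in> carrier G" and f: "f \<in> carrier (group_ring G)"
  shows "ring_delta c g \<otimes>\<^bsub>group_ring G\<^esub> f = (\<lambda>x. if x \<in> carrier G then c * f (inv g \<otimes> x) else 0)"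
proof
  fix x
  have fG: "f k \<noteq> 0 \<Longrightarrow> k \<in> carrier G" for k using f by (auto simp: group_ring_carrier)
  let ?A = "{(h, k). ring_delta c g h \<noteq> 0 \<and> f k \<noteq> 0 \<and> h \<otimes> k = x}"
  have mult: "(ring_delta c g \<otimes>\<^bsub>group_ring G\<^esub> f) x = (\<Sum>(h, k)\<in>?A. ring_delta c g h * f k)"
    by (simp add: group_ring_def)
  show "(ring_delta c g \<otimes>\<^bsub>group_ring G\<^esub> f) x = (if x \<in> carrier G then c * f (inv g \<otimes> x) else 0)"
  proof (cases "x \<in> carrier G \<and> c \<noteq> 0 \<and> f (inv g \<otimes> x) \<noteq> 0")
    case True
    have "?A = {(g, inv g \<otimes> x)}"
      using True g fG by (auto simp: ring_delta_def m_assoc[symmetric] split: if_splits)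
    then show ?thesis using True unfolding mult by (simp add: ring_delta_def)
  next
    case False
    have "?A = {}"
    proof (rule ccontr)
      assume "?A \<noteq> {}"
      then obtain k where k: "c \<noteq> 0" "f k \<noteq> 0" "g \<otimes> k = x" by (auto simp: ring_delta_def split: if_splits)
      then have "x \<in> carrier G" "inv g \<otimes> x = k" using g fG by (auto simp: m_assoc[symmetric])
      then show False using False k by auto
    qed
    then have "(ring_delta c g \<otimes>\<^bsub>group_ring G\<^esub> f) x = 0" unfolding mult by (simp only: sum.empty)
    then show ?thesis using False by auto
  qed
qed

lemma group_ring_induct [consumes 1, case_names zero add]:
  fixes f :: "'a \<Rightarrow> 'c::comm_ring_1"
  assumes f: "f \<in> carrier (group_ring G)"
    and zero: "Q (\<lambda>x. 0)"
    and add: "\<And>c g f. g \<in> carrier G \<Longrightarrow> f \<in> carrier (group_ring G) \<Longrightarrow> Q f \<Longrightarrow>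
      Q (\<lambda>x. ring_delta c g x + f x)"
  shows "Q f"
proof -
  have "finite A \<Longrightarrow> {x. f x \<noteq> 0} = A \<Longrightarrow> A \<subseteq> carrier G \<Longrightarrow> Q f" for A and f :: "'a \<Rightarrow> 'c"
  proof (induction A arbitrary: f rule: finite_induct)
    case empty
    have "f = (\<lambda>x. 0)" using empty.prems by (auto simp: fun_eq_iff)
    then show ?case using zero by simp
  next
    case (insert g A)
    define f' where "f' = f(g := 0)"
    have supp: "{x. f' x \<noteq> 0} = A" using insert.prems insert.hyps by (auto simp: f'_def)
    then have "f' \<in> carrier (group_ring G)" using insert by (simp add: group_ring_carrier)
    moreover have "Q f'" using insert.IH[OF supp] insert.prems by auto
    ultimately have "Q (\<lambda>x. ring_delta (f g) g x + f' x)" using add insert.prems by auto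
    moreover have "(\<lambda>x. ring_delta (f g) g x + f' x) = f" by (auto simp: ring_delta_def f'_def fun_eq_iff)
    ultimately show ?case by simp
  qed
  then show ?thesis using f unfolding group_ring_carrier by blast
qed

end

context group
begin

definition itrans :: "'a \<Rightarrow> ('a \<Rightarrow> int) \<Rightarrow> 'a \<Rightarrow> int" where
  "itrans g f = (\<lambda>x. if x \<in> carrier G then f (inv g \<otimes> x) else 0)"

text \<open>The left ideal of \<open>\<int>G\<close> generated by \<open>T\<close>, described by translates so that restriction to a subgroup can
  be followed through the generation process.\<close>

inductive_set int_span :: "('a \<Rightarrow> int) set \<Rightarrow> ('a \<Rightarrow> int) set" for T where
  zero: "(\<lambda>x. 0) \<in> int_span T"
| add: "g \<in> carrier G \<Longrightarrow> u \<in> T \<Longrightarrow> w \<in> int_span T \<Longrightarrow> (\<lambda>x. c * itrans g u x + w x) \<in> int_span T"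

lemma int_span_mono: "w \<in> int_span T \<Longrightarrow> T \<subseteq> T' \<Longrightarrow> w \<in> int_span T'"
  by (induction rule: int_span.induct) (auto intro: int_span.intros)

lemma int_span_add:
  "w \<in> int_span T \<Longrightarrow> w' \<in> int_span T \<Longrightarrow> (\<lambda>x. w x + w' x) \<in> int_span T"
  by (induction rule: int_span.induct) (auto simp: add.assoc intro: int_span.add)

lemma int_span_scale: "w \<in> int_span T \<Longrightarrow> (\<lambda>x. c * w x) \<in> int_span T"
proof (induction rule: int_span.induct)
  case (add g u w c')
  then show ?case using int_span.add[of g u T "\<lambda>x. c * w x" "c * c'"] by (simp add: algebra_simps)
qed (auto intro: int_span.zero)

lemma int_span_itrans:
  assumes T: "T \<subseteq> carrier (group_ring G)" and h: "h \<in> carrier G"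
  shows "w \<in> int_span T \<Longrightarrow> itrans h w \<in> int_span T"
proof (induction rule: int_span.induct)
  case zero
  have "itrans h (\<lambda>x. 0) = (\<lambda>x. 0)" by (auto simp: itrans_def)
  then show ?case using int_span.zero by simp
next
  case (add g u w c)
  have "itrans h (\<lambda>x. c * itrans g u x + w x) = (\<lambda>x. c * itrans (h \<otimes> g) u x + itrans h w x)"
    using add h by (auto simp: itrans_def fun_eq_iff inv_mult_group m_assoc)
  then show ?case using int_span.add[of "h \<otimes> g" u T "itrans h w" c] add h by simp
qed

lemma int_span_base:
  assumes "T \<subseteq> carrier (group_ring G)" "u \<in> T"
  shows "u \<in> int_span T"
proof -
  have "u \<in> carrier (group_ring G)" using assms by blast
  then have "u x = 0" if "x \<notin> carrier G" for x using that unfolding group_ring_carrier by blast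
  then have "u = (\<lambda>x. 1 * itrans \<one> u x + 0)"
    by (auto simp: itrans_def fun_eq_iff)
  then show ?thesis using int_span.add[OF one_closed assms(2) int_span.zero, of 1] by simp
qed

lemma int_span_carrier:
  assumes T: "T \<subseteq> carrier (group_ring G)"
  shows "int_span T \<subseteq> carrier (group_ring G)"
proof
  fix w assume "w \<in> int_span T"
  then show "w \<in> carrier (group_ring G)"
  proof (induction rule: int_span.induct)
    case zero
    then show ?case by (simp add: group_ring_carrier)
  next
    case (add g u w c)
    have u: "u \<in> carrier (group_ring G)" using T add by auto
    have "{x. itrans g u x \<noteq> 0} \<subseteq> (\<lambda>x. g \<otimes> x) ` {x. u x \<noteq> 0}"
    proof
      fix x assume "x \<in> {x. itrans g u x \<noteq> 0}"
      then have x: "x \<in> carrier G" "u (inv g \<otimes> x) \<noteq> 0" by (auto simp: itrans_def split: if_splits)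
      then have "x = g \<otimes> (inv g \<otimes> x)" using add by (simp add: m_assoc[symmetric])
      then show "x \<in> (\<lambda>x. g \<otimes> x) ` {x. u x \<noteq> 0}" using x by blast
    qed
    then have "finite {x. itrans g u x \<noteq> 0}" using u finite_surj unfolding group_ring_carrier by blast
    moreover have "{x. c * itrans g u x + w x \<noteq> 0} \<subseteq> {x. itrans g u x \<noteq> 0} \<union> {x. w x \<noteq> 0}" by auto
    ultimately have "finite {x. c * itrans g u x + w x \<noteq> 0}"
      using add finite_subset unfolding group_ring_carrier by blast
    moreover have "{x. c * itrans g u x + w x \<noteq> 0} \<subseteq> carrier G"
      using add by (auto simp: itrans_def group_ring_carrier split: if_splits)
    ultimately show ?case unfolding group_ring_carrier by blast
  qed
qed

lemma left_ideal_int_span: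
  assumes R: "ring (integral_group_ring G)" and T: "T \<subseteq> carrier (integral_group_ring G)"
  shows "left_ideal (int_span T) (integral_group_ring G)"
proof -
  let ?R = "integral_group_ring G"
  interpret R: ring ?R by (rule R)
  have add: "f \<oplus>\<^bsub>?R\<^esub> g = (\<lambda>x. f x + g x)" for f g by (simp add: group_ring_def)
  have zero: "\<zero>\<^bsub>?R\<^esub> = (\<lambda>x. 0)" by (simp add: group_ring_def)
  show ?thesis
  proof (intro left_ideal.intro left_ideal_axioms.intro R additive_subgroup.intro)
    show "subgroup (int_span T) (add_monoid (?R))"
    proof (rule R.add.subgroupI)
      show "int_span T \<subseteq> carrier (?R)" by (rule int_span_carrier[OF T])
      show "int_span T \<noteq> {}" using int_span.zero by blast
      fix w assume w: "w \<in> int_span T"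
      have w': "(\<lambda>x. - 1 * w x) \<in> int_span T" using int_span_scale[OF w] by blast
      have "\<ominus>\<^bsub>?R\<^esub> w = (\<lambda>x. - 1 * w x)"
        using w w' int_span_carrier[OF T] by (intro R.minus_equality) (auto simp: add zero)
      then show "\<ominus>\<^bsub>?R\<^esub> w \<in> int_span T" using w' by simp
      fix w' assume "w' \<in> int_span T"
      then show "w \<oplus>\<^bsub>?R\<^esub> w' \<in> int_span T" using int_span_add[OF w] add by simp
    qed
    fix w a assume w: "w \<in> int_span T" and a: "a \<in> carrier (?R)"
    have wc: "w \<in> carrier (?R)" using w int_span_carrier[OF T] by blast
    show "a \<otimes>\<^bsub>?R\<^esub> w \<in> int_span T"
      using a
    proof (induction rule: group_ring_induct)
      case zero
      have "\<zero>\<^bsub>?R\<^esub> \<otimes>\<^bsub>?R\<^esub> w = \<zero>\<^bsub>?R\<^esub>"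
        using wc by simp
      then show ?case using int_span.zero by (simp add: group_ring_def)
    next
      case (add c g f)
      have "(\<lambda>x. ring_delta c g x + f x) \<otimes>\<^bsub>?R\<^esub> w
          = ring_delta c g \<otimes>\<^bsub>?R\<^esub> w \<oplus>\<^bsub>?R\<^esub> f \<otimes>\<^bsub>?R\<^esub> w"
        using R.l_distr[OF ring_delta_carrier[OF add(1)] add(2) wc] by (simp add: \<open>\<And>f g. f \<oplus>\<^bsub>?R\<^esub> g = (\<lambda>x. f x + g x)\<close>)
      moreover have "ring_delta c g \<otimes>\<^bsub>?R\<^esub> w = (\<lambda>x. c * itrans g w x)"
        using ring_delta_mult[OF add(1) wc] by (auto simp: itrans_def fun_eq_iff)
      moreover have "(\<lambda>x. c * itrans g w x) \<in> int_span T"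
        using int_span_scale[OF int_span_itrans[OF T add(1) w]] .
      ultimately show ?case using int_span_add add(3)
        by (simp add: \<open>\<And>f g. f \<oplus>\<^bsub>?R\<^esub> g = (\<lambda>x. f x + g x)\<close>)
    qed
  qed
qed

lemma int_span_finite_part:
  "w \<in> int_span T \<Longrightarrow> \<exists>T'. finite T' \<and> T' \<subseteq> T \<and> w \<in> int_span T'"
proof (induction rule: int_span.induct)
  case zero
  then show ?case using int_span.zero by blast
next
  case (add g u w c)
  then obtain T' where T': "finite T'" "T' \<subseteq> T" "w \<in> int_span T'" by blast
  have "w \<in> int_span (insert u T')" using int_span_mono[OF T'(3)] by blast
  then have "(\<lambda>x. c * itrans g u x + w x) \<in> int_span (insert u T')"
    using int_span.add[of g u "insert u T'"] add by blast
  then show ?case using T' add by (intro exI[of _ "insert u T'"]) auto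
qed

text \<open>A finite set of generators of the ideal generated by \<open>T\<close> involves only finitely many elements of \<open>T\<close>, so
  the generators can be chosen inside \<open>T\<close>.\<close>

lemma noetherian_int_span:
  assumes N: "left_noetherian (integral_group_ring G)" and T: "T \<subseteq> carrier (integral_group_ring G)"
  obtains T' where "finite T'" "T' \<subseteq> T" "T \<subseteq> int_span T'"
proof -
  have R: "ring (integral_group_ring G)" using N by (simp add: left_noetherian_def)
  have "fg_left_ideal (int_span T) (integral_group_ring G)"
    using N left_ideal_int_span[OF R T] by (simp add: left_noetherian_def)
  then obtain A where A: "finite A" "int_span T = \<Inter>{J. left_ideal J (integral_group_ring G) \<and> A \<subseteq> J}"
    unfolding fg_left_ideal_def by blast
  have "A \<subseteq> int_span T" unfolding A(2) by (rule Inter_greatest) simp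
  then have "\<forall>a\<in>A. \<exists>T'. finite T' \<and> T' \<subseteq> T \<and> a \<in> int_span T'"
    using int_span_finite_part by (metis subsetD)
  then obtain F where F: "\<And>a. a \<in> A \<Longrightarrow> finite (F a)" "\<And>a. a \<in> A \<Longrightarrow> F a \<subseteq> T"
    "\<And>a. a \<in> A \<Longrightarrow> a \<in> int_span (F a)" by metis
  define T' where "T' = \<Union>(F ` A)"
  have T': "finite T'" "T' \<subseteq> T" using F A by (auto simp: T'_def)
  have "a \<in> int_span T'" if "a \<in> A" for a
    using int_span_mono[OF F(3)[OF that]] that by (auto simp: T'_def)
  then have "A \<subseteq> int_span T'" by blast
  moreover have "left_ideal (int_span T') (integral_group_ring G)"
    using left_ideal_int_span[OF R] T'(2) T by simp
  ultimately have "int_span T \<subseteq> int_span T'" unfolding A(2) by (intro Inter_lower) simp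
  then have "T \<subseteq> int_span T'" using int_span_base[OF T] by (meson subsetD subsetI)
  then show ?thesis using that T' by metis
qed

end

context permutation_modules
begin

definition lspan :: "'g set \<Rightarrow> (nat \<times> 'g \<Rightarrow> rat) set \<Rightarrow> (nat \<times> 'g \<Rightarrow> rat) set" where
  "lspan L T = fn.span {translate l t | l t. l \<in> L \<and> t \<in> T}"

definition row :: "nat \<Rightarrow> (nat \<times> 'g \<Rightarrow> rat) \<Rightarrow> nat \<times> 'g \<Rightarrow> rat" where
  "row r v = (\<lambda>(i, x). if i = r then v (i, x) else 0)"

definition int_row :: "nat \<Rightarrow> ('g \<Rightarrow> int) \<Rightarrow> nat \<times> 'g \<Rightarrow> rat" where
  "int_row r f = (\<lambda>(i, x). if i = r then of_int (f x) else 0)"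

lemma invariant_rows: "subgroup L G \<Longrightarrow> invariant L (I \<times> L)"
  using subgroup.subset[of L G] subgroup.m_closed[of L G]
  by (auto simp: invariant_def points_def shift_def)

lemma lspan_mono: "T \<subseteq> T' \<Longrightarrow> lspan L T \<subseteq> lspan L T'"
  unfolding lspan_def by (intro fn.span_mono) auto

lemma lspan_subset:
  assumes "submod L E" "T \<subseteq> E"
  shows "lspan L T \<subseteq> E"
  unfolding lspan_def using assms submod_act[OF assms(1)] submod_subspace[OF assms(1)]
  by (intro fn.span_minimal) auto

lemma common_denominator:
  fixes v :: "'s \<Rightarrow> rat"
  assumes "finite A"
  shows "\<exists>N::int. N \<noteq> 0 \<and> (\<forall>s\<in>A. \<exists>m::int. of_int N * v s = of_int m)"
  using assms
proof (induction A rule: finite_induct)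
  case empty
  then show ?case by (intro exI[of _ 1]) auto
next
  case (insert s A)
  then obtain N :: int where N: "N \<noteq> 0" "\<And>s. s \<in> A \<Longrightarrow> \<exists>m::int. of_int N * v s = of_int m" by blast
  obtain p q :: int where pq: "v s = of_int p / of_int q" "q \<noteq> 0"
    by (cases "v s") (auto simp: Fract_of_int_quotient)
  have "\<exists>m::int. of_int (N * q) * v s' = of_int m" if s': "s' \<in> insert s A" for s'
  proof (cases "s' = s")
    case True
    then have "of_int (N * q) * v s' = of_int (N * p)" using pq by simp
    then show ?thesis by blast
  next
    case False
    then obtain m :: int where "of_int N * v s' = of_int m" using N(2)[of s'] s' by blast
    then have "of_int (N * q) * v s' = of_int (m * q)" by (simp add: mult_ac)
    then show ?thesis by blast
  qed
  then show ?case using N pq by (intro exI[of _ "N * q"]) auto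
qed

text \<open>A left ideal \<open>J\<close> of \<open>\<rat>L\<close> is finitely generated: clearing denominators, it is generated by its integral
  elements, and these lie in the left ideal of \<open>\<int>G\<close> generated by finitely many of them. As a left
  \<open>\<int>L\<close>-module, \<open>\<int>G\<close> has the direct summand \<open>\<int>L\<close>, with complement spanned by \<open>G - L\<close>. Restricting
  a \<open>\<int>G\<close>-combination of elements supported on \<open>L\<close> to \<open>L\<close> removes exactly the translates by elements outside
  \<open>L\<close>, hence leaves a \<open>\<int>L\<close>-combination of the same elements.\<close>

lemma row_fg:
  assumes N: "left_noetherian (integral_group_ring G)" and L: "subgroup L G"
    and J: "submod L J" "J \<subseteq> fin_supp ({r} \<times> L)"
  shows "\<exists>T. finite T \<and> T \<subseteq> J \<and> J \<subseteq> lspan L T"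
proof -
  have LG: "L \<subseteq> carrier G" using L subgroup.subset by blast
  define Z where "Z = {f :: 'g \<Rightarrow> int. int_row r f \<in> J}"
  have supp: "finite {x. f x \<noteq> 0}" "{x. f x \<noteq> 0} \<subseteq> L" if "f \<in> Z" for f
  proof -
    have *: "(\<lambda>x. (r, x)) ` {x. f x \<noteq> 0} = {s. int_row r f s \<noteq> 0}"
      by (auto simp: int_row_def split: if_splits)
    have fs: "int_row r f \<in> fin_supp ({r} \<times> L)" using that J by (auto simp: Z_def)
    then have "finite ((\<lambda>x. (r, x)) ` {x. f x \<noteq> 0})" unfolding * by (simp add: fin_supp_def)
    then show "finite {x. f x \<noteq> 0}" by (rule finite_imageD) (auto simp: inj_on_def)
    have "(\<lambda>x. (r, x)) ` {x. f x \<noteq> 0} \<subseteq> {r} \<times> L" unfolding * using fs by (simp add: fin_supp_def)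
    then show "{x. f x \<noteq> 0} \<subseteq> L" by auto
  qed
  have ZC: "Z \<subseteq> carrier (integral_group_ring G)"
  proof
    fix f assume "f \<in> Z"
    from supp[OF this] LG show "f \<in> carrier (integral_group_ring G)" unfolding group_ring_carrier by blast
  qed
  obtain T where T: "finite T" "T \<subseteq> Z" "Z \<subseteq> int_span T" using noetherian_int_span[OF N ZC] by blast
  define T' where "T' = int_row r ` T"
  have restrict: "int_row r (\<lambda>x. if x \<in> L then w x else 0) \<in> lspan L T'" if "w \<in> int_span T" for w
    using that
  proof (induction rule: int_span.induct)
    case zero
    have "int_row r (\<lambda>x. if x \<in> L then 0 else 0) = 0" by (auto simp: int_row_def fun_eq_iff)
    then show ?case unfolding lspan_def by (metis fn.span_zero)
  next
    case (add g u w c)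
    have "u \<in> Z" using add T by blast
    from supp(2)[OF this] have u: "u x \<noteq> 0 \<Longrightarrow> x \<in> L" for x by blast
    have part: "int_row r (\<lambda>x. if x \<in> L then itrans g u x else 0) \<in> lspan L T'"
    proof (cases "g \<in> L")
      case True
      have "inv g \<otimes> x \<in> L \<longleftrightarrow> x \<in> L" if x: "x \<in> carrier G" for x
      proof
        assume "inv g \<otimes> x \<in> L"
        then have "g \<otimes> (inv g \<otimes> x) \<in> L" using True subgroup.m_closed[OF L] by blast
        then show "x \<in> L" using x add by (simp add: m_assoc[symmetric])
      qed (use True subgroup.m_closed[OF L] subgroup.m_inv_closed[OF L] in blast)
      then have eq: "int_row r (\<lambda>x. if x \<in> L then itrans g u x else 0) = translate g (int_row r u)"
        using u LG by (auto simp: int_row_def translate_def itrans_def fun_eq_iff)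
      show ?thesis unfolding eq lspan_def
        by (rule fn.span_base) (use True add T'_def in blast)
    next
      case False
      have "\<not> (x \<in> L \<and> itrans g u x \<noteq> 0)" for x
      proof
        assume x: "x \<in> L \<and> itrans g u x \<noteq> 0"
        then have "inv g \<otimes> x \<in> L" using u by (auto simp: itrans_def split: if_splits)
        then have "x \<otimes> inv (inv g \<otimes> x) \<in> L"
          using x subgroup.m_closed[OF L] subgroup.m_inv_closed[OF L] by blast
        moreover have "x \<otimes> inv (inv g \<otimes> x) = g" using x add(1) subgroup.mem_carrier[OF L]
          by (simp add: inv_mult_group m_assoc[symmetric])
        ultimately show False using False by simp
      qed
      then have "(\<lambda>x. if x \<in> L then itrans g u x else 0) = (\<lambda>x. 0)" by auto
      moreover have "int_row r (\<lambda>x. 0) = 0" by (auto simp: int_row_def fun_eq_iff)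
      ultimately have eq: "int_row r (\<lambda>x. if x \<in> L then itrans g u x else 0) = 0" by metis
      show ?thesis unfolding eq lspan_def by (rule fn.span_zero)
    qed
    have eq: "int_row r (\<lambda>x. if x \<in> L then c * itrans g u x + w x else 0)
        = fscale (of_int c) (int_row r (\<lambda>x. if x \<in> L then itrans g u x else 0))
          + int_row r (\<lambda>x. if x \<in> L then w x else 0)"
      by (auto simp: int_row_def fscale_def fun_eq_iff)
    show ?case using part add.IH unfolding eq lspan_def
      by (intro fn.span_add fn.span_scale)
  qed
  have "J \<subseteq> lspan L T'"
  proof
    fix v assume v: "v \<in> J"
    then have vf: "finite {s. v s \<noteq> 0}" "{s. v s \<noteq> 0} \<subseteq> {r} \<times> L" using J by (auto simp: fin_supp_def)
    obtain n :: int where n: "n \<noteq> 0" "\<forall>s\<in>{s. v s \<noteq> 0}. \<exists>m::int. of_int n * v s = of_int m"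
      using common_denominator[OF vf(1)] by blast
    have "\<exists>m::int. of_int n * v (r, x) = of_int m" for x
    proof (cases "v (r, x) = 0")
      case True
      then show ?thesis by (intro exI[of _ 0]) simp
    qed (use n in blast)
    then obtain f :: "'g \<Rightarrow> int" where f: "\<And>x. of_int n * v (r, x) = of_int (f x)" by metis
    have row: "int_row r f = fscale (of_int n) v"
    proof (rule ext, clarify)
      fix i x
      have "v (i, x) = 0" if "i \<noteq> r" using vf(2) that by blast
      then show "int_row r f (i, x) = fscale (of_int n) v (i, x)"
        using f by (auto simp: int_row_def fscale_def)
    qed
    then have fZ: "f \<in> Z" using fn.subspace_scale[OF submod_subspace[OF J(1)] v] by (simp add: Z_def)
    have "f x = 0" if "x \<notin> L" for x using supp(2)[OF fZ] that by blast
    then have fL: "(\<lambda>x. if x \<in> L then f x else 0) = f" by auto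
    have "f \<in> int_span T" using T fZ by blast
    from restrict[OF this] have "fscale (of_int n) v \<in> lspan L T'" unfolding fL row .
    then have "fscale (1 / of_int n) (fscale (of_int n) v) \<in> lspan L T'"
      unfolding lspan_def using fn.span_scale by blast
    then show "v \<in> lspan L T'" using n by simp
  qed
  moreover have "finite T'" "T' \<subseteq> J" using T(1,2) unfolding T'_def Z_def by auto
  ultimately show ?thesis by (intro exI[of _ T'] conjI)
qed

lemma row_add: "row r (u + v) = row r u + row r v"
  by (auto simp: row_def fun_eq_iff)

lemma row_scale: "row r (fscale c v) = fscale c (row r v)"
  by (auto simp: row_def fun_eq_iff fscale_def)

lemma row_translate: "row r (translate g v) = translate g (row r v)"
  by (auto simp: row_def fun_eq_iff translate_def)

lemma row_lhom: "lhom L M UNIV (row r)"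
  by (intro lhomI) (auto simp: row_add row_scale row_translate)

text \<open>Left ideals are the case of one row. The general case is the usual induction on the rank, splitting off
  the last row.\<close>

lemma submodule_fg:
  assumes N: "left_noetherian (integral_group_ring G)" and L: "subgroup L G"
  shows "submod L E \<Longrightarrow> E \<subseteq> fin_supp ({..<r} \<times> L) \<Longrightarrow> \<exists>T. finite T \<and> T \<subseteq> E \<and> E \<subseteq> lspan L T"
proof (induction r arbitrary: E)
  case 0
  then have "E \<subseteq> {0}" by (auto simp: fin_supp_def fun_eq_iff)
  then show ?case unfolding lspan_def using fn.span_zero by (intro exI[of _ "{}"]) auto
next
  case (Suc r)
  note ES = submod_subspace[OF Suc.prems(1)] and EA = submod_act[OF Suc.prems(1)]
  define E' where "E' = {v \<in> E. row r v = 0}"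
  have row0: "row r 0 = 0" by (auto simp: row_def fun_eq_iff)
  have E'1: "submod L E'"
    unfolding submod_def
  proof
    show "fn.subspace E'"
      using ES by (intro fn.subspaceI)
        (auto simp: E'_def fn.subspace_0 fn.subspace_add fn.subspace_scale row_add row_scale row0)
    show "\<forall>l\<in>L. \<forall>v\<in>E'. translate l v \<in> E'" using EA by (auto simp: E'_def row_translate)
  qed
  have E'2: "E' \<subseteq> fin_supp ({..<r} \<times> L)"
  proof
    fix v assume v: "v \<in> E'"
    have "v (r, x) = 0" for x
      using v by (auto simp: E'_def row_def fun_eq_iff dest: spec[of _ r])
    then show "v \<in> fin_supp ({..<r} \<times> L)"
      using v Suc.prems(2) by (fastforce simp: fin_supp_def E'_def less_Suc_eq)
  qed
  obtain T1 where T1: "finite T1" "T1 \<subseteq> E'" "E' \<subseteq> lspan L T1"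
    using Suc.IH[OF E'1 E'2] by blast
  define J where "J = row r ` E"
  have J1: "submod L J"
    unfolding submod_def
  proof
    show "fn.subspace J" unfolding J_def by (rule subspace_lhom_image[OF row_lhom ES])
    show "\<forall>l\<in>L. \<forall>v\<in>J. translate l v \<in> J" using EA by (auto simp: J_def simp flip: row_translate)
  qed
  have J2: "J \<subseteq> fin_supp ({r} \<times> L)"
  proof
    fix u assume "u \<in> J"
    then obtain v where v: "v \<in> E" "u = row r v" by (auto simp: J_def)
    have "{s. u s \<noteq> 0} \<subseteq> {s. v s \<noteq> 0} \<inter> {r} \<times> UNIV" using v by (auto simp: row_def split: if_splits)
    moreover have "finite {s. v s \<noteq> 0}" "{s. v s \<noteq> 0} \<subseteq> {..<Suc r} \<times> L"
      using v Suc.prems(2) by (auto simp: fin_supp_def)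
    ultimately show "u \<in> fin_supp ({r} \<times> L)"
      unfolding fin_supp_def by (auto intro: finite_subset)
  qed
  obtain T2 where T2: "finite T2" "T2 \<subseteq> J" "J \<subseteq> lspan L T2" using row_fg[OF N L J1 J2] by blast
  obtain T3 where T3: "finite T3" "T3 \<subseteq> E" "T2 = row r ` T3"
    using T2 unfolding J_def by (metis finite_subset_image)
  have lift: "\<exists>v\<in>lspan L T3. row r v = u" if "u \<in> lspan L T2" for u
  proof -
    have "lspan L T2 \<subseteq> row r ` lspan L T3"
      unfolding lspan_def[of L T2]
    proof (rule fn.span_minimal)
      show "{translate l t |l t. l \<in> L \<and> t \<in> T2} \<subseteq> row r ` lspan L T3"
      proof clarify
        fix l t assume l: "l \<in> L" and "t \<in> T2"
        then obtain t' where t': "t' \<in> T3" "t = row r t'" using T3(3) by blast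
        have "translate l t' \<in> lspan L T3" unfolding lspan_def using l t' by (blast intro: fn.span_base)
        then show "translate l t \<in> row r ` lspan L T3" using t' by (simp flip: row_translate)
      qed
      show "fn.subspace (row r ` lspan L T3)"
        using subspace_lhom_image[OF row_lhom] by (simp add: lspan_def)
    qed
    then show ?thesis using that by blast
  qed
  have "E \<subseteq> lspan L (T1 \<union> T3)"
  proof
    fix v assume v: "v \<in> E"
    then obtain v' where v': "v' \<in> lspan L T3" "row r v' = row r v" using lift T2(3) J_def by blast
    have "v' \<in> E" using v' lspan_subset[OF Suc.prems(1) T3(2)] by blast
    moreover have "row r (v - v') = row r v - row r v'" by (auto simp: row_def fun_eq_iff)
    ultimately have "v - v' \<in> E'" using v v' fn.subspace_diff[OF ES] by (simp add: E'_def)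
    then have "v - v' \<in> lspan L (T1 \<union> T3)" "v' \<in> lspan L (T1 \<union> T3)"
      using T1(3) v' lspan_mono[of T1 "T1 \<union> T3" L] lspan_mono[of T3 "T1 \<union> T3" L] by auto
    then have "(v - v') + v' \<in> lspan L (T1 \<union> T3)" unfolding lspan_def using fn.span_add by blast
    then show "v \<in> lspan L (T1 \<union> T3)" by simp
  qed
  moreover have "finite (T1 \<union> T3)" "T1 \<union> T3 \<subseteq> E" using T1 T3 E'_def by blast+
  ultimately show ?case by (intro exI[of _ "T1 \<union> T3"] conjI)
qed

lemma finite_free_cover:
  assumes L: "subgroup L G" and E: "submod L E" and T: "finite T" "T \<subseteq> E" "E \<subseteq> lspan L T"
  shows "\<exists>r \<rho>. lhom L (fin_supp ({..<r::nat} \<times> L)) UNIV \<rho> \<and> \<rho> ` fin_supp ({..<r} \<times> L) = E"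
proof -
  have LG: "L \<subseteq> carrier G" using L subgroup.subset by blast
  obtain e where "bij_betw e {0..<card T} T" using ex_bij_betw_nat_finite[OF T(1)] by blast
  then have e: "T = e ` {..<card T}" by (simp add: bij_betw_def atLeast0LessThan)
  define r where "r = card T"
  define \<phi> where "\<phi> = (\<lambda>(i, l). translate l (e i))"
  let ?F = "fin_supp ({..<r} \<times> L)"
  have eE: "e i \<in> E" if "i < r" for i using that e T(2) r_def by blast
  have h: "lhom L ?F E (extend \<phi>)"
  proof (rule lhom_extend[OF LG invariant_rows[OF L] submod_subspace[OF E]])
    show "\<phi> s \<in> E" if "s \<in> {..<r} \<times> L" for s
      using that submod_act[OF E] eE by (auto simp: \<phi>_def)
    show "\<phi> (shift l s) = translate l (\<phi> s)" if "l \<in> L" "s \<in> {..<r} \<times> L" for l s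
      using that LG act_mult by (auto simp: \<phi>_def shift_def subset_iff)
  qed
  have sub: "fn.subspace (extend \<phi> ` ?F)" by (rule subspace_lhom_image[OF h subspace_fin_supp])
  have "lspan L T \<subseteq> extend \<phi> ` ?F"
    unfolding lspan_def
  proof (rule fn.span_minimal[OF _ sub], clarify)
    fix l t assume l: "l \<in> L" and "t \<in> T"
    then obtain i where i: "i < r" "t = e i" using e r_def by auto
    have "translate l t = extend \<phi> (delta (i, l))" using i by (simp add: \<phi>_def)
    then show "translate l t \<in> extend \<phi> ` ?F" using i l delta_in[of "(i, l)" "{..<r} \<times> L"] by blast
  qed
  then have "extend \<phi> ` ?F = E" using T(3) h by (auto simp: lhom_def)
  then show ?thesis using h by (intro exI[of _ r] exI[of _ "extend \<phi>"]) (auto simp: lhom_def)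
qed

text \<open>Coinvariants of the free module of rank \<open>r\<close> are \<open>r\<close>-dimensional, with the sums of the rows as
  coordinates.\<close>

lemma finite_codim_free:
  assumes L: "subgroup L G"
  shows "finite_codim (aug L (fin_supp ({..<r} \<times> L))) (fin_supp ({..<r} \<times> L))"
  unfolding finite_codim_def
proof (intro allI impI)
  let ?F = "fin_supp ({..<r} \<times> L)"
  fix v assume v: "\<forall>k::nat. v k \<in> ?F"
  define m where "m i k = mass ({i} \<times> L) (v k)" for i k
  obtain a where a: "\<exists>k\<in>{..r}. a k \<noteq> 0" "\<forall>i<r. (\<Sum>k\<in>{..r}. a k * m i k) = 0"
  proof -
    have "\<exists>a. (\<exists>k\<in>{..r}. a k \<noteq> 0) \<and> (\<forall>i<r. (\<Sum>k\<in>{..r}. a k * m i k) = 0)"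
      by (rule homogeneous_system) simp_all
    then show thesis using that by blast
  qed
  define w where "w = (\<Sum>k\<le>r. fscale (a k) (v k))"
  have part: "(\<Sum>k\<in>K. fscale (a k) (v k)) \<in> ?F \<and>
      mass T (\<Sum>k\<in>K. fscale (a k) (v k)) = (\<Sum>k\<in>K. a k * mass T (v k))" if "finite K" for K T
    using that
  proof (induction K rule: finite_induct)
    case empty
    have "mass T 0 = 0" by (simp add: mass_def pairing_def)
    then show ?case using fn.subspace_0[OF subspace_fin_supp] unfolding sum.empty by blast
  next
    case (insert k K)
    have "fscale (a k) (v k) \<in> ?F" using v fn.subspace_scale[OF subspace_fin_supp] by blast
    then have "fscale (a k) (v k) + (\<Sum>k\<in>K. fscale (a k) (v k)) \<in> ?F"
        "mass T (fscale (a k) (v k) + (\<Sum>k\<in>K. fscale (a k) (v k)))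
          = a k * mass T (v k) + (\<Sum>k\<in>K. a k * mass T (v k))"
      using insert.IH fn.subspace_add[OF subspace_fin_supp] mass_add[of "fscale (a k) (v k)" "{..<r} \<times> L"]
      by (blast, simp add: mass_scale)
    then show ?case unfolding sum.insert[OF insert.hyps] by blast
  qed
  have orb: "orb L s = {i} \<times> L" if "s = (i, x)" "x \<in> L" for s i x
  proof
    show "orb L s \<subseteq> {i} \<times> L" using that subgroup.m_closed[OF L] by (auto simp: orb_def shift_def)
    show "{i} \<times> L \<subseteq> orb L s"
    proof clarify
      fix y assume y: "y \<in> L"
      have "y \<otimes> inv x \<in> L"
        using y that subgroup.m_closed[OF L] subgroup.m_inv_closed[OF L] by blast
      moreover have "(i, y) = shift (y \<otimes> inv x) s"
        using that y subgroup.mem_carrier[OF L] by (simp add: shift_def m_assoc)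
      ultimately show "(i, y) \<in> orb L s" by (auto simp: orb_def)
    qed
  qed
  have w: "w \<in> aug L ?F"
  proof (rule orbit_masses_aug[OF L invariant_rows[OF L]])
    show "w \<in> ?F" using part w_def by blast
    fix s assume "s \<in> {..<r} \<times> L"
    then obtain i x where "s = (i, x)" "i < r" "x \<in> L" by blast
    then show "mass (orb L s) w = 0" using orb part[of "{..r}"] a(2) unfolding w_def m_def by simp
  qed
  have "\<exists>k\<le>r. a k \<noteq> 0" using a(1) by auto
  then show "\<exists>N a. (\<exists>k\<le>N. a k \<noteq> 0) \<and> (\<Sum>k\<le>N. fscale (a k) (v k)) \<in> aug L ?F"
    using w unfolding w_def by (rule exI[of _ r, OF exI[of _ a, OF conjI]])
qed

end

section \<open>Concrete resolutions for groups of type FP\<close>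

context left_module
begin

lemma smult_zero_right: "a \<in> carrier R \<Longrightarrow> a \<odot>\<^bsub>M\<^esub> \<zero>\<^bsub>M\<^esub> = \<zero>\<^bsub>M\<^esub>"
  using smult_r_distr[of a "\<zero>\<^bsub>M\<^esub>" "\<zero>\<^bsub>M\<^esub>"] smult_closed[of a "\<zero>\<^bsub>M\<^esub>"] M.add.l_cancel_one by auto

lemma smult_zero_left: "x \<in> carrier M \<Longrightarrow> \<zero> \<odot>\<^bsub>M\<^esub> x = \<zero>\<^bsub>M\<^esub>"
  using smult_l_distr[of \<zero> \<zero> x] smult_closed[of \<zero> x] M.add.l_cancel_one by auto

end

text \<open>The free module of rank \<open>k\<close> over \<open>\<rat>G\<close> as a record. Its elements have the same type as those of the
  modules in a resolution, so it is admissible as a test module for projectivity.\<close>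

definition free_module :: "('g, 'm) monoid_scheme \<Rightarrow> nat \<Rightarrow> ('g \<Rightarrow> rat, nat \<Rightarrow> 'g \<Rightarrow> rat) module" where
  "free_module G k =
    \<lparr>carrier = {v. (\<forall>i. v i \<in> carrier (group_ring G)) \<and> (\<forall>i\<ge>k. v i = (\<lambda>x. 0))},
     monoid.mult = (\<lambda>u v. u), one = (\<lambda>i x. 0), ring.zero = (\<lambda>i x. 0),
     ring.add = (\<lambda>u v i x. u i x + v i x), smult = (\<lambda>a v i. a \<otimes>\<^bsub>group_ring G\<^esub> v i)\<rparr>"

primrec lincomb :: "('a, 'b, 'm) module_scheme \<Rightarrow> (nat \<Rightarrow> 'b) \<Rightarrow> (nat \<Rightarrow> 'a) \<Rightarrow> nat \<Rightarrow> 'b" where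
  "lincomb M e v 0 = \<zero>\<^bsub>M\<^esub>"
| "lincomb M e v (Suc j) = lincomb M e v j \<oplus>\<^bsub>M\<^esub> v j \<odot>\<^bsub>M\<^esub> e j"

context left_module
begin

lemma lincomb_closed:
  "(\<And>i. i < j \<Longrightarrow> v i \<in> carrier R) \<Longrightarrow> (\<And>i. i < j \<Longrightarrow> e i \<in> carrier M) \<Longrightarrow> lincomb M e v j \<in> carrier M"
  by (induction j) (auto intro: smult_closed)

lemma lincomb_add:
  "(\<And>i. i < j \<Longrightarrow> u i \<in> carrier R) \<Longrightarrow> (\<And>i. i < j \<Longrightarrow> v i \<in> carrier R) \<Longrightarrow>
   (\<And>i. i < j \<Longrightarrow> e i \<in> carrier M) \<Longrightarrow>
   lincomb M e (\<lambda>i. u i \<oplus> v i) j = lincomb M e u j \<oplus>\<^bsub>M\<^esub> lincomb M e v j"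
  by (induction j) (auto simp: smult_l_distr smult_closed lincomb_closed M.add.m_ac)

lemma lincomb_smult:
  "a \<in> carrier R \<Longrightarrow> (\<And>i. i < j \<Longrightarrow> v i \<in> carrier R) \<Longrightarrow> (\<And>i. i < j \<Longrightarrow> e i \<in> carrier M) \<Longrightarrow>
   lincomb M e (\<lambda>i. a \<otimes> v i) j = a \<odot>\<^bsub>M\<^esub> lincomb M e v j"
  by (induction j) (auto simp: smult_zero_right smult_r_distr smult_assoc smult_closed lincomb_closed)

lemma lincomb_unit:
  assumes "i < j" "\<And>i. i < j \<Longrightarrow> e i \<in> carrier M"
  shows "lincomb M e (\<lambda>i'. if i' = i then \<one> else \<zero>) j = e i"
  using assms
proof (induction j)
  case (Suc j)
  have zero: "lincomb M e (\<lambda>i'. if i' = i then \<one> else \<zero>) j' = \<zero>\<^bsub>M\<^esub>" if "j' \<le> i" "j' \<le> j" for j'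
    using that Suc.prems(2) by (induction j') (auto simp: smult_zero_left)
  show ?case
  proof (cases "i = j")
    case True
    then show ?thesis using zero[of j] Suc.prems by (auto simp: smult_one)
  next
    case False
    then show ?thesis using Suc by (auto simp: smult_zero_left)
  qed
qed simp

end

context group
begin

lemma free_module_left_module:
  assumes R: "ring (rational_group_ring G)"
  shows "left_module (rational_group_ring G) (free_module G k)"
proof -
  let ?R = "rational_group_ring G"
  interpret R: ring ?R by (rule R)
  have add: "f \<oplus>\<^bsub>?R\<^esub> g = (\<lambda>x. f x + g x)" for f g by (simp add: group_ring_def)
  have zero: "\<zero>\<^bsub>?R\<^esub> = (\<lambda>x. 0)" by (simp add: group_ring_def)
  have F: "carrier (free_module G k) = {v. (\<forall>i. v i \<in> carrier (group_ring G)) \<and> (\<forall>i\<ge>k. v i = (\<lambda>x. 0))}"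
    "u \<oplus>\<^bsub>free_module G k\<^esub> v = (\<lambda>i. u i \<oplus>\<^bsub>?R\<^esub> v i)"
    "\<zero>\<^bsub>free_module G k\<^esub> = (\<lambda>i. \<zero>\<^bsub>?R\<^esub>)"
    "a \<odot>\<^bsub>free_module G k\<^esub> v = (\<lambda>i. a \<otimes>\<^bsub>?R\<^esub> v i)" for u v a
    by (simp_all add: free_module_def add zero)
  have zz: "(\<lambda>x. 0) \<oplus>\<^bsub>?R\<^esub> (\<lambda>x. 0) = (\<lambda>x. 0)" by (simp add: add)
  have az: "a \<otimes>\<^bsub>?R\<^esub> (\<lambda>x. 0) = (\<lambda>x. 0)" if "a \<in> carrier (?R)" for a
    using R.r_null[OF that] by (simp add: zero)
  show ?thesis
  proof (intro left_module.intro left_module_axioms.intro R abelian_groupI)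
    fix u assume u: "u \<in> carrier (free_module G k)"
    have minus: "\<ominus>\<^bsub>?R\<^esub> (\<lambda>x. 0) = (\<lambda>x. 0)" using R.minus_zero by (simp add: zero)
    show "\<exists>v\<in>carrier (free_module G k). v \<oplus>\<^bsub>free_module G k\<^esub> u = \<zero>\<^bsub>free_module G k\<^esub>"
      using u minus by (intro bexI[of _ "\<lambda>i. \<ominus>\<^bsub>?R\<^esub> u i"]) (auto simp: F R.l_neg)
  qed (auto simp: F zz az R.add.m_ac R.l_distr R.r_distr R.m_assoc simp flip: zero)
qed

end

context permutation_modules
begin

text \<open>An embedding \<open>\<iota>\<close> of the abstract module \<open>M\<close> as a direct summand into functions on \<open>{..<k} \<times> G\<close>, with
  retraction \<open>\<pi>\<close>. Linearity is required for the scalars \<open>c g\<close> with rational \<open>c\<close> and group element \<open>g\<close>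
  only, which on the concrete side are combinations of scaling and translation.\<close>

definition module_embedding ::
    "('g \<Rightarrow> rat, 'b) module \<Rightarrow> nat \<Rightarrow> ('b \<Rightarrow> nat \<times> 'g \<Rightarrow> rat) \<Rightarrow> ((nat \<times> 'g \<Rightarrow> rat) \<Rightarrow> 'b) \<Rightarrow> bool" where
  "module_embedding M k \<iota> \<pi> \<longleftrightarrow>
    (\<forall>x\<in>carrier M. \<iota> x \<in> fin_supp ({..<k} \<times> carrier G) \<and> \<pi> (\<iota> x) = x) \<and>
    (\<forall>x\<in>carrier M. \<forall>y\<in>carrier M. \<iota> (x \<oplus>\<^bsub>M\<^esub> y) = \<iota> x + \<iota> y) \<and>
    (\<forall>c. \<forall>g\<in>carrier G. \<forall>x\<in>carrier M. \<iota> (ring_delta c g \<odot>\<^bsub>M\<^esub> x) = fscale c (translate g (\<iota> x))) \<and>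
    (\<forall>v\<in>fin_supp ({..<k} \<times> carrier G). \<pi> v \<in> carrier M) \<and>
    (\<forall>u\<in>fin_supp ({..<k} \<times> carrier G). \<forall>v\<in>fin_supp ({..<k} \<times> carrier G). \<pi> (u + v) = \<pi> u \<oplus>\<^bsub>M\<^esub> \<pi> v) \<and>
    (\<forall>c. \<forall>g\<in>carrier G. \<forall>v\<in>fin_supp ({..<k} \<times> carrier G).
       \<pi> (fscale c (translate g v)) = ring_delta c g \<odot>\<^bsub>M\<^esub> \<pi> v)"

text \<open>Generators of \<open>M\<close> give a surjection \<open>p\<close> from a free module, and lifting the identity of \<open>M\<close> along \<open>p\<close> splits
  it.\<close>

lemma projective_embedding:
  fixes M :: "('g \<Rightarrow> rat, nat \<Rightarrow> 'g \<Rightarrow> rat) module"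
  assumes M: "left_module (rational_group_ring G) M" and fg: "fg_left_module (rational_group_ring G) M"
    and proj: "projective_left_module (rational_group_ring G) M"
  shows "\<exists>k \<iota> \<pi>. module_embedding M k \<iota> \<pi>"
proof -
  let ?R = "rational_group_ring G"
  interpret M: left_module ?R M by (rule M)
  have R: "ring ?R" by (rule M.R.ring_axioms)
  have add: "f \<oplus>\<^bsub>?R\<^esub> g = (\<lambda>x. f x + g x)" for f g by (simp add: group_ring_def)
  have zero: "\<zero>\<^bsub>?R\<^esub> = (\<lambda>x. 0)" by (simp add: group_ring_def)
  obtain A where A: "finite A" "A \<subseteq> carrier M" "carrier M = \<Inter>{N. submodule N ?R M \<and> A \<subseteq> N}"
    using fg unfolding fg_left_module_def by blast
  obtain e where "bij_betw e {0..<card A} A" using ex_bij_betw_nat_finite[OF A(1)] by blast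
  then have eA: "e ` {..<card A} = A" by (simp add: bij_betw_def atLeast0LessThan)
  define k where "k = card A"
  have e: "e i \<in> carrier M" if "i < k" for i
  proof -
    have "e i \<in> e ` {..<card A}" using that k_def by simp
    then have "e i \<in> A" using eA by simp
    then show ?thesis using A(2) by blast
  qed
  let ?F = "free_module G k"
  let ?S = "fin_supp ({..<k} \<times> carrier G)"
  have Fc: "v i \<in> carrier ?R" "i \<ge> k \<Longrightarrow> v i = (\<lambda>x. 0)" if "v \<in> carrier ?F" for v i
    using that by (auto simp: free_module_def)
  define p where "p v = lincomb M e v k" for v
  have pc: "p v \<in> carrier M" if "v \<in> carrier ?F" for v
    unfolding p_def using Fc[OF that] e by (intro M.lincomb_closed)
  have padd: "p (u \<oplus>\<^bsub>?F\<^esub> v) = p u \<oplus>\<^bsub>M\<^esub> p v" if "u \<in> carrier ?F" "v \<in> carrier ?F" for u v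
  proof -
    have "u \<oplus>\<^bsub>?F\<^esub> v = (\<lambda>i. u i \<oplus>\<^bsub>?R\<^esub> v i)" by (simp add: free_module_def add)
    then show ?thesis unfolding p_def using Fc that e M.lincomb_add by simp
  qed
  have psm: "p (a \<odot>\<^bsub>?F\<^esub> v) = a \<odot>\<^bsub>M\<^esub> p v" if "a \<in> carrier ?R" "v \<in> carrier ?F" for a v
  proof -
    have "a \<odot>\<^bsub>?F\<^esub> v = (\<lambda>i. a \<otimes>\<^bsub>?R\<^esub> v i)" by (simp add: free_module_def)
    then show ?thesis unfolding p_def using Fc that e M.lincomb_smult by simp
  qed
  have F: "left_module ?R ?F" by (rule free_module_left_module[OF R])
  interpret F: left_module ?R ?F by (rule F)
  have phom: "p \<in> left_module_hom ?R ?F M" using pc padd psm by (simp add: left_module_hom_def)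
  have "submodule (p ` carrier ?F) ?R M"
  proof (intro submodule.intro submodule_axioms.intro)
    show "subgroup (p ` carrier ?F) (add_monoid M)"
    proof (rule M.add.subgroupI)
      show "p ` carrier ?F \<subseteq> carrier M" using pc by blast
      show "p ` carrier ?F \<noteq> {}" using F.zero_closed by blast
    next
      fix x assume "x \<in> p ` carrier ?F"
      then obtain v where v: "v \<in> carrier ?F" "x = p v" by blast
      have "p (\<ominus>\<^bsub>?F\<^esub> v) \<oplus>\<^bsub>M\<^esub> p v = p \<zero>\<^bsub>?F\<^esub>" using v padd[of "\<ominus>\<^bsub>?F\<^esub> v" v] F.l_neg by simp
      moreover have "p \<zero>\<^bsub>?F\<^esub> = \<zero>\<^bsub>M\<^esub>"
        using padd[of "\<zero>\<^bsub>?F\<^esub>" "\<zero>\<^bsub>?F\<^esub>"] pc[of "\<zero>\<^bsub>?F\<^esub>"] M.add.l_cancel_one by auto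
      ultimately have "\<ominus>\<^bsub>M\<^esub> x = p (\<ominus>\<^bsub>?F\<^esub> v)" using v pc by (intro M.minus_equality) auto
      then show "\<ominus>\<^bsub>M\<^esub> x \<in> p ` carrier ?F" using v by blast
    next
      fix x y assume "x \<in> p ` carrier ?F" "y \<in> p ` carrier ?F"
      then obtain u v where "u \<in> carrier ?F" "x = p u" "v \<in> carrier ?F" "y = p v" by blast
      then show "x \<oplus>\<^bsub>M\<^esub> y \<in> p ` carrier ?F" by (intro image_eqI[of _ _ "u \<oplus>\<^bsub>?F\<^esub> v"]) (simp_all add: padd)
    qed
    fix a x assume "a \<in> carrier ?R" "x \<in> p ` carrier ?F"
    then obtain v where "a \<in> carrier ?R" "v \<in> carrier ?F" "x = p v" by blast
    then show "a \<odot>\<^bsub>M\<^esub> x \<in> p ` carrier ?F"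
      by (intro image_eqI[of _ _ "a \<odot>\<^bsub>?F\<^esub> v"]) (simp_all add: psm F.smult_closed)
  qed
  moreover have "A \<subseteq> p ` carrier ?F"
  proof
    fix x assume "x \<in> A"
    then have "x \<in> e ` {..<k}" using eA k_def by simp
    then obtain i where i: "i < k" "x = e i" by blast
    let ?v = "\<lambda>i'. if i' = i then \<one>\<^bsub>?R\<^esub> else \<zero>\<^bsub>?R\<^esub>"
    have "?v \<in> carrier ?F"
      using i M.R.one_closed M.R.zero_closed by (auto simp: free_module_def simp flip: zero)
    moreover have "p ?v = e i" unfolding p_def using i e by (intro M.lincomb_unit)
    ultimately show "x \<in> p ` carrier ?F" using i by (metis imageI)
  qed
  ultimately have "carrier M \<subseteq> p ` carrier ?F" unfolding A(3) by (intro Inter_lower) simp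
  then have surj: "p ` carrier ?F = carrier M" using pc by blast
  have id: "(\<lambda>x. x) \<in> left_module_hom ?R M M" by (simp add: left_module_hom_def)
  obtain h where h: "h \<in> left_module_hom ?R M ?F" "\<And>x. x \<in> carrier M \<Longrightarrow> p (h x) = x"
    using proj[unfolded projective_left_module_def, rule_format, OF conjI[OF F conjI[OF M conjI[OF phom conjI[OF surj id]]]]]
    by blast
  have hc: "h x \<in> carrier ?F" if "x \<in> carrier M" for x using h(1) that by (auto simp: left_module_hom_def)
  define \<iota> where "\<iota> x = (\<lambda>(i, y). h x i y)" for x
  define cur where "cur v = (\<lambda>i y. v (i, y))" for v :: "nat \<times> 'g \<Rightarrow> rat"
  have supp: "v i y = 0" if "v \<in> carrier ?F" "y \<notin> carrier G" for v i y
    using Fc(1)[OF that(1), of i] that(2) by (auto simp: group_ring_carrier)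
  have curF: "cur v \<in> carrier ?F" if "v \<in> ?S" for v
  proof -
    have v: "finite {s. v s \<noteq> 0}" "{s. v s \<noteq> 0} \<subseteq> {..<k} \<times> carrier G" using that by (auto simp: fin_supp_def)
    have "finite {y. v (i, y) \<noteq> 0}" for i
      using finite_vimageI[OF v(1), of "\<lambda>y. (i, y)"] by (auto simp: inj_on_def vimage_def)
    moreover have "{y. v (i, y) \<noteq> 0} \<subseteq> carrier G" for i using v(2) by blast
    moreover have "v (i, y) = 0" if "i \<ge> k" for i y using v(2) that by force
    ultimately show ?thesis by (auto simp: free_module_def cur_def group_ring_carrier fun_eq_iff)
  qed
  have \<iota>S: "\<iota> x \<in> ?S" if "x \<in> carrier M" for x
  proof -
    note v = hc[OF that]
    have ik: "i < k" if nz: "h x i y \<noteq> 0" for i y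
    proof (rule ccontr)
      assume "\<not> i < k"
      then show False using Fc(2)[OF v, of i] nz by simp
    qed
    have yG: "y \<in> carrier G" if nz: "h x i y \<noteq> 0" for i y using supp[OF v] nz by blast
    have "{s. \<iota> x s \<noteq> 0} \<subseteq> (\<Union>i<k. (\<lambda>y. (i, y)) ` {y. h x i y \<noteq> 0})"
      using ik by (auto simp: \<iota>_def)
    moreover have "finite (\<Union>i<k. (\<lambda>y. (i, y)) ` {y. h x i y \<noteq> 0})"
      using Fc(1)[OF v] by (simp add: group_ring_carrier)
    moreover have "{s. \<iota> x s \<noteq> 0} \<subseteq> {..<k} \<times> carrier G"
      using ik yG by (auto simp: \<iota>_def)
    ultimately show ?thesis unfolding fin_supp_def using finite_subset by blast
  qed
  have cur\<iota>: "cur (\<iota> x) = h x" for x by (simp add: cur_def \<iota>_def)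
  have rd: "ring_delta c g \<in> carrier ?R" if "g \<in> carrier G" for c :: rat and g
    using ring_delta_carrier that by blast
  have act: "ring_delta c g \<odot>\<^bsub>?F\<^esub> v = (\<lambda>i y. if y \<in> carrier G then c * v i (inv g \<otimes> y) else 0)"
    if "g \<in> carrier G" "v \<in> carrier ?F" for c g v
    using ring_delta_mult[OF that(1) Fc(1)[OF that(2)]] by (simp add: free_module_def)
  have "module_embedding M k \<iota> (\<lambda>v. p (cur v))"
    unfolding module_embedding_def
  proof (intro conjI ballI allI)
    fix x assume x: "x \<in> carrier M"
    show "\<iota> x \<in> ?S" using \<iota>S[OF x] .
    show "p (cur (\<iota> x)) = x" using h(2)[OF x] cur\<iota> by simp
    show "\<iota> (x \<oplus>\<^bsub>M\<^esub> y) = \<iota> x + \<iota> y" if "y \<in> carrier M" for y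
    proof -
      have "h (x \<oplus>\<^bsub>M\<^esub> y) = h x \<oplus>\<^bsub>?F\<^esub> h y" using h(1) x that by (simp add: left_module_hom_def)
      then show ?thesis by (auto simp: \<iota>_def free_module_def fun_eq_iff)
    qed
    show "\<iota> (ring_delta c g \<odot>\<^bsub>M\<^esub> x) = fscale c (translate g (\<iota> x))" if "g \<in> carrier G" for c g
    proof -
      have "h (ring_delta c g \<odot>\<^bsub>M\<^esub> x) = ring_delta c g \<odot>\<^bsub>?F\<^esub> h x"
        using h(1) x rd[OF that] by (simp add: left_module_hom_def)
      then show ?thesis using act[OF that hc[OF x]] supp[OF hc[OF x]]
        by (auto simp: \<iota>_def fscale_def translate_def fun_eq_iff)
    qed
  next
    fix v assume v: "v \<in> ?S"
    show "p (cur v) \<in> carrier M" using pc curF v by blast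
    show "p (cur (u + v)) = p (cur u) \<oplus>\<^bsub>M\<^esub> p (cur v)" if "u \<in> ?S" for u
    proof -
      have "cur (u + v) = cur u \<oplus>\<^bsub>?F\<^esub> cur v" by (simp add: cur_def free_module_def)
      then show ?thesis using padd curF v that by simp
    qed
    show "p (cur (fscale c (translate g v))) = ring_delta c g \<odot>\<^bsub>M\<^esub> p (cur v)" if "g \<in> carrier G" for c g
    proof -
      have "cur (fscale c (translate g v)) = ring_delta c g \<odot>\<^bsub>?F\<^esub> cur v"
        using act[OF that curF[OF v]] supp[OF curF[OF v]]
        by (auto simp: cur_def fscale_def translate_def fun_eq_iff)
      then show ?thesis using psm[OF rd[OF that] curF[OF v]] by simp
    qed
  qed
  then show ?thesis by blast
qed

text \<open>Projectivity over a subgroup \<open>L\<close> and injectivity of \<open>t - 1\<close> on coinvariants pass to direct summands of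
  permutation modules.\<close>

lemma retract_projective:
  assumes L: "subgroup L G" and S: "invariant (carrier G) S"
    and e: "lhom (carrier G) (fin_supp S) M e" "M \<subseteq> fin_supp S" "\<And>v. v \<in> M \<Longrightarrow> e v = v"
  shows "projective_rel L M"
  unfolding projective_rel_def
proof (intro allI impI, elim conjE)
  fix A f g
  assume A: "submod L A" and f: "lhom L A UNIV f" and g: "lhom L M UNIV g" and gf: "g ` M \<subseteq> f ` A"
  have LG: "L \<subseteq> carrier G" using L subgroup.subset by blast
  have eL: "lhom L (fin_supp S) M e" using e(1) LG unfolding lhom_def by blast
  have eM: "e ` fin_supp S \<subseteq> M" using lhomD(1)[OF eL] by blast
  have "invariant L S" using S LG unfolding invariant_def by blast
  note fp = free_projective[OF L this]
  obtain h where h: "lhom L (fin_supp S) A h" "\<And>p. p \<in> fin_supp S \<Longrightarrow> f (h p) = g (e p)"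
    using projective_relD[OF fp A f lhom_comp[OF eL g eM]] gf eM by blast
  have "lhom L M A h" using lhom_mono[OF h(1) order_refl e(2)] lhomD(1)[OF h(1)] e(2) by blast
  moreover have "\<forall>p\<in>M. f (h p) = g p" using h(2) e(2,3) by (metis subsetD)
  ultimately show "\<exists>h. lhom L M A h \<and> (\<forall>p\<in>M. f (h p) = g p)" by blast
qed

lemma retract_regular:
  assumes L: "subgroup L G" and t: "t \<in> carrier G" "normalizes t L" "\<And>a :: int. t [^] a \<in> L \<Longrightarrow> a = 0"
    and S: "invariant (carrier G) S"
    and e: "lhom (carrier G) (fin_supp S) M e" "M \<subseteq> fin_supp S" "\<And>v. v \<in> M \<Longrightarrow> e v = v"
    and u: "u \<in> M" "dif t u \<in> aug L M"
  shows "u \<in> aug L M"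
proof -
  have LG: "L \<subseteq> carrier G" using L subgroup.subset by blast
  have eL: "lhom L (fin_supp S) M e" using e(1) LG unfolding lhom_def by blast
  have "invariant L S" using S LG unfolding invariant_def by blast
  then have SM: "submod L (fin_supp S)" by (rule submod_fin_supp[OF LG])
  have "dif t u \<in> aug L (fin_supp S)" using u(2) aug_mono[OF order_refl e(2)] by blast
  then have "u \<in> aug L (fin_supp S)" using free_regular[OF L t S] u(1) e(2) by blast
  then have "e u \<in> aug L M" by (rule lhom_aug[OF eL SM])
  then show ?thesis using e(3) u(1) by simp
qed

text \<open>Every module \<open>Q i\<close> of the given resolution is transported along its embedding \<open>\<iota> i\<close>. The trivial module
  becomes the constant functions, which are invariant under all translations.\<close>

lemma resolution_exists:
  assumes FP: "type_FP_rat G" and N: "left_noetherian (integral_group_ring G)"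
  shows "\<exists>P d \<epsilon> n. noetherian_resolution G fscale translate P d \<epsilon> (\<lambda>s. 1)
           (\<lambda>L. range (\<lambda>r::nat. fin_supp ({..<r} \<times> L))) n"
proof -
  let ?R = "rational_group_ring G"
  let ?T = "trivial_rational_module :: ('g \<Rightarrow> rat, rat) module"
  obtain n Q d \<epsilon> where
    "\<forall>i. left_module ?R (Q i :: ('g \<Rightarrow> rat, nat \<Rightarrow> 'g \<Rightarrow> rat) module) \<and> fg_left_module ?R (Q i) \<and>
       projective_left_module ?R (Q i)"
    and "\<forall>i>n. carrier (Q i) = {\<zero>\<^bsub>Q i\<^esub>}"
    and "\<forall>i. d i \<in> left_module_hom ?R (Q (Suc i)) (Q i)"
    and \<epsilon>: "\<epsilon> \<in> left_module_hom ?R (Q 0) ?T"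
    and "\<forall>i. d (Suc i) ` carrier (Q (Suc (Suc i))) = {x \<in> carrier (Q (Suc i)). d i x = \<zero>\<^bsub>Q i\<^esub>}"
    and exact0: "d 0 ` carrier (Q 1) = {x \<in> carrier (Q 0). \<epsilon> x = \<zero>\<^bsub>?T\<^esub>}"
    and surj: "\<epsilon> ` carrier (Q 0) = carrier ?T"
    using FP unfolding type_FP_rat_def by (elim exE conjE) (rule that, assumption+)
  then have Q: "\<And>i. left_module ?R (Q i)" "\<And>i. fg_left_module ?R (Q i)"
      "\<And>i. projective_left_module ?R (Q i)"
    and van: "\<And>i. i > n \<Longrightarrow> carrier (Q i) = {\<zero>\<^bsub>Q i\<^esub>}"
    and d: "\<And>i. d i \<in> left_module_hom ?R (Q (Suc i)) (Q i)"
    and exact: "\<And>i. d (Suc i) ` carrier (Q (Suc (Suc i))) = {x \<in> carrier (Q (Suc i)). d i x = \<zero>\<^bsub>Q i\<^esub>}"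
    by simp_all
  have "\<forall>i. \<exists>k \<iota> \<pi>. module_embedding (Q i) k \<iota> \<pi>" using projective_embedding[OF Q] by blast
  then obtain k \<iota> \<pi> where "\<And>i. module_embedding (Q i) (k i) (\<iota> i) (\<pi> i)" by metis
  note emb = this[unfolded module_embedding_def]
  define S where "S i = {..<k i} \<times> carrier G" for i
  have \<iota>: "\<And>i x. x \<in> carrier (Q i) \<Longrightarrow> \<iota> i x \<in> fin_supp (S i)"
      "\<And>i x. x \<in> carrier (Q i) \<Longrightarrow> \<pi> i (\<iota> i x) = x"
      "\<And>i x y. x \<in> carrier (Q i) \<Longrightarrow> y \<in> carrier (Q i) \<Longrightarrow> \<iota> i (x \<oplus>\<^bsub>Q i\<^esub> y) = \<iota> i x + \<iota> i y"
      "\<And>i c g x. g \<in> carrier G \<Longrightarrow> x \<in> carrier (Q i) \<Longrightarrow>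
         \<iota> i (ring_delta c g \<odot>\<^bsub>Q i\<^esub> x) = fscale c (translate g (\<iota> i x))"
    and \<pi>: "\<And>i v. v \<in> fin_supp (S i) \<Longrightarrow> \<pi> i v \<in> carrier (Q i)"
      "\<And>i u v. u \<in> fin_supp (S i) \<Longrightarrow> v \<in> fin_supp (S i) \<Longrightarrow> \<pi> i (u + v) = \<pi> i u \<oplus>\<^bsub>Q i\<^esub> \<pi> i v"
      "\<And>i c g v. g \<in> carrier G \<Longrightarrow> v \<in> fin_supp (S i) \<Longrightarrow>
         \<pi> i (fscale c (translate g v)) = ring_delta c g \<odot>\<^bsub>Q i\<^esub> \<pi> i v"
    using emb unfolding S_def by simp_all
  have inv: "invariant (carrier G) (S i)" for i
    unfolding S_def by (rule invariant_rows[OF subgroup_self])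
  have rd: "ring_delta c g \<in> carrier ?R" if "g \<in> carrier G" for c :: rat and g
    using ring_delta_carrier that by blast
  define P where "P i = \<iota> i ` carrier (Q i)" for i
  define D where "D i v = \<iota> i (d i (\<pi> (Suc i) v))" for i v
  define E where "E v = (\<lambda>s :: nat \<times> 'g. \<epsilon> (\<pi> 0 v))" for v
  have PS: "P i \<subseteq> fin_supp (S i)" for i using \<iota>(1) P_def by auto
  have Qz: "\<zero>\<^bsub>Q i\<^esub> \<in> carrier (Q i)" "\<And>x. x \<in> carrier (Q i) \<Longrightarrow> x \<oplus>\<^bsub>Q i\<^esub> \<zero>\<^bsub>Q i\<^esub> = x" for i
  proof -
    interpret left_module ?R "Q i" by (rule Q)
    show "\<zero>\<^bsub>Q i\<^esub> \<in> carrier (Q i)" by simp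
    show "x \<in> carrier (Q i) \<Longrightarrow> x \<oplus>\<^bsub>Q i\<^esub> \<zero>\<^bsub>Q i\<^esub> = x" for x by simp
  qed
  have Qc: "x \<oplus>\<^bsub>Q i\<^esub> y \<in> carrier (Q i)" "a \<in> carrier ?R \<Longrightarrow> a \<odot>\<^bsub>Q i\<^esub> x \<in> carrier (Q i)"
    if "x \<in> carrier (Q i)" "y \<in> carrier (Q i)" for i x y a
  proof -
    interpret left_module ?R "Q i" by (rule Q)
    show "x \<oplus>\<^bsub>Q i\<^esub> y \<in> carrier (Q i)" using that by simp
    show "a \<in> carrier ?R \<Longrightarrow> a \<odot>\<^bsub>Q i\<^esub> x \<in> carrier (Q i)" using that smult_closed by simp
  qed
  have \<iota>0: "\<iota> i \<zero>\<^bsub>Q i\<^esub> = 0" for i using \<iota>(3)[OF Qz(1)[of i] Qz(1)[of i]] Qz(2)[OF Qz(1)[of i]] by simp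
  have \<iota>_eq0: "\<iota> i x = 0 \<longleftrightarrow> x = \<zero>\<^bsub>Q i\<^esub>" if "x \<in> carrier (Q i)" for i x
    using \<iota>0 \<iota>(2) Qz(1) that by metis
  have tr1: "translate \<one> v = v" for v by (rule act_one)
  have sc1: "fscale 1 v = v" for v :: "nat \<times> 'g \<Rightarrow> rat" by (simp add: fscale_def)
  have dc: "d i x \<in> carrier (Q i)" if "x \<in> carrier (Q (Suc i))" for i x
    using d[of i] that by (auto simp: left_module_hom_def)
  have \<iota>sm: "fscale c (\<iota> i x) = \<iota> i (ring_delta c \<one> \<odot>\<^bsub>Q i\<^esub> x)"
      "g \<in> carrier G \<Longrightarrow> translate g (\<iota> i x) = \<iota> i (ring_delta 1 g \<odot>\<^bsub>Q i\<^esub> x)"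
    if "x \<in> carrier (Q i)" for c i x g
    using \<iota>(4)[OF one_closed that, of c] \<iota>(4)[OF _ that, of g 1] by (simp_all add: tr1 sc1)
  have \<pi>sm: "\<pi> i (fscale c v) = ring_delta c \<one> \<odot>\<^bsub>Q i\<^esub> \<pi> i v"
      "g \<in> carrier G \<Longrightarrow> \<pi> i (translate g v) = ring_delta 1 g \<odot>\<^bsub>Q i\<^esub> \<pi> i v"
    if "v \<in> fin_supp (S i)" for c i v g
    using \<pi>(3)[OF one_closed that, of c] \<pi>(3)[OF _ that, of g 1] by (simp_all add: tr1 sc1)
  have e: "lhom (carrier G) (fin_supp (S i)) (P i) (\<lambda>v. \<iota> i (\<pi> i v))" for i
    by (rule lhomI) (simp_all add: P_def \<iota>(3,4) \<pi>(1,2) \<pi>sm tr1 sc1)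
  have eP: "\<iota> i (\<pi> i v) = v" if "v \<in> P i" for i v using that \<iota>(2) by (auto simp: P_def)
  have Psub: "submod (carrier G) (P i)" for i
    unfolding submod_def
  proof (intro conjI ballI fn.subspaceI)
    show "0 \<in> P i" using \<iota>0[of i] Qz(1)[of i] unfolding P_def by (metis imageI)
  next
    fix x assume "x \<in> P i"
    then obtain u where u: "u \<in> carrier (Q i)" "x = \<iota> i u" by (auto simp: P_def)
    show "x + y \<in> P i" if "y \<in> P i" for y
    proof -
      obtain v where v: "v \<in> carrier (Q i)" "y = \<iota> i v" using \<open>y \<in> P i\<close> by (auto simp: P_def)
      have "x + y = \<iota> i (u \<oplus>\<^bsub>Q i\<^esub> v)" using u v \<iota>(3) by simp
      then show ?thesis using Qc(1)[OF u(1) v(1)] by (simp add: P_def)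
    qed
    show "fscale c x \<in> P i" for c
      using Qc(2)[OF u(1) u(1) rd[OF one_closed]] u(2) \<iota>sm(1)[OF u(1)] by (simp add: P_def)
    show "translate g x \<in> P i" if "g \<in> carrier G" for g
      using Qc(2)[OF u(1) u(1) rd[OF that]] u(2) \<iota>sm(2)[OF u(1) that] by (simp add: P_def)
  qed
  have dD: "D i (\<iota> (Suc i) x) = \<iota> i (d i x)" if "x \<in> carrier (Q (Suc i))" for i x
    using \<iota>(2)[OF that] by (simp add: D_def)
  have \<epsilon>E: "E (\<iota> 0 x) = (\<lambda>s. \<epsilon> x)" if "x \<in> carrier (Q 0)" for x
    using \<iota>(2)[OF that] by (simp add: E_def)
  have dhom: "d i (x \<oplus>\<^bsub>Q (Suc i)\<^esub> y) = d i x \<oplus>\<^bsub>Q i\<^esub> d i y"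
      "a \<in> carrier ?R \<Longrightarrow> d i (a \<odot>\<^bsub>Q (Suc i)\<^esub> x) = a \<odot>\<^bsub>Q i\<^esub> d i x"
    if "x \<in> carrier (Q (Suc i))" "y \<in> carrier (Q (Suc i))" for i x y a
    using d[of i] that by (auto simp: left_module_hom_def)
  have \<epsilon>hom: "\<epsilon> (x \<oplus>\<^bsub>Q 0\<^esub> y) = \<epsilon> x + \<epsilon> y"
      "a \<in> carrier ?R \<Longrightarrow> \<epsilon> (a \<odot>\<^bsub>Q 0\<^esub> x) = (\<Sum>g | a g \<noteq> 0. a g) * \<epsilon> x"
    if "x \<in> carrier (Q 0)" "y \<in> carrier (Q 0)" for x y a
    using \<epsilon> that by (auto simp: left_module_hom_def trivial_rational_module_def)
  have rdsum: "(\<Sum>h | ring_delta c g h \<noteq> 0. ring_delta c g h) = c" for c :: rat and g :: 'g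
  proof (cases "c = 0")
    case False
    then have "{h. ring_delta c g h \<noteq> 0} = {g}" by (auto simp: ring_delta_def)
    then show ?thesis by (simp add: ring_delta_def)
  qed (simp add: ring_delta_def)
  have "noetherian_resolution G fscale translate P D E (\<lambda>s. 1)
      (\<lambda>L. range (\<lambda>r::nat. fin_supp ({..<r} \<times> L))) n"
  proof (unfold_locales)
    show "submod (carrier G) (P j)" for j by (rule Psub)
    show "lhom (carrier G) (P (Suc j)) (P j) (D j)" for j
    proof (rule lhomI)
      fix v assume "v \<in> P (Suc j)"
      then obtain x where x: "x \<in> carrier (Q (Suc j))" "v = \<iota> (Suc j) x" by (auto simp: P_def)
      show "D j v \<in> P j" using x dc by (simp add: dD P_def)
      show "D j (fscale c v) = fscale c (D j v)" for c
        using x dc Qc(2)[OF x(1) x(1) rd[OF one_closed]] dhom(2)[OF x(1) x(1) rd[OF one_closed]]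
        by (simp add: dD \<iota>sm)
      show "D j (translate g v) = translate g (D j v)" if "g \<in> carrier G" for g
        using x dc that Qc(2)[OF x(1) x(1) rd[OF that]] dhom(2)[OF x(1) x(1) rd[OF that]]
        by (simp add: dD \<iota>sm)
      show "D j (v + u) = D j v + D j u" if u: "u \<in> P (Suc j)" for u
      proof -
        obtain y where y: "y \<in> carrier (Q (Suc j))" "u = \<iota> (Suc j) y" using u by (auto simp: P_def)
        have "v + u = \<iota> (Suc j) (x \<oplus>\<^bsub>Q (Suc j)\<^esub> y)" using x y \<iota>(3) by simp
        then have "D j (v + u) = \<iota> j (d j x \<oplus>\<^bsub>Q j\<^esub> d j y)"
          using dD[OF Qc(1)[OF x(1) y(1)]] dhom(1)[OF x(1) y(1)] by simp
        then show ?thesis using x y dc by (simp add: dD \<iota>(3))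
      qed
    qed
    show "D (Suc j) ` P (Suc (Suc j)) = {p \<in> P (Suc j). D j p = 0}" for j
    proof -
      have "D (Suc j) ` P (Suc (Suc j)) = \<iota> (Suc j) ` d (Suc j) ` carrier (Q (Suc (Suc j)))"
        by (auto simp: P_def dD image_image)
      also have "\<dots> = {p \<in> P (Suc j). D j p = 0}"
        unfolding exact using dc \<iota>_eq0 \<iota>0 by (auto simp: P_def dD)
      finally show ?thesis .
    qed
    show "lhom (carrier G) (P 0) UNIV E"
    proof (rule lhomI)
      fix v assume "v \<in> P 0"
      then obtain x where x: "x \<in> carrier (Q 0)" "v = \<iota> 0 x" by (auto simp: P_def)
      have smul: "E (\<iota> 0 (ring_delta c g \<odot>\<^bsub>Q 0\<^esub> x)) = (\<lambda>s. c * \<epsilon> x)" if "g \<in> carrier G" for c g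
        using \<epsilon>E[OF Qc(2)[OF x(1) x(1) rd[OF that]]] \<epsilon>hom(2)[OF x(1) x(1) rd[OF that]] rdsum by simp
      show "E (fscale c v) = fscale c (E v)" for c
        unfolding x(2) \<iota>sm(1)[OF x(1)] smul[OF one_closed] \<epsilon>E[OF x(1)] by (simp add: fscale_def)
      show "E (translate g v) = translate g (E v)" if "g \<in> carrier G" for g
        unfolding x(2) \<iota>sm(2)[OF x(1) that] smul[OF that] \<epsilon>E[OF x(1)] by (auto simp: translate_def)
      show "E (v + u) = E v + E u" if u: "u \<in> P 0" for u
      proof -
        obtain y where y: "y \<in> carrier (Q 0)" "u = \<iota> 0 y" using u by (auto simp: P_def)
        have "v + u = \<iota> 0 (x \<oplus>\<^bsub>Q 0\<^esub> y)" using x y \<iota>(3) by simp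
        then have vu: "E (v + u) = (\<lambda>s. \<epsilon> x + \<epsilon> y)"
          using \<epsilon>E[OF Qc(1)[OF x(1) y(1)]] \<epsilon>hom(1)[OF x(1) y(1)] by simp
        show ?thesis unfolding vu unfolding x(2) y(2) \<epsilon>E[OF x(1)] \<epsilon>E[OF y(1)]
          by (simp add: fun_eq_iff)
      qed
    qed simp
    show "D 0 ` P (Suc 0) = {p \<in> P 0. E p = 0}"
    proof -
      have "D 0 ` P (Suc 0) = \<iota> 0 ` d 0 ` carrier (Q 1)"
        by (auto simp: P_def dD image_image)
      also have "\<dots> = {p \<in> P 0. E p = 0}"
        unfolding exact0 by (auto simp: P_def \<epsilon>E trivial_rational_module_def fun_eq_iff)
      finally show ?thesis .
    qed
    show "E ` P 0 = range (\<lambda>c. fscale c (\<lambda>s. 1))"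
    proof -
      have "E ` P 0 = (\<lambda>q s. q) ` \<epsilon> ` carrier (Q 0)" by (auto simp: P_def \<epsilon>E image_image)
      also have "\<dots> = range (\<lambda>c. fscale c (\<lambda>s. 1))"
        unfolding surj by (simp add: trivial_rational_module_def fscale_def)
      finally show ?thesis .
    qed
    show "(\<lambda>s :: nat \<times> 'g. 1 :: rat) \<noteq> 0" by (simp add: fun_eq_iff)
    show "translate g (\<lambda>s. 1) = (\<lambda>s. 1)" for g by (auto simp: translate_def)
    show "P j = {0}" if "j > n" for j unfolding P_def van[OF that] using \<iota>0 by simp
    fix L assume L: "subgroup L G"
    then have LG: "L \<subseteq> carrier G" using subgroup.subset by blast
    show "projective_rel L (P j)" for j by (rule retract_projective[OF L inv e PS eP])
    show "u \<in> aug L (P j)" if "t \<in> carrier G" "normalizes t L" "\<And>a :: int. t [^] a \<in> L \<Longrightarrow> a = 0"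
      "u \<in> P j" "dif t u \<in> aug L (P j)" for t u j
      by (rule retract_regular[OF L that(1-3) inv e PS eP that(4,5)])
    show "\<exists>F\<in>range (\<lambda>r::nat. fin_supp ({..<r} \<times> L)). \<exists>\<rho>. lhom L F UNIV \<rho> \<and>
        \<rho> ` F = range (\<lambda>c. fscale c (\<lambda>s. 1))"
    proof -
      let ?w = "(\<lambda>s. 1) :: nat \<times> 'g \<Rightarrow> rat"
      let ?E = "range (\<lambda>c. fscale c ?w)"
      have trw: "translate g ?w = ?w" for g by (auto simp: translate_def)
      have E: "submod L ?E"
        unfolding submod_def
      proof (intro conjI ballI fn.subspaceI)
        show "0 \<in> ?E" by (rule image_eqI[of _ _ 0]) (auto simp: fscale_def fun_eq_iff)
        show "x + y \<in> ?E" if "x \<in> ?E" "y \<in> ?E" for x y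
          using that by (auto simp flip: fn.scale_left_distrib)
        show "fscale c x \<in> ?E" if "x \<in> ?E" for c x using that by auto
        show "translate l x \<in> ?E" if "x \<in> ?E" for l x using that by (auto simp: act_scale trw)
      qed
      have wE: "?w \<in> ?E" using sc1 by (metis rangeI)
      have "?E \<subseteq> lspan L {?w}"
      proof
        fix x assume "x \<in> ?E"
        then obtain c where x: "x = fscale c ?w" by blast
        have "?w \<in> {translate l t | l t. l \<in> L \<and> t \<in> {?w}}"
          using trw[of \<one>] subgroup.one_closed[OF L] by force
        then show "x \<in> lspan L {?w}" unfolding x lspan_def by (intro fn.span_scale fn.span_base)
      qed
      from finite_free_cover[OF L E _ _ this] wE show ?thesis by blast
    qed
    fix F assume "F \<in> range (\<lambda>r::nat. fin_supp ({..<r} \<times> L))"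
    then obtain r :: nat where F: "F = fin_supp ({..<r} \<times> L)" by blast
    show "submod L F" unfolding F by (rule submod_fin_supp[OF LG invariant_rows[OF L]])
    show "projective_rel L F" unfolding F by (rule free_projective[OF L invariant_rows[OF L]])
    show "finite_codim (aug L F) F" unfolding F by (rule finite_codim_free[OF L])
    fix E' assume E': "submod L E'" "E' \<subseteq> F"
    obtain T where T: "finite T" "T \<subseteq> E'" "E' \<subseteq> lspan L T"
      using submodule_fg[OF N L E'(1) E'(2)[unfolded F]] by blast
    show "\<exists>F'\<in>range (\<lambda>r::nat. fin_supp ({..<r} \<times> L)). \<exists>\<rho>. lhom L F' UNIV \<rho> \<and> \<rho> ` F' = E'"
      using finite_free_cover[OF L E'(1) T] by blast
  qed
  then show ?thesis by blast
qed

end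

section \<open>Torsion in the abelianization and subgroups of finite index\<close>

lemma tensor_relations_subset:
  assumes "monoid A" "monoid B"
  shows "tensor_relations A B \<subseteq> carrier (free_Abelian_group (carrier A \<times> carrier B))"
proof -
  interpret A: monoid A by fact
  interpret B: monoid B by fact
  have "Poly_Mapping.keys (frag_of x - frag_of y - frag_of z) \<subseteq> {x, y, z}" for x y z :: "'a \<times> 'c"
    using keys_diff[of "frag_of x - frag_of y" "frag_of z"] keys_diff[of "frag_of x" "frag_of y"]
    by auto
  note keys = subset_trans[OF this]
  show ?thesis unfolding tensor_relations_def by (auto intro!: keys)
qed

text \<open>By induction on \<open>k\<close> from biadditivity: both elements represent the \<open>k\<close>-fold multiple of \<open>a \<otimes> b\<close>.\<close>

lemma tensor_balanced:
  fixes k :: nat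
  assumes A: "monoid A" and B: "monoid B" and a: "a \<in> carrier A" and b: "b \<in> carrier B"
  shows "frag_of (a [^]\<^bsub>A\<^esub> k, b) - frag_of (a, b [^]\<^bsub>B\<^esub> k) \<in> tensor_kernel A B"
proof -
  interpret A: monoid A by fact
  interpret B: monoid B by fact
  let ?F = "free_Abelian_group (carrier A \<times> carrier B)"
  interpret F: comm_group ?F by (rule abelian_free_Abelian_group)
  have K: "subgroup (tensor_kernel A B) ?F"
    unfolding tensor_kernel_def by (rule F.generate_is_subgroup[OF tensor_relations_subset[OF A B]])
  have rel: "r \<in> tensor_kernel A B" if "r \<in> tensor_relations A B" for r
    unfolding tensor_kernel_def using that by (rule generate.incl)
  have add: "x + y \<in> tensor_kernel A B" if "x \<in> tensor_kernel A B" "y \<in> tensor_kernel A B" for x y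
    using subgroup.m_closed[OF K that] by simp
  have neg: "- x \<in> tensor_kernel A B" if "x \<in> tensor_kernel A B" for x
    using subgroup.m_inv_closed[OF K that] subgroup.mem_carrier[OF K that] by simp
  have left: "frag_of (x \<otimes>\<^bsub>A\<^esub> x', y) - frag_of (x, y) - frag_of (x', y) \<in> tensor_kernel A B"
    if "x \<in> carrier A" "x' \<in> carrier A" "y \<in> carrier B" for x x' y
    using that by (intro rel) (auto simp: tensor_relations_def)
  have right: "frag_of (x, y \<otimes>\<^bsub>B\<^esub> y') - frag_of (x, y) - frag_of (x, y') \<in> tensor_kernel A B"
    if "x \<in> carrier A" "y \<in> carrier B" "y' \<in> carrier B" for x y y'
    using that by (intro rel) (auto simp: tensor_relations_def)
  show ?thesis
  proof (induction k)
    case 0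
    have "- frag_of (\<one>\<^bsub>A\<^esub>, b) \<in> tensor_kernel A B" "- frag_of (a, \<one>\<^bsub>B\<^esub>) \<in> tensor_kernel A B"
      using left[of "\<one>\<^bsub>A\<^esub>" "\<one>\<^bsub>A\<^esub>" b] right[of a "\<one>\<^bsub>B\<^esub>" "\<one>\<^bsub>B\<^esub>"] a b by auto
    then show ?case using add[OF neg, of "- frag_of (\<one>\<^bsub>A\<^esub>, b)" "- frag_of (a, \<one>\<^bsub>B\<^esub>)"] by simp
  next
    case (Suc k)
    let ?l = "frag_of (a [^]\<^bsub>A\<^esub> Suc k, b) - frag_of (a [^]\<^bsub>A\<^esub> k, b) - frag_of (a, b)"
    let ?r = "frag_of (a, b [^]\<^bsub>B\<^esub> Suc k) - frag_of (a, b [^]\<^bsub>B\<^esub> k) - frag_of (a, b)"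
    have "?l \<in> tensor_kernel A B" "?r \<in> tensor_kernel A B"
      using left[of "a [^]\<^bsub>A\<^esub> k" a b] right[of a "b [^]\<^bsub>B\<^esub> k" b] a b by simp_all
    then have "?l + - ?r + (frag_of (a [^]\<^bsub>A\<^esub> k, b) - frag_of (a, b [^]\<^bsub>B\<^esub> k)) \<in> tensor_kernel A B"
      using add neg Suc by blast
    then show ?case by (simp add: algebra_simps)
  qed
qed

text \<open>Torsion dies in the rational abelianization: \<open>1 \<otimes> g = (1/k) \<otimes> g\<^sup>k = 0\<close> if \<open>g\<^sup>k\<close> is a product of
  commutators.\<close>

lemma (in group) torsion_in_kernel:
  assumes g: "g \<in> carrier G" and k: "k > 0" "g [^] (k::nat) \<in> derived G (carrier G)"
  shows "g \<in> kernel G (rational_abelianization G) (rational_abelianization_map G)"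
proof -
  let ?D = "derived G (carrier G)"
  let ?B = "abelianization G"
  let ?F = "free_Abelian_group (carrier rational_group \<times> carrier ?B)"
  have D: "?D \<lhd> G" by (rule derived_self_is_normal)
  interpret D: normal ?D G by (rule D)
  have A: "monoid rational_group" by (rule monoidI) (simp_all add: rational_group_def)
  have B: "monoid ?B" unfolding abelianization_def using D.factorgroup_is_group group.is_monoid by blast
  interpret F: comm_group ?F by (rule abelian_free_Abelian_group)
  have K: "subgroup (tensor_kernel rational_group ?B) ?F"
    unfolding tensor_kernel_def by (rule F.generate_is_subgroup[OF tensor_relations_subset[OF A B]])
  have gB: "?D #> g \<in> carrier ?B" using g by (auto simp: abelianization_def carrier_FactGroup)
  have oneB: "\<one>\<^bsub>?B\<^esub> \<in> carrier ?B" using B by (rule monoid.one_closed)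
  have "(?D #> g) [^]\<^bsub>?B\<^esub> k = ?D #> (g [^] k)"
    unfolding abelianization_def by (rule D.FactGroup_pow[OF g])
  also have "\<dots> = ?D" using coset_join2[OF _ D.subgroup_axioms k(2)] g by simp
  finally have powB: "(?D #> g) [^]\<^bsub>?B\<^esub> k = \<one>\<^bsub>?B\<^esub>" by (simp add: abelianization_def)
  have powA: "(1 / rat_of_nat k) [^]\<^bsub>rational_group\<^esub> j = rat_of_nat j / rat_of_nat k" for j
  proof (induction j)
    case (Suc j)
    then show ?case by (simp add: rational_group_def add_divide_distrib)
  qed (simp add: rational_group_def)
  have carA: "1 / rat_of_nat k \<in> carrier rational_group" by (simp add: rational_group_def)
  have "frag_of (1, ?D #> g) - frag_of (1 / rat_of_nat k, \<one>\<^bsub>?B\<^esub>) \<in> tensor_kernel rational_group ?B"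
    using tensor_balanced[OF A B carA gB, of k] k(1) by (simp add: powA powB)
  moreover have "frag_of (1 / rat_of_nat k, \<one>\<^bsub>?B\<^esub>) \<in> tensor_kernel rational_group ?B"
  proof -
    have "- frag_of (1 / rat_of_nat k, \<one>\<^bsub>?B\<^esub>) \<in> tensor_relations rational_group ?B"
      unfolding tensor_relations_def
    proof (rule UnI2, rule CollectI, intro exI conjI)
      show "- frag_of (1 / rat_of_nat k, \<one>\<^bsub>?B\<^esub>) = frag_of (1 / rat_of_nat k, \<one>\<^bsub>?B\<^esub> \<otimes>\<^bsub>?B\<^esub> \<one>\<^bsub>?B\<^esub>)
          - frag_of (1 / rat_of_nat k, \<one>\<^bsub>?B\<^esub>) - frag_of (1 / rat_of_nat k, \<one>\<^bsub>?B\<^esub>)"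
        using monoid.l_one[OF B oneB] by simp
    qed (use carA oneB in auto)
    then have m: "- frag_of (1 / rat_of_nat k, \<one>\<^bsub>?B\<^esub>) \<in> tensor_kernel rational_group ?B"
      unfolding tensor_kernel_def by (rule generate.incl)
    show ?thesis using subgroup.m_inv_closed[OF K m] subgroup.mem_carrier[OF K m] by simp
  qed
  ultimately have "frag_of (1, ?D #> g) \<in> tensor_kernel rational_group ?B"
    using subgroup.m_closed[OF K] by fastforce
  then have "rational_abelianization_map G g = tensor_kernel rational_group ?B"
    unfolding rational_abelianization_map_def pure_tensor_def
    using F.coset_join2[OF _ K] subgroup.mem_carrier[OF K] by blast
  then show ?thesis
    using g by (simp add: kernel_def rational_abelianization_def tensor_group_def)
qed

lemma (in group) finite_index_subgroup_trans:
  assumes H: "finite_index_subgroup H G" and K: "finite_index_subgroup K (restrict_group G H)"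
  shows "finite_index_subgroup K G"
proof -
  have HG: "subgroup H G" "finite (rcosets H)" using H by (auto simp: finite_index_subgroup_def)
  have KH: "subgroup K (restrict_group G H)" "finite (rcosets\<^bsub>restrict_group G H\<^esub> K)"
    using K by (auto simp: finite_index_subgroup_def)
  have KG: "subgroup K G" using incl_subgroup[OF HG(1) KH(1)] .
  define r where "r Y = (SOME y. y \<in> Y)" for Y :: "'a set"
  define f where "f p = fst p #> r (snd p)" for p
  have "rcosets K \<subseteq> f ` ((rcosets\<^bsub>restrict_group G H\<^esub> K) \<times> (rcosets H))"
  proof
    fix Z assume "Z \<in> rcosets K"
    then obtain a where a: "a \<in> carrier G" "Z = K #> a" by (auto simp: RCOSETS_def)
    define Y where "Y = H #> a"
    have aY: "a \<in> Y" unfolding Y_def using rcos_self[OF a(1) HG(1)] .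
    then have rY: "r Y \<in> Y" unfolding r_def by (rule someI)
    then have "H #> r Y = Y" using repr_independence[OF _ a(1) HG(1)] Y_def by metis
    then obtain h where h: "h \<in> H" "a = h \<otimes> r Y" using aY by (auto simp: r_coset_def)
    have rG: "r Y \<in> carrier G"
      using rY a(1) subgroup.mem_carrier[OF HG(1)] unfolding Y_def r_coset_def by auto
    have "Z = (K #> h) #> r Y"
      using a h rG subgroup.mem_carrier[OF HG(1)] subgroup.subset[OF KG] by (simp add: coset_mult_assoc)
    moreover have "K #> h \<in> rcosets\<^bsub>restrict_group G H\<^esub> K" using h by (auto simp: RCOSETS_def)
    moreover have "Y \<in> rcosets H" using a by (auto simp: RCOSETS_def Y_def)
    moreover have "(K #> h) #> r Y = f (K #> h, Y)" by (simp add: f_def)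
    ultimately show "Z \<in> f ` ((rcosets\<^bsub>restrict_group G H\<^esub> K) \<times> (rcosets H))" by blast
  qed
  then have "finite (rcosets K)" using HG(2) KH(2) finite_subset by blast
  then show ?thesis using KG by (simp add: finite_index_subgroup_def)
qed

section \<open>RFRS groups with towers of bounded length\<close>

context group
begin

lemma finite_index_uniform_power:
  assumes N: "N \<lhd> G" "finite (rcosets N)"
  obtains e :: nat where "e > 0" "\<And>x. x \<in> carrier G \<Longrightarrow> x [^] e \<in> N"
proof -
  interpret N: normal N G by (rule N)
  interpret Q: group "G Mod N" by (rule N.factorgroup_is_group)
  have fin: "finite (carrier (G Mod N))" using N(2) by (simp add: FactGroup_def)
  have "x [^] order (G Mod N) \<in> N" if x: "x \<in> carrier G" for x
  proof -
    have "N #> x \<in> carrier (G Mod N)" using x by (auto simp: carrier_FactGroup)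
    then have "(N #> x) [^]\<^bsub>G Mod N\<^esub> order (G Mod N) = \<one>\<^bsub>G Mod N\<^esub>" by (rule Q.pow_order_eq_1)
    then have "N #> (x [^] order (G Mod N)) = N" using N.FactGroup_pow[OF x] by simp
    then show ?thesis using coset_join1[OF _ nat_pow_closed[OF x] N.subgroup_axioms] by blast
  qed
  moreover have "order (G Mod N) > 0" using Q.order_gt_0_iff_finite fin by simp
  ultimately show ?thesis using that by metis
qed

text \<open>Among all towers over the commutator subgroups of the members of the chain, a longest one exists; let it
  belong to \<open>C i\<close>. Suitable powers of its elements form a tower in every later \<open>C l\<close>, which cannot be
  prolonged, so every element of \<open>C l\<close> has a nontrivial power in the top group of that tower. Elements
  that are torsion modulo \<open>[C i, C i]\<close> are therefore torsion modulo \<open>[C l, C l]\<close> by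
  \<open>tower_power_descend\<close>, and the RFRS condition moves them down the chain.\<close>

lemma RFRS_bounded_towers:
  assumes H: "subgroup H G" and RFRS: "RFRS (restrict_group G H)"
    and bound: "\<And>K ts. subgroup K G \<Longrightarrow> set ts \<subseteq> K \<Longrightarrow> tower (derived G K) ts \<Longrightarrow> length ts \<le> n"
  shows "\<exists>K. finite_index_subgroup K (restrict_group G H) \<and> comm_group (restrict_group G K)"
proof -
  let ?H = "restrict_group G H"
  obtain C where C: "\<And>i::nat. C i \<lhd> ?H" "\<And>i. finite_index_subgroup (C i) ?H" "\<And>i. C (Suc i) \<subseteq> C i"
    "(\<Inter>i. C i) = {\<one>}"
    and ker: "\<And>i. kernel (restrict_group ?H (C i)) (rational_abelianization (restrict_group ?H (C i)))
              (rational_abelianization_map (restrict_group ?H (C i))) \<subseteq> C (Suc i)"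
  proof -
    from RFRS obtain C where "C 0 = carrier ?H"
      "\<forall>i. C i \<lhd> ?H \<and> finite_index_subgroup (C i) ?H \<and> C (Suc i) \<subseteq> C i" "(\<Inter>i. C i) = {\<one>\<^bsub>?H\<^esub>}"
      "\<forall>i. kernel (restrict_group ?H (C i)) (rational_abelianization (restrict_group ?H (C i)))
              (rational_abelianization_map (restrict_group ?H (C i))) \<subseteq> C (Suc i)"
      unfolding RFRS_def by (elim conjE exE) (rule that, assumption+)
    then show thesis by (intro that[of C]) simp_all
  qed
  have Hgrp: "group ?H" using subgroup_imp_group[OF H] .
  have CG: "subgroup (C i) G" for i using incl_subgroup[OF H normal_imp_subgroup[OF C(1)]] .
  have CH: "C i \<subseteq> H" for i using subgroup.subset[OF normal_imp_subgroup[OF C(1)], of i] by simp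
  have anti: "i \<le> j \<Longrightarrow> C j \<subseteq> C i" for i j using C(3) by (rule lift_Suc_antimono_le)
  define D where "D i = derived G (C i)" for i
  have DG: "subgroup (D i) G" for i
    unfolding D_def by (rule derived_is_subgroup[OF subgroup.subset[OF CG]])
  have DC: "D i \<subseteq> C i" for i unfolding D_def by (rule derived_incl[OF order_refl CG])
  have Dcom: "commutators_in (C i) (D i)" for i unfolding D_def by (rule commutators_in_derived)
  have step: "g \<in> C (Suc i)" if g: "g \<in> C i" and k: "k > 0" "g [^] (k::nat) \<in> D i" for g k i
  proof -
    interpret Ci: group "restrict_group G (C i)" by (rule subgroup_imp_group[OF CG])
    have "g \<in> kernel (restrict_group G (C i)) (rational_abelianization (restrict_group G (C i)))
              (rational_abelianization_map (restrict_group G (C i)))"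
    proof (rule Ci.torsion_in_kernel[OF _ k(1)])
      show "g \<in> carrier (restrict_group G (C i))" using g by simp
      have "derived (restrict_group G (C i)) (C i) = D i"
        unfolding D_def by (rule derived_consistent[OF order_refl CG])
      then show "g [^]\<^bsub>restrict_group G (C i)\<^esub> k
          \<in> derived (restrict_group G (C i)) (carrier (restrict_group G (C i)))"
        using k(2) by (simp flip: nat_pow_consistent)
    qed
    then show ?thesis using ker[of i] by auto
  qed
  define Len where "Len = {length ts | ts i. set ts \<subseteq> C i \<and> tower (D i) ts}"
  have Len_n: "Len \<subseteq> {..n}" using bound[OF CG] unfolding Len_def D_def by auto
  then have fin: "finite Len" using finite_subset by blast
  have "length ([] :: 'a list) \<in> Len" unfolding Len_def by fastforce
  then have "Max Len \<in> Len" using fin Max_in by blast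
  then obtain ts i where ts: "set ts \<subseteq> C i" "tower (D i) ts" "length ts = Max Len"
    unfolding Len_def by auto
  define N where "N = {g \<in> C i. \<exists>k>0. g [^] (k::nat) \<in> D i}"
  have "N \<subseteq> C (i + j)" for j
  proof (induction j)
    case 0
    then show ?case by (auto simp: N_def)
  next
    case (Suc j)
    define l where "l = i + j"
    have li: "C l \<subseteq> C i" using anti l_def by simp
    have Dli: "D l \<subseteq> D i" unfolding D_def by (rule mono_derived[OF li])
    obtain e :: nat where e: "e > 0" "\<And>x. x \<in> H \<Longrightarrow> x [^] e \<in> C l"
    proof -
      have "finite (rcosets\<^bsub>?H\<^esub> C l)" using C(2) by (simp add: finite_index_subgroup_def)
      from group.finite_index_uniform_power[OF Hgrp C(1) this] obtain e :: nat where
        "e > 0" "\<And>x. x \<in> carrier ?H \<Longrightarrow> x [^]\<^bsub>?H\<^esub> e \<in> C l" by blast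
      then show thesis using that[of e] by (simp flip: nat_pow_consistent)
    qed
    define ss where "ss = map (\<lambda>t. t [^] e) ts"
    have tsG: "set ts \<subseteq> carrier G" using ts(1) subgroup.subset[OF CG] by blast
    have ssC: "(\<lambda>t. t [^] e) ` set ts \<subseteq> C l" using ts(1) CH e(2) by blast
    then have ssC': "set ss \<subseteq> C l" by (simp add: ss_def)
    have tow: "tower (D l) ss" unfolding ss_def by (rule tower_powers[OF Dli tsG ts(2) e(1)])
    show ?case
    proof
      fix g assume g: "g \<in> N"
      then have gl: "g \<in> C l" using Suc l_def by blast
      have gG: "g \<in> carrier G" using gl subgroup.mem_carrier[OF CG] by blast
      obtain k :: nat where k: "k > 0" "g [^] k \<in> D i" using g by (auto simp: N_def)
      have "\<not> tower (D l) (ss @ [g])"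
      proof
        assume "tower (D l) (ss @ [g])"
        then have "length (ss @ [g]) \<in> Len" unfolding Len_def using ssC' gl by fastforce
        then have "length (ss @ [g]) \<le> Max Len" using fin by simp
        then show False using ts(3) by (simp add: ss_def)
      qed
      then obtain a :: int where a: "g [^] a \<in> foldl adjoin (D l) ss" "a \<noteq> 0"
        using tow unfolding tower_snoc by blast
      have sub: "subgroup (foldl adjoin (D l) ss) G"
        by (rule foldl_adjoin_subgroup[OF CG DG DC Dcom ssC'])
      have "g [^] \<bar>a\<bar> \<in> foldl adjoin (D l) ss"
        using a subgroup.m_inv_closed[OF sub a(1)] gG by (cases "a \<ge> 0") (auto simp: int_pow_neg)
      moreover define b where "b = nat \<bar>a\<bar>"
      then have "int b = \<bar>a\<bar>" "b > 0" using a(2) by auto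
      ultimately have ga: "g [^] b \<in> foldl adjoin (D l) ss" using int_pow_int[of G g b] by simp
      have "(g [^] b) [^] k = (g [^] k) [^] b" using gG by (simp add: nat_pow_pow mult.commute)
      also have "\<dots> \<in> D i"
        using subgroup_int_pow_closed[OF DG k(2), of "int b"] by (simp only: int_pow_int)
      finally have "(g [^] b) [^] k \<in> D i" .
      then have "g [^] b \<in> D l"
        using tower_power_descend[OF CG DG DC Dcom CG DG DC Dcom Dli ts(1) ssC ts(2) e(1) ga[unfolded ss_def] _ k(1)]
        by blast
      then show "g \<in> C (i + Suc j)" using step[OF gl \<open>b > 0\<close>] l_def by simp
    qed
  qed
  then have "N \<subseteq> C j" for j using anti[of j "i + j"] by fastforce
  then have "N \<subseteq> {\<one>}" using C(4) by blast
  moreover have "D i \<subseteq> N"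
  proof
    fix g assume g: "g \<in> D i"
    then have "g [^] (1::nat) \<in> D i" using subgroup.mem_carrier[OF DG] by simp
    then show "g \<in> N" unfolding N_def using g DC by (intro CollectI conjI exI[of _ 1]) auto
  qed
  ultimately have D1: "D i \<subseteq> {\<one>}" by blast
  have "comm_group (restrict_group G (C i))"
  proof (rule group.group_comm_groupI)
    show "group (restrict_group G (C i))" by (rule subgroup_imp_group[OF CG])
    fix x y assume "x \<in> carrier (restrict_group G (C i))" "y \<in> carrier (restrict_group G (C i))"
    then have xy: "x \<in> C i" "y \<in> C i" by auto
    then have G: "x \<in> carrier G" "y \<in> carrier G" using subgroup.mem_carrier[OF CG] by auto
    have c: "x \<otimes> y \<otimes> inv x \<otimes> inv y = \<one>"
      using Dcom xy D1 unfolding commutators_in_def by blast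
    have "x \<otimes> y = (x \<otimes> y \<otimes> inv x \<otimes> inv y) \<otimes> (y \<otimes> x)"
    proof -
      have "inv y \<otimes> (y \<otimes> x) = x" using G by (simp flip: m_assoc)
      then show ?thesis using G by (simp add: m_assoc)
    qed
    then show "x \<otimes>\<^bsub>restrict_group G (C i)\<^esub> y = y \<otimes>\<^bsub>restrict_group G (C i)\<^esub> x" using c G by simp
  qed
  then show ?thesis using C(2) by blast
qed

end

section \<open>Virtually RFRS groups with Noetherian group ring\<close>

theorem corollaryE:
  fixes G :: "('g, 'm) monoid_scheme"
  assumes "group G"
    and "virtually_RFRS G"
    and "type_FP_rat G"
    and "left_noetherian (integral_group_ring G)"
  shows "virtually_abelian G"
proof -
  interpret permutation_modules G by (rule permutation_modules.intro[OF assms(1)])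
  obtain P d \<epsilon> n where res: "noetherian_resolution G fscale translate P d \<epsilon> (\<lambda>s. 1)
      (\<lambda>L. range (\<lambda>r::nat. fin_supp ({..<r} \<times> L))) n"
    using resolution_exists[OF assms(3,4)] by blast
  have bound: "length ts \<le> n" if "subgroup K G" "set ts \<subseteq> K" "tower (derived G K) ts" for K ts
    using noetherian_resolution.tower_length_le[OF res that(1)
        derived_is_subgroup[OF subgroup.subset[OF that(1)]] derived_incl[OF order_refl that(1)]
        commutators_in_derived that(2,3)] .
  obtain H where H: "finite_index_subgroup H G" "RFRS (restrict_group G H)"
    using assms(2) by (auto simp: virtually_RFRS_def)
  have "subgroup H G" using H(1) by (simp add: finite_index_subgroup_def)
  have "\<exists>K. finite_index_subgroup K (restrict_group G H) \<and> comm_group (restrict_group G K)"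
    by (rule RFRS_bounded_towers[OF \<open>subgroup H G\<close> H(2)]) (rule bound)
  then show ?thesis
    using finite_index_subgroup_trans[OF H(1)] by (auto simp: virtually_abelian_def)
qed

end
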